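(* In the setting described in the context, let $0\to\mathcal N(-\gamma)\xrightarrow{\pi}\Upsilon_1\xrightarrow{\iota}\mathcal F(\gamma)\to0$ be the exact sequence on $\mathbb P^{2n+1}$ described there, and put $\hslash_1=2\gamma-(2n+1)(\alpha+\beta)$, $\hslash_2=2n\gamma+3n(2n+1)(\alpha+\beta)$. Then there exist two morphisms $$\Upsilon_1^*(-\hslash_1)\xrightarrow{\ \phi\ }\Upsilon_1\xrightarrow{\ \psi\ }\bigwedge^{2n-1}\Upsilon_1^*(\hslash_2)$$ forming a complex exact at $\Upsilon_1$, such that $\phi$ factors as a surjection $\Upsilon_1^*(-\hslash_1)\to\mathcal N(-\gamma)$ followed by $\pi$, and $\psi$ factors as $\iota$ followed by an injective morphism $\mathcal F(\gamma)\to\bigwedge^{2n-1}\Upsilon_1^*(\hslash_2)$. Moreover, if $$\gamma>\max\{\,|\alpha+\beta(4n+1)|+(2n+1)(\alpha+\beta),\ \alpha(4n+1)+\beta\,\},$$ then $\phi$ and $\psi$ are matrices (of homogeneous forms) of rank $2n$ and $\hslash_1>0$.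
   Context: Everything is over $\mathbb C$. Let $n\ge1$, $\alpha,\gamma\in\mathbb N$, $\beta\in\mathbb Z$ with $\gamma>0$, $\alpha\ge\beta$, $\alpha+\beta\ge0$, $\gamma>(2n+1)|\beta|$. Let $U=\mathbb C^2$ with basis $x,y$, $V=S^{2n+1}U$ with basis $e_j=x^{2n+1-j}y^j$ ($0\le j\le2n+1$). $\mathbb C^*$ acts on $U$ by $\mathrm{diag}(t^\alpha,t^\beta)$, and on $V,\bigwedge^2V$ accordingly. For $1\le k\le4n+1$ let $E_k\subset\bigwedge^2V$ be spanned by $e_p\wedge e_q$, $p<q$, $p+q=k$. Let $W\subset\bigwedge^2V$ be a $\mathbb C^*$-invariant subspace of dimension $\binom{2n+2}{2}-4n-1$ containing no nonzero decomposable element; invariance means $W=\bigoplus_kW_k$, $W_k=W\cap E_k$ (each $W_k$ is a hyperplane of $E_k$). Let $f\in(\bigwedge^2V)^*$ be the linear form, unique up to nonzero scalar, vanishing on $W$ and on all $E_k$, $k\ne2n+1$; it is nondegenerate. Write $f_{ij}=f(e_i\wedge e_j)$. Let $g_0,\dots,g_{2n+1}$ be homogeneous forms in $2n+2$ variables without common zero on $\mathbb P^{2n+1}$, $\deg g_i=\gamma+(2n+1)\alpha+i(\beta-\alpha)$. With $\mathcal U=\mathcal O(\alpha)\oplus\mathcal O(\beta)$ on $\mathbb P^{2n+1}$ and $S^{2n+1}\mathcal U=\bigoplus_j\mathcal O((2n+1)\alpha+j(\beta-\alpha))$, define: - $\mathcal Q=\mathrm{coker}\big((g_i):\mathcal O(-\gamma)\to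 S^{2n+1}\mathcal U\big)$; - $\mathcal N=\ker\big(\mathcal Q\to\mathcal O(\gamma+(2n+1)(\alpha+\beta))\big)$, the map induced by $(s_j)\mapsto\sum f_{ij}g_is_j$; - $\mathcal F(\gamma)=\mathrm{coker}\big(\mathcal Q(-\gamma)\to\bigoplus_{k=1}^{4n+1}(E_k/W_k)\otimes\mathcal O(2(2n+1)\alpha+k(\beta-\alpha))\big)$, the map induced by $(s_j)\mapsto\sum g_is_j\,e_i\wedge e_j$ mod $W$. $\mathcal N$ and $\mathcal F$ are vector bundles of rank $2n$. $\Upsilon_1=\bigoplus_{1\le k\le4n+1,\,k\ne2n+1}\mathcal O(2(2n+1)\alpha+k(\beta-\alpha))$ is the sum of the summands with $k\ne2n+1$ above; the map $\iota:\Upsilon_1\to\mathcal F(\gamma)$ induced by the inclusion of these summands is surjective with kernel isomorphic to $\mathcal N(-\gamma)$, and $\pi$ is the inclusion of the kernel. *)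

theory Defs
  imports
    Complex_Main
    "HOL-Library.Poly_Mapping"
    "HOL-Library.Function_Algebras"
    "HOL-Computational_Algebra.Fraction_Field"
    "HOL-Algebra.Module"
begin

section \<open>Linear algebra on coordinate functions\<close>

definition fscale :: "'a::field \<Rightarrow> ('i \<Rightarrow> 'a) \<Rightarrow> 'i \<Rightarrow> 'a" where
  "fscale c v = (\<lambda>i. c * v i)"

interpretation fun_vs: vector_space "fscale :: 'a::field \<Rightarrow> ('i \<Rightarrow> 'a) \<Rightarrow> 'i \<Rightarrow> 'a"
  by unfold_locales (auto simp: fscale_def fun_eq_iff algebra_simps)


section \<open>Forms and the Zariski topology of projective space\<close>

type_synonym cpoly = "(nat \<Rightarrow>\<^sub>0 nat) \<Rightarrow>\<^sub>0 complex"
type_synonym pt = "nat \<Rightarrow> complex"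

definition cst :: "complex \<Rightarrow> cpoly" where
  "cst c = Poly_Mapping.single 0 c"

definition peval :: "cpoly \<Rightarrow> pt \<Rightarrow> complex" where
  "peval p x = (\<Sum>m \<in> Poly_Mapping.keys p.
     Poly_Mapping.lookup p m * (\<Prod>i \<in> Poly_Mapping.keys m. x i ^ Poly_Mapping.lookup m i))"

text \<open>Forms of degree \<open>d\<close> in the \<open>N + 1\<close> variables \<open>x\<^sub>0, \<dots>, x\<^sub>N\<close>.
  The zero polynomial is a form of every degree, and the only one of negative degree.\<close>

definition is_form :: "nat \<Rightarrow> int \<Rightarrow> cpoly \<Rightarrow> bool" where
  "is_form N d p \<longleftrightarrow> (\<forall>m \<in> Poly_Mapping.keys p. Poly_Mapping.keys m \<subseteq> {..N} \<and>
     int (\<Sum>i \<in> Poly_Mapping.keys m. Poly_Mapping.lookup m i) = d)"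

text \<open>A subset of the projective space of dimension \<open>N\<close> is represented by its preimage in the space of nonzero vectors with coordinates
  \<open>x\<^sub>0, \<dots>, x\<^sub>N\<close>, a union of punctured lines.  Zariski-open subsets are those on which some member
  of a given set of forms does not vanish.\<close>

definition cone_pts :: "nat \<Rightarrow> pt set" where
  "cone_pts N = {x. (\<exists>i. x i \<noteq> 0) \<and> (\<forall>i>N. x i = 0)}"

definition zopen :: "nat \<Rightarrow> pt set \<Rightarrow> bool" where
  "zopen N U \<longleftrightarrow> (\<exists>S. (\<forall>p\<in>S. \<exists>d. is_form N d p) \<and>
     U = {x \<in> cone_pts N. \<exists>p\<in>S. peval p x \<noteq> 0})"

text \<open>Sections over \<open>U\<close> of the line bundle of degree \<open>d\<close>: functions that are locally quotients
  of forms with degree difference \<open>d\<close> (hence homogeneous of degree \<open>d\<close> on lines).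
  They are extended by \<open>0\<close> outside \<open>U\<close>.\<close>

definition line_sections :: "nat \<Rightarrow> int \<Rightarrow> pt set \<Rightarrow> (pt \<Rightarrow> complex) set" where
  "line_sections N d U = {s. (\<forall>x. x \<notin> U \<longrightarrow> s x = 0) \<and>
     (\<forall>x\<in>U. \<exists>V a b e. zopen N V \<and> x \<in> V \<and> V \<subseteq> U \<and> is_form N (e + d) a \<and> is_form N e b \<and>
        (\<forall>y\<in>V. peval b y \<noteq> 0 \<and> s y = peval a y / peval b y))}"

definition fun_restrict :: "pt set \<Rightarrow> (pt \<Rightarrow> complex) \<Rightarrow> pt \<Rightarrow> complex" where
  "fun_restrict V s = (\<lambda>x. if x \<in> V then s x else 0)"


section \<open>Sheaves of modules over the structure sheaf\<close>

text \<open>\<open>Sec F U\<close> is the module of sections over \<open>U\<close>, with scalars \<open>line_sections N 0 U\<close>;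
  its fields \<open>mult\<close> and \<open>one\<close> are irrelevant.  \<open>Res F U V\<close> is the restriction from \<open>U\<close> to \<open>V\<close>.\<close>

record 's shf =
  Sec :: "pt set \<Rightarrow> (pt \<Rightarrow> complex, 's) module"
  Res :: "pt set \<Rightarrow> pt set \<Rightarrow> 's \<Rightarrow> 's"

type_synonym ('a, 'b) shf_map = "pt set \<Rightarrow> 'a \<Rightarrow> 'b"

definition shf_hom :: "nat \<Rightarrow> 'a shf \<Rightarrow> 'b shf \<Rightarrow> ('a, 'b) shf_map \<Rightarrow> bool" where
  "shf_hom N F G \<phi> \<longleftrightarrow> (\<forall>U. zopen N U \<longrightarrow>
     (\<forall>s \<in> carrier (Sec F U). \<phi> U s \<in> carrier (Sec G U)) \<and>
     (\<forall>s \<in> carrier (Sec F U). \<forall>t \<in> carrier (Sec F U).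
        \<phi> U (s \<oplus>\<^bsub>Sec F U\<^esub> t) = \<phi> U s \<oplus>\<^bsub>Sec G U\<^esub> \<phi> U t) \<and>
     (\<forall>r \<in> line_sections N 0 U. \<forall>s \<in> carrier (Sec F U).
        \<phi> U (r \<odot>\<^bsub>Sec F U\<^esub> s) = r \<odot>\<^bsub>Sec G U\<^esub> \<phi> U s) \<and>
     (\<forall>V. zopen N V \<longrightarrow> V \<subseteq> U \<longrightarrow>
        (\<forall>s \<in> carrier (Sec F U). \<phi> V (Res F U V s) = Res G U V (\<phi> U s))))"

definition shf_map_eq :: "nat \<Rightarrow> 'a shf \<Rightarrow> ('a, 'b) shf_map \<Rightarrow> ('a, 'b) shf_map \<Rightarrow> bool" where
  "shf_map_eq N F \<phi> \<psi> \<longleftrightarrow> (\<forall>U. zopen N U \<longrightarrow> (\<forall>s \<in> carrier (Sec F U). \<phi> U s = \<psi> U s))"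

definition shf_comp :: "('b, 'c) shf_map \<Rightarrow> ('a, 'b) shf_map \<Rightarrow> ('a, 'c) shf_map" where
  "shf_comp \<psi> \<phi> = (\<lambda>U s. \<psi> U (\<phi> U s))"

definition shf_inj :: "nat \<Rightarrow> 'a shf \<Rightarrow> ('a, 'b) shf_map \<Rightarrow> bool" where
  "shf_inj N F \<phi> \<longleftrightarrow> (\<forall>U. zopen N U \<longrightarrow> inj_on (\<phi> U) (carrier (Sec F U)))"

text \<open>\<open>t\<close> is locally on \<open>U\<close> in the image of \<open>\<phi>\<close>, i.e. it is a section of the image sheaf.\<close>

definition locally_in_image ::
  "nat \<Rightarrow> 'a shf \<Rightarrow> 'b shf \<Rightarrow> ('a, 'b) shf_map \<Rightarrow> pt set \<Rightarrow> 'b \<Rightarrow> bool" where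
  "locally_in_image N F G \<phi> U t \<longleftrightarrow> (\<forall>x\<in>U. \<exists>V. zopen N V \<and> x \<in> V \<and> V \<subseteq> U \<and>
     (\<exists>s \<in> carrier (Sec F V). \<phi> V s = Res G U V t))"

definition shf_surj :: "nat \<Rightarrow> 'a shf \<Rightarrow> 'b shf \<Rightarrow> ('a, 'b) shf_map \<Rightarrow> bool" where
  "shf_surj N F G \<phi> \<longleftrightarrow>
     (\<forall>U. zopen N U \<longrightarrow> (\<forall>t \<in> carrier (Sec G U). locally_in_image N F G \<phi> U t))"

text \<open>\<open>F \<rightarrow> G \<rightarrow> H\<close> is a complex which is exact at \<open>G\<close>.\<close>

definition shf_exact ::
  "nat \<Rightarrow> 'a shf \<Rightarrow> 'b shf \<Rightarrow> 'c shf \<Rightarrow> ('a, 'b) shf_map \<Rightarrow> ('b, 'c) shf_map \<Rightarrow> bool" where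
  "shf_exact N F G H \<phi> \<psi> \<longleftrightarrow> (\<forall>U. zopen N U \<longrightarrow>
     (\<forall>s \<in> carrier (Sec F U). \<psi> U (\<phi> U s) = \<zero>\<^bsub>Sec H U\<^esub>) \<and>
     (\<forall>t \<in> carrier (Sec G U). \<psi> U t = \<zero>\<^bsub>Sec H U\<^esub> \<longrightarrow> locally_in_image N F G \<phi> U t))"

definition shf_short_exact ::
  "nat \<Rightarrow> 'a shf \<Rightarrow> 'b shf \<Rightarrow> 'c shf \<Rightarrow> ('a, 'b) shf_map \<Rightarrow> ('b, 'c) shf_map \<Rightarrow> bool" where
  "shf_short_exact N F G H \<phi> \<psi> \<longleftrightarrow> shf_hom N F G \<phi> \<and> shf_hom N G H \<psi> \<and>
     shf_inj N F \<phi> \<and> shf_exact N F G H \<phi> \<psi> \<and> shf_surj N G H \<psi>"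

definition shf_ker :: "'a shf \<Rightarrow> 'b shf \<Rightarrow> ('a, 'b) shf_map \<Rightarrow> 'a shf" where
  "shf_ker F G \<phi> = \<lparr>
     Sec = (\<lambda>U. (Sec F U)\<lparr>carrier := {s \<in> carrier (Sec F U). \<phi> U s = \<zero>\<^bsub>Sec G U\<^esub>}\<rparr>),
     Res = Res F\<rparr>"

text \<open>The cokernel of \<open>\<phi> : A \<rightarrow> B\<close> is the sheaf associated with \<open>U \<mapsto> B U / \<phi> (A U)\<close>.
  \<open>coker_germ N A B \<phi> x V b\<close> is the germ at \<open>x\<close> of the class of \<open>b \<in> B V\<close>: the set of all
  pairs \<open>(V', b')\<close> which near \<open>x\<close> agree with \<open>b\<close> modulo the image of \<open>\<phi>\<close>.  A section over \<open>U\<close>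
  assigns to each point of \<open>U\<close> a germ, locally coming from one section of \<open>B\<close>; it is extended
  by \<open>{}\<close> outside \<open>U\<close>.\<close>

type_synonym 'b germ_fun = "pt \<Rightarrow> (pt set \<times> 'b) set"

definition coker_germ ::
  "nat \<Rightarrow> 'a shf \<Rightarrow> 'b shf \<Rightarrow> ('a, 'b) shf_map \<Rightarrow> pt \<Rightarrow> pt set \<Rightarrow> 'b \<Rightarrow> (pt set \<times> 'b) set" where
  "coker_germ N A B \<phi> x V b = {(V', b'). zopen N V' \<and> x \<in> V' \<and> b' \<in> carrier (Sec B V') \<and>
     (\<exists>X. zopen N X \<and> x \<in> X \<and> X \<subseteq> V \<inter> V' \<and>
       (\<exists>a \<in> carrier (Sec A X). Res B V X b = Res B V' X b' \<oplus>\<^bsub>Sec B X\<^esub> \<phi> X a))}"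

definition coker_proj ::
  "nat \<Rightarrow> 'a shf \<Rightarrow> 'b shf \<Rightarrow> ('a, 'b) shf_map \<Rightarrow> ('b, 'b germ_fun) shf_map" where
  "coker_proj N A B \<phi> = (\<lambda>U b x. if x \<in> U then coker_germ N A B \<phi> x U b else {})"

definition shf_coker ::
  "nat \<Rightarrow> 'a shf \<Rightarrow> 'b shf \<Rightarrow> ('a, 'b) shf_map \<Rightarrow> 'b germ_fun shf" where
  "shf_coker N A B \<phi> = \<lparr>
     Sec = (\<lambda>U. \<lparr>
       carrier = {t. (\<forall>x. x \<notin> U \<longrightarrow> t x = {}) \<and>
         (\<forall>x\<in>U. \<exists>V. zopen N V \<and> x \<in> V \<and> V \<subseteq> U \<and>
            (\<exists>b \<in> carrier (Sec B V). \<forall>y\<in>V. t y = coker_germ N A B \<phi> y V b))},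
       mult = undefined, one = undefined,
       zero = coker_proj N A B \<phi> U \<zero>\<^bsub>Sec B U\<^esub>,
       add = (\<lambda>s t x. \<Union>(V, b) \<in> s x. \<Union>(V', b') \<in> t x.
         coker_germ N A B \<phi> x (V \<inter> V')
           (Res B V (V \<inter> V') b \<oplus>\<^bsub>Sec B (V \<inter> V')\<^esub> Res B V' (V \<inter> V') b')),
       smult = (\<lambda>r t x. \<Union>(V, b) \<in> t x.
         coker_germ N A B \<phi> x (U \<inter> V)
           (fun_restrict (U \<inter> V) r \<odot>\<^bsub>Sec B (U \<inter> V)\<^esub> Res B V (U \<inter> V) b))\<rparr>),
     Res = (\<lambda>U V t x. if x \<in> V then t x else {})\<rparr>"

text \<open>The map out of a cokernel induced by a map \<open>\<psi> : B \<rightarrow> C\<close> that vanishes on the image: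
  the value on \<open>t\<close> is the section of \<open>C\<close> that is locally \<open>\<psi> b\<close> for representatives \<open>b\<close> of \<open>t\<close>.\<close>

definition coker_induced :: "'c shf \<Rightarrow> ('b, 'c) shf_map \<Rightarrow> ('b germ_fun, 'c) shf_map" where
  "coker_induced C \<psi> = (\<lambda>U t. THE c. c \<in> carrier (Sec C U) \<and>
     (\<forall>x\<in>U. \<exists>(V, b) \<in> t x. V \<subseteq> U \<and> Res C U V c = \<psi> V b))"


section \<open>Direct sums of line bundles and matrices of forms\<close>

text \<open>The direct sum over the finite index set \<open>I\<close> of the line bundles of degrees \<open>d i\<close>.\<close>

definition line_sum :: "nat \<Rightarrow> 'i set \<Rightarrow> ('i \<Rightarrow> int) \<Rightarrow> ('i \<Rightarrow> pt \<Rightarrow> complex) shf" where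
  "line_sum N I d = \<lparr>
     Sec = (\<lambda>U. \<lparr>
       carrier = {s. (\<forall>i\<in>I. s i \<in> line_sections N (d i) U) \<and> (\<forall>i. i \<notin> I \<longrightarrow> s i = (\<lambda>_. 0))},
       mult = undefined, one = undefined,
       zero = (\<lambda>i x. 0),
       add = (\<lambda>s t i x. s i x + t i x),
       smult = (\<lambda>r s i x. r x * s i x)\<rparr>),
     Res = (\<lambda>U V s i. fun_restrict V (s i))\<rparr>"

abbreviation line_bundle :: "nat \<Rightarrow> int \<Rightarrow> (unit \<Rightarrow> pt \<Rightarrow> complex) shf" where
  "line_bundle N d \<equiv> line_sum N {()} (\<lambda>_. d)"

definition matrix_map ::
  "'i set \<Rightarrow> 'j set \<Rightarrow> ('i \<Rightarrow> 'j \<Rightarrow> cpoly) \<Rightarrow> ('j \<Rightarrow> pt \<Rightarrow> complex, 'i \<Rightarrow> pt \<Rightarrow> complex) shf_map" where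
  "matrix_map I J M = (\<lambda>U s i x. if i \<in> I then \<Sum>j\<in>J. peval (M i j) x * s j x else 0)"

text \<open>Rank over the field of rational functions.\<close>

definition poly_matrix_rank :: "'i set \<Rightarrow> 'j set \<Rightarrow> ('i \<Rightarrow> 'j \<Rightarrow> cpoly) \<Rightarrow> nat" where
  "poly_matrix_rank I J M = fun_vs.dim ((\<lambda>j i. if i \<in> I then Fract (M i j) 1 else 0) ` J)"

text \<open>The map \<open>\<phi>\<close> from the sum of the line bundles of degrees \<open>d' j\<close> (\<open>j \<in> J\<close>) to the sum of those
  of degrees \<open>d i\<close> (\<open>i \<in> I\<close>) is given by a matrix of rank \<open>r\<close> whose entries are forms.  The
  degree \<open>d i - d' j\<close> of an entry is required to be a natural number.\<close>

definition form_matrix_of_rank ::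
  "nat \<Rightarrow> 'j set \<Rightarrow> ('j \<Rightarrow> int) \<Rightarrow> 'i set \<Rightarrow> ('i \<Rightarrow> int) \<Rightarrow>
   ('j \<Rightarrow> pt \<Rightarrow> complex, 'i \<Rightarrow> pt \<Rightarrow> complex) shf_map \<Rightarrow> nat \<Rightarrow> bool" where
  "form_matrix_of_rank N J d' I d \<phi> r \<longleftrightarrow> (\<exists>M.
     (\<forall>i\<in>I. \<forall>j\<in>J. d i - d' j \<ge> 0 \<and> is_form N (d i - d' j) (M i j)) \<and>
     shf_map_eq N (line_sum N J d') \<phi> (matrix_map I J M) \<and>
     poly_matrix_rank I J M = r)"


section \<open>The second exterior power of the space of binary forms of odd degree\<close>

text \<open>\<open>V = S\<^sup>2\<^sup>n\<^sup>+\<^sup>1 U\<close> is identified with coordinate vectors with respect to the basis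
  \<open>e\<^sub>0, \<dots>, e\<^sub>2\<^sub>n\<^sub>+\<^sub>1\<close>, and its second exterior power with coordinate vectors, indexed by pairs
  \<open>(p, q)\<close> with \<open>p < q\<close>, with respect to the basis of the \<open>e\<^sub>p \<and> e\<^sub>q\<close>.\<close>

type_synonym bivector = "nat \<times> nat \<Rightarrow> complex"

definition basis_vec :: "nat \<Rightarrow> nat \<Rightarrow> complex" where
  "basis_vec j = (\<lambda>i. if i = j then 1 else 0)"

definition V_space :: "nat \<Rightarrow> (nat \<Rightarrow> complex) set" where
  "V_space n = {v. \<forall>i > 2*n+1. v i = 0}"

definition wedge :: "(nat \<Rightarrow> complex) \<Rightarrow> (nat \<Rightarrow> complex) \<Rightarrow> bivector" where
  "wedge u v = (\<lambda>(p, q). if p < q then u p * v q - u q * v p else 0)"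

definition ext_square :: "nat \<Rightarrow> bivector set" where
  "ext_square n = fun_vs.span {wedge (basis_vec p) (basis_vec q) |p q. p < q \<and> q \<le> 2*n+1}"

definition decomposable :: "nat \<Rightarrow> bivector \<Rightarrow> bool" where
  "decomposable n w \<longleftrightarrow> (\<exists>u \<in> V_space n. \<exists>v \<in> V_space n. w = wedge u v)"

definition E_space :: "nat \<Rightarrow> nat \<Rightarrow> bivector set" where
  "E_space n k = fun_vs.span
     {wedge (basis_vec p) (basis_vec q) |p q. p < q \<and> q \<le> 2*n+1 \<and> p + q = k}"

text \<open>\<open>W\<close> is the (automatically direct) sum of its intersections with the \<open>E\<^sub>k\<close>.  The torus acts on
  \<open>E\<^sub>k\<close> with weight \<open>2(2n+1)\<alpha> + k(\<beta>-\<alpha>)\<close>; for \<open>\<alpha> \<noteq> \<beta>\<close> these weights are distinct and the condition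
  is invariance under the action, for \<open>\<alpha> = \<beta>\<close> it is the meaning given to invariance.\<close>

definition torus_invariant :: "nat \<Rightarrow> bivector set \<Rightarrow> bool" where
  "torus_invariant n W \<longleftrightarrow> W = fun_vs.span (\<Union>k\<in>{1..4*n+1}. W \<inter> E_space n k)"

text \<open>Linear forms on the exterior square are restrictions of linear forms on the type
  \<open>bivector\<close>; only their values on the exterior square are ever used.\<close>

abbreviation linear_form :: "(bivector \<Rightarrow> complex) \<Rightarrow> bool" where
  "linear_form \<equiv> Vector_Spaces.linear fscale (*)"


section \<open>The bundles\<close>

text \<open>Twists: since tensoring with a line bundle is exact, the twist by \<open>d\<close> of a cokernel or
  kernel of maps between sums of line bundles is the cokernel or kernel of the same maps with all
  degrees raised by \<open>d\<close>.  The argument \<open>d\<close> of \<open>S_sheaf\<close>, \<open>Q_sheaf\<close>, \<open>N_sheaf\<close> is this twist.\<close>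

definition S_deg :: "nat \<Rightarrow> int \<Rightarrow> int \<Rightarrow> nat \<Rightarrow> int" where
  "S_deg n \<alpha> \<beta> j = (2 * int n + 1) * \<alpha> + int j * (\<beta> - \<alpha>)"

definition S_sheaf :: "nat \<Rightarrow> int \<Rightarrow> int \<Rightarrow> int \<Rightarrow> (nat \<Rightarrow> pt \<Rightarrow> complex) shf" where
  "S_sheaf n \<alpha> \<beta> d = line_sum (2*n+1) {..2*n+1} (\<lambda>j. S_deg n \<alpha> \<beta> j + d)"

definition g_map :: "nat \<Rightarrow> (nat \<Rightarrow> cpoly) \<Rightarrow> (unit \<Rightarrow> pt \<Rightarrow> complex, nat \<Rightarrow> pt \<Rightarrow> complex) shf_map" where
  "g_map n g = matrix_map {..2*n+1} {()} (\<lambda>i _. g i)"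

definition Q_sheaf ::
  "nat \<Rightarrow> int \<Rightarrow> int \<Rightarrow> int \<Rightarrow> (nat \<Rightarrow> cpoly) \<Rightarrow> int \<Rightarrow> (nat \<Rightarrow> pt \<Rightarrow> complex) germ_fun shf" where
  "Q_sheaf n \<alpha> \<beta> \<gamma> g d =
     shf_coker (2*n+1) (line_bundle (2*n+1) (- \<gamma> + d)) (S_sheaf n \<alpha> \<beta> d) (g_map n g)"

definition f_map ::
  "nat \<Rightarrow> (bivector \<Rightarrow> complex) \<Rightarrow> (nat \<Rightarrow> cpoly) \<Rightarrow>
   (nat \<Rightarrow> pt \<Rightarrow> complex, unit \<Rightarrow> pt \<Rightarrow> complex) shf_map" where
  "f_map n f g = matrix_map {()} {..2*n+1}
     (\<lambda>_ j. \<Sum>i\<le>2*n+1. cst (f (wedge (basis_vec i) (basis_vec j))) * g i)"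

definition N_sheaf ::
  "nat \<Rightarrow> int \<Rightarrow> int \<Rightarrow> int \<Rightarrow> (bivector \<Rightarrow> complex) \<Rightarrow> (nat \<Rightarrow> cpoly) \<Rightarrow> int \<Rightarrow>
   (nat \<Rightarrow> pt \<Rightarrow> complex) germ_fun shf" where
  "N_sheaf n \<alpha> \<beta> \<gamma> f g d =
     (let L = line_bundle (2*n+1) (\<gamma> + (2 * int n + 1) * (\<alpha> + \<beta>) + d)
      in shf_ker (Q_sheaf n \<alpha> \<beta> \<gamma> g d) L (coker_induced L (f_map n f g)))"

text \<open>The sum over \<open>k \<in> K\<close> of the bundles \<open>(E\<^sub>k/W\<^sub>k) \<otimes> O(2(2n+1)\<alpha> + k(\<beta>-\<alpha>))\<close>, where the
  one-dimensional space \<open>E\<^sub>k/W\<^sub>k\<close> is identified with the ground field through a linear form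
  \<open>h k\<close> on \<open>E\<^sub>k\<close> with kernel \<open>W\<^sub>k\<close>.\<close>

definition E_deg :: "nat \<Rightarrow> int \<Rightarrow> int \<Rightarrow> nat \<Rightarrow> int" where
  "E_deg n \<alpha> \<beta> k = 2 * (2 * int n + 1) * \<alpha> + int k * (\<beta> - \<alpha>)"

definition E_sheaf :: "nat \<Rightarrow> int \<Rightarrow> int \<Rightarrow> nat set \<Rightarrow> (nat \<Rightarrow> pt \<Rightarrow> complex) shf" where
  "E_sheaf n \<alpha> \<beta> K = line_sum (2*n+1) K (E_deg n \<alpha> \<beta>)"

text \<open>In \<open>\<Sum> g\<^sub>i s\<^sub>j e\<^sub>i \<and> e\<^sub>j\<close> the component in \<open>E\<^sub>k\<close> is the sum of the terms with \<open>i + j = k\<close>.\<close>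

definition h_map ::
  "nat \<Rightarrow> (nat \<Rightarrow> bivector \<Rightarrow> complex) \<Rightarrow> (nat \<Rightarrow> cpoly) \<Rightarrow>
   (nat \<Rightarrow> pt \<Rightarrow> complex, nat \<Rightarrow> pt \<Rightarrow> complex) shf_map" where
  "h_map n h g = matrix_map {1..4*n+1} {..2*n+1}
     (\<lambda>k j. \<Sum>i | i \<le> 2*n+1 \<and> i + j = k. cst (h k (wedge (basis_vec i) (basis_vec j))) * g i)"

definition Q_to_E ::
  "nat \<Rightarrow> int \<Rightarrow> int \<Rightarrow> (nat \<Rightarrow> bivector \<Rightarrow> complex) \<Rightarrow> (nat \<Rightarrow> cpoly) \<Rightarrow>
   ((nat \<Rightarrow> pt \<Rightarrow> complex) germ_fun, nat \<Rightarrow> pt \<Rightarrow> complex) shf_map" where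
  "Q_to_E n \<alpha> \<beta> h g = coker_induced (E_sheaf n \<alpha> \<beta> {1..4*n+1}) (h_map n h g)"

text \<open>\<open>F_gamma\<close> is the sheaf \<open>F(\<gamma>)\<close>.\<close>

definition F_gamma ::
  "nat \<Rightarrow> int \<Rightarrow> int \<Rightarrow> int \<Rightarrow> (nat \<Rightarrow> bivector \<Rightarrow> complex) \<Rightarrow> (nat \<Rightarrow> cpoly) \<Rightarrow>
   (nat \<Rightarrow> pt \<Rightarrow> complex) germ_fun shf" where
  "F_gamma n \<alpha> \<beta> \<gamma> h g = shf_coker (2*n+1) (Q_sheaf n \<alpha> \<beta> \<gamma> g (- \<gamma>))
     (E_sheaf n \<alpha> \<beta> {1..4*n+1}) (Q_to_E n \<alpha> \<beta> h g)"

definition K1 :: "nat \<Rightarrow> nat set" where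
  "K1 n = {1..4*n+1} - {2*n+1}"

definition Upsilon1 :: "nat \<Rightarrow> int \<Rightarrow> int \<Rightarrow> (nat \<Rightarrow> pt \<Rightarrow> complex) shf" where
  "Upsilon1 n \<alpha> \<beta> = E_sheaf n \<alpha> \<beta> (K1 n)"

text \<open>Sections of a sum of line bundles vanish outside the index set, so the inclusion of a
  partial sum is the identity on sections and \<open>\<iota>\<close> is the restriction of the projection.\<close>

definition iota_map ::
  "nat \<Rightarrow> int \<Rightarrow> int \<Rightarrow> int \<Rightarrow> (nat \<Rightarrow> bivector \<Rightarrow> complex) \<Rightarrow> (nat \<Rightarrow> cpoly) \<Rightarrow>
   (nat \<Rightarrow> pt \<Rightarrow> complex, (nat \<Rightarrow> pt \<Rightarrow> complex) germ_fun) shf_map" where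
  "iota_map n \<alpha> \<beta> \<gamma> h g = coker_proj (2*n+1) (Q_sheaf n \<alpha> \<beta> \<gamma> g (- \<gamma>))
     (E_sheaf n \<alpha> \<beta> {1..4*n+1}) (Q_to_E n \<alpha> \<beta> h g)"

definition hbar1 :: "nat \<Rightarrow> int \<Rightarrow> int \<Rightarrow> int \<Rightarrow> int" where
  "hbar1 n \<alpha> \<beta> \<gamma> = 2 * \<gamma> - (2 * int n + 1) * (\<alpha> + \<beta>)"

definition hbar2 :: "nat \<Rightarrow> int \<Rightarrow> int \<Rightarrow> int \<Rightarrow> int" where
  "hbar2 n \<alpha> \<beta> \<gamma> = 2 * int n * \<gamma> + 3 * int n * (2 * int n + 1) * (\<alpha> + \<beta>)"

text \<open>Degrees of the line bundle summands of \<open>\<Upsilon>\<^sub>1\<^sup>*(-\<hbar>\<^sub>1)\<close>, and of the exterior power of order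
  \<open>2n-1\<close> of \<open>\<Upsilon>\<^sub>1\<^sup>*\<close> twisted by \<open>\<hbar>\<^sub>2\<close>.  The latter exterior power of a sum of line bundles is the
  sum, over the subsets of \<open>2n-1\<close> summands, of their tensor products.\<close>

definition dual_deg :: "nat \<Rightarrow> int \<Rightarrow> int \<Rightarrow> int \<Rightarrow> nat \<Rightarrow> int" where
  "dual_deg n \<alpha> \<beta> \<gamma> k = - E_deg n \<alpha> \<beta> k - hbar1 n \<alpha> \<beta> \<gamma>"

definition ext_index :: "nat \<Rightarrow> nat set set" where
  "ext_index n = {I. I \<subseteq> K1 n \<and> card I = 2*n - 1}"

definition ext_deg :: "nat \<Rightarrow> int \<Rightarrow> int \<Rightarrow> int \<Rightarrow> nat set \<Rightarrow> int" where
  "ext_deg n \<alpha> \<beta> \<gamma> I = (\<Sum>k\<in>I. - E_deg n \<alpha> \<beta> k) + hbar2 n \<alpha> \<beta> \<gamma>"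

definition Upsilon1_dual :: "nat \<Rightarrow> int \<Rightarrow> int \<Rightarrow> int \<Rightarrow> (nat \<Rightarrow> pt \<Rightarrow> complex) shf" where
  "Upsilon1_dual n \<alpha> \<beta> \<gamma> = line_sum (2*n+1) (K1 n) (dual_deg n \<alpha> \<beta> \<gamma>)"

definition Upsilon1_ext :: "nat \<Rightarrow> int \<Rightarrow> int \<Rightarrow> int \<Rightarrow> (nat set \<Rightarrow> pt \<Rightarrow> complex) shf" where
  "Upsilon1_ext n \<alpha> \<beta> \<gamma> = line_sum (2*n+1) (ext_index n) (ext_deg n \<alpha> \<beta> \<gamma>)"

end

theory Submission
  imports Defs "Jordan_Normal_Form.Determinant"
begin

text \<open>
  At a point let \<open>G\<close> be the vector of the values of the \<open>g\<^sub>i\<close>, let \<open>r s = f (G \<and> s)\<close>, and let \<open>B s\<close> be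
  the class of \<open>G \<and> s\<close> in the sum of the \<open>E\<^sub>k/W\<^sub>k\<close> with \<open>k \<noteq> 2n+1\<close>.  As \<open>W\<close> contains no
  decomposable bivector, \<open>B s = 0\<close> and \<open>r s = 0\<close> force \<open>s\<close> to be a multiple of \<open>G\<close>.  Hence the
  kernel of \<open>\<iota>\<close> has the fibre \<open>B (ker r)\<close>, of dimension \<open>2n\<close>, with a basis of vectors \<open>w\<^sub>j\<close>.

  The map \<open>\<phi>\<close> is \<open>B f\<^sup>-\<^sup>1 B\<^sup>T\<close>, the composition of \<open>B\<close> and its dual through the symplectic form.  Its
  image lies in \<open>B (ker r)\<close> because \<open>B G = 0\<close>; it is all of it because the matrix is skew, so a
  linear form killing the image also kills \<open>B (ker r)\<close>.

  The map \<open>\<psi>\<close> sends \<open>t\<close> to the exterior product of \<open>t\<close> with the \<open>2n\<close>-vector obtained by contracting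
  \<open>f\<close> into the exterior product of the \<open>2n+2\<close> columns of \<open>B\<close>.  By \<open>B G = 0\<close> this \<open>2n\<close>-vector is a
  multiple of the exterior product of the \<open>w\<^sub>j\<close>, so \<open>\<psi> t = 0\<close> means that \<open>t\<close> lies in \<open>B (ker r)\<close>.

  Since \<open>\<phi>\<close> has constant rank, sections of its image lift locally by Cramer's rule.  The same algebra
  over the field of rational functions gives the generic ranks.
\<close>

subsection \<open>Evaluation of polynomials and forms\<close>

text \<open>The vectors w_j exist only after a choice of m with nonzero value of g_m, hence only
  fibrewise, whereas the matrices \<open>Mp\<close> and \<open>Pp\<close> are written down once for
  all. So kernels and images are compared fibre by fibre, over an arbitrary field and for an
  arbitrary ring homomorphism \<open>H\<close> out of the polynomials: evaluation at a point, or the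
  embedding into the field of rational functions. A product of t with a 2n-vector has order 2n+1,
  while the target is the exterior power of order 2n-1 of the dual. As the rank of Upsilon_1 is 4n,
  its determinant identifies the two up to a twist; thus component \<open>J\<close> of \<psi> is a
  determinant in the 2n+1 coordinates outside \<open>J\<close>. The twist \<open>hbar1\<close> is
  the degree that inverting f requires, \<open>hbar2\<close> the one that comes out of this
  determinant. The condition r s = 0 comes from the summand k = 2n+1 that is missing in Upsilon_1:
  there the class modulo W and f are proportional, so an s whose image in the sum of all E_k/W_k has
  no component at 2n+1 satisfies r s = 0.\<close>

lemma poly_mapping_single_induct [case_names zero add]:
  fixes p :: "'a \<Rightarrow>\<^sub>0 'b::comm_monoid_add"
  assumes "P 0" and "\<And>p m c. P p \<Longrightarrow> P (p + Poly_Mapping.single m c)"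
  shows "P p"
proof (induction p rule: update_induct)
  fix f :: "'a \<Rightarrow>\<^sub>0 'b" and a and b :: 'b assume 2: "a \<notin> Poly_Mapping.keys f" "b \<noteq> 0" "P f"
  have "Poly_Mapping.update a b f = f + Poly_Mapping.single a b"
    using 2(1) by (intro poly_mapping_eqI)
      (auto simp: lookup_add lookup_single lookup_update when_def in_keys_iff)
  with assms(2) 2(3) show "P (Poly_Mapping.update a b f)" by simp
qed (fact assms(1))

definition mon_eval :: "(nat \<Rightarrow>\<^sub>0 nat) \<Rightarrow> pt \<Rightarrow> complex" where
  "mon_eval m x = (\<Prod>i\<in>Poly_Mapping.keys m. x i ^ Poly_Mapping.lookup m i)"

lemma mon_eval_superset:
  assumes "finite S" "Poly_Mapping.keys m \<subseteq> S"
  shows "mon_eval m x = (\<Prod>i\<in>S. x i ^ Poly_Mapping.lookup m i)"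
  unfolding mon_eval_def
  by (rule prod.mono_neutral_left) (use assms in \<open>auto simp: in_keys_iff\<close>)

lemma mon_eval_0 [simp]: "mon_eval 0 x = 1"
  by (simp add: mon_eval_def)

lemma mon_eval_add: "mon_eval (m + m') x = mon_eval m x * mon_eval m' x"
proof -
  let ?S = "Poly_Mapping.keys m \<union> Poly_Mapping.keys m'"
  show ?thesis
    using mon_eval_superset[of ?S "m + m'" x] mon_eval_superset[of ?S m x]
      mon_eval_superset[of ?S m' x] Poly_Mapping.keys_add[of m m']
    by (simp add: lookup_add power_add prod.distrib)
qed

lemma peval_def': "peval p x = (\<Sum>m\<in>Poly_Mapping.keys p. Poly_Mapping.lookup p m * mon_eval m x)"
  by (simp add: peval_def mon_eval_def)

lemma peval_0 [simp]: "peval 0 x = 0"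
  by (simp add: peval_def')

lemma peval_add: "peval (p + q) x = peval p x + peval q x"
  unfolding peval_def'
  by (rule setsum_keys_plus_distrib) (auto simp: algebra_simps)

lemma peval_single: "peval (Poly_Mapping.single m c) x = c * mon_eval m x"
  by (simp add: peval_def')

lemma peval_cst [simp]: "peval (cst c) x = c"
  by (simp add: cst_def peval_single)

lemma peval_1 [simp]: "peval 1 x = 1"
  using peval_single[of 0 1 x] by (simp add: single_one)

lemma peval_mult: "peval (p * q) x = peval p x * peval q x"
proof (induction p rule: poly_mapping_single_induct)
  case (add p m c)
  have "peval (Poly_Mapping.single m c * q) x = peval (Poly_Mapping.single m c) x * peval q x"
    by (induction q rule: poly_mapping_single_induct)
      (auto simp: algebra_simps peval_add mult_single peval_single mon_eval_add)
  with add show ?case by (simp add: algebra_simps peval_add)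
qed simp

lemma peval_hom: "comm_ring_hom (\<lambda>p. peval p x)"
  by unfold_locales (auto simp: peval_add peval_mult)

interpretation peval_hom: comm_ring_hom "\<lambda>p. peval p x" for x
  by (rule peval_hom)

lemma is_form_0 [simp]: "is_form N d 0"
  by (simp add: is_form_def)

lemma is_form_cst [simp]: "is_form N 0 (cst c)"
  by (auto simp: is_form_def cst_def)

lemma is_form_1 [simp]: "is_form N 0 1"
  using is_form_cst[of N 1] by (simp add: cst_def single_one)

lemma is_form_add: "is_form N d p \<Longrightarrow> is_form N d q \<Longrightarrow> is_form N d (p + q)"
  using Poly_Mapping.keys_add[of p q] unfolding is_form_def by blast

lemma is_form_uminus [simp]: "is_form N d (- p) \<longleftrightarrow> is_form N d p"
  by (simp add: is_form_def)

lemma is_form_sum: "(\<And>i. i \<in> A \<Longrightarrow> is_form N d (p i)) \<Longrightarrow> is_form N d (sum p A)"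
  by (induction A rule: infinite_finite_induct) (auto intro: is_form_add)

lemma sum_lookup_add:
  "(\<Sum>i\<in>Poly_Mapping.keys (m + m' :: nat \<Rightarrow>\<^sub>0 nat). Poly_Mapping.lookup (m + m') i) =
     (\<Sum>i\<in>Poly_Mapping.keys m. Poly_Mapping.lookup m i) + (\<Sum>i\<in>Poly_Mapping.keys m'. Poly_Mapping.lookup m' i)"
  by (rule setsum_keys_plus_distrib) auto

lemma is_form_mult: "is_form N d p \<Longrightarrow> is_form N e q \<Longrightarrow> is_form N (d + e) (p * q)"
  unfolding is_form_def
proof
  fix m assume p: "\<forall>m\<in>Poly_Mapping.keys p. Poly_Mapping.keys m \<subseteq> {..N} \<and> int (sum (Poly_Mapping.lookup m) (Poly_Mapping.keys m)) = d"
    and q: "\<forall>m\<in>Poly_Mapping.keys q. Poly_Mapping.keys m \<subseteq> {..N} \<and> int (sum (Poly_Mapping.lookup m) (Poly_Mapping.keys m)) = e"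
    and m: "m \<in> Poly_Mapping.keys (p * q)"
  from m obtain a b where "a \<in> Poly_Mapping.keys p" "b \<in> Poly_Mapping.keys q" "m = a + b"
    using Poly_Mapping.keys_mult[of p q] by blast
  with p q show "Poly_Mapping.keys m \<subseteq> {..N} \<and> int (sum (Poly_Mapping.lookup m) (Poly_Mapping.keys m)) = d + e"
    using Poly_Mapping.keys_add[of a b] by (fastforce simp: sum_lookup_add)
qed

lemma is_form_mult': "is_form N d p \<Longrightarrow> is_form N e q \<Longrightarrow> d + e = c \<Longrightarrow> is_form N c (p * q)"
  using is_form_mult by blast

lemma is_form_prod:
  "finite A \<Longrightarrow> (\<And>i. i \<in> A \<Longrightarrow> is_form N (d i) (p i)) \<Longrightarrow> is_form N (sum d A) (prod p A)"
  by (induction A rule: finite_induct) (auto intro: is_form_mult)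

text \<open>Every Leibniz term uses each row degree \<open>e\<close> once and, since a permutation
  only reorders them, each column degree \<open>d\<close> once; so all terms have the same
  degree.\<close>

lemma is_form_det:
  assumes "\<And>i j. i < k \<Longrightarrow> j < k \<Longrightarrow> is_form N (e i - d j) (X i j)"
  shows "is_form N ((\<Sum>i<k. e i) - (\<Sum>j<k. d j)) (det (mat k k (\<lambda>(i, j). X i j)))"
proof -
  have "is_form N ((\<Sum>i<k. e i) - (\<Sum>j<k. d j)) (of_int (sign p) * (\<Prod>i = 0..<k. X i (p i)))"
    if p: "p permutes {0..<k}" for p
  proof -
    have "is_form N (\<Sum>i = 0..<k. e i - d (p i)) (\<Prod>i = 0..<k. X i (p i))"
      using p by (intro is_form_prod assms) (auto simp: permutes_in_image)
    moreover have "(\<Sum>i = 0..<k. d (p i)) = (\<Sum>j = 0..<k. d j)"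
      using sum.permute[OF p, of d] by (simp add: o_def)
    ultimately show ?thesis
      by (auto simp: sum_subtractf atLeast0LessThan sign_def)
  qed
  moreover have "(\<Prod>i = 0..<k. mat k k (\<lambda>(i, j). X i j) $$ (i, p i)) = (\<Prod>i = 0..<k. X i (p i))"
    if "p permutes {0..<k}" for p
    using that by (intro prod.cong) (auto simp: permutes_in_image)
  ultimately show ?thesis
    by (subst det_def'[of _ k]) (auto intro!: is_form_sum)
qed

text \<open>The generic point: through this homomorphism the algebra of a fibre applies over the
  field of rational functions.\<close>

lemma frac_hom: "comm_ring_hom (\<lambda>p :: 'a::idom. Fract p 1)"
  by unfold_locales (auto simp: One_fract_def Zero_fract_def)

section \<open>Zariski-open sets\<close>

lemma zopen_cone: "zopen N (cone_pts N)"
  unfolding zopen_def by (rule exI[of _ "{1}"]) (auto intro: is_form_1)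

lemma zopen_subset: "zopen N U \<Longrightarrow> U \<subseteq> cone_pts N"
  by (auto simp: zopen_def)

lemma zopen_Int:
  assumes "zopen N U" "zopen N V"
  shows "zopen N (U \<inter> V)"
proof -
  obtain S where S: "\<forall>p\<in>S. \<exists>d. is_form N d p" "U = {x \<in> cone_pts N. \<exists>p\<in>S. peval p x \<noteq> 0}"
    using assms(1) unfolding zopen_def by (elim exE conjE)
  obtain T where T: "\<forall>p\<in>T. \<exists>d. is_form N d p" "V = {x \<in> cone_pts N. \<exists>p\<in>T. peval p x \<noteq> 0}"
    using assms(2) unfolding zopen_def by (elim exE conjE)
  show ?thesis unfolding zopen_def
  proof (rule exI[of _ "{p * q |p q. p \<in> S \<and> q \<in> T}"], intro conjI)
    show "\<forall>p\<in>{p * q |p q. p \<in> S \<and> q \<in> T}. \<exists>d. is_form N d p"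
    proof safe
      fix p q assume "p \<in> S" "q \<in> T"
      then obtain d e where "is_form N d p" "is_form N e q" using S(1) T(1) by metis
      then show "\<exists>d. is_form N d (p * q)" by (blast intro: is_form_mult)
    qed
    have "(\<exists>r\<in>{p * q |p q. p \<in> S \<and> q \<in> T}. peval r x \<noteq> 0) \<longleftrightarrow>
        (\<exists>p\<in>S. \<exists>q\<in>T. peval (p * q) x \<noteq> 0)" for x
      by blast
    then have "(\<exists>r\<in>{p * q |p q. p \<in> S \<and> q \<in> T}. peval r x \<noteq> 0) \<longleftrightarrow>
        (\<exists>p\<in>S. peval p x \<noteq> 0) \<and> (\<exists>q\<in>T. peval q x \<noteq> 0)" for x
      by (auto simp: peval_mult)
    then show "U \<inter> V = {x \<in> cone_pts N. \<exists>r\<in>{p * q |p q. p \<in> S \<and> q \<in> T}. peval r x \<noteq> 0}"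
      unfolding S(2) T(2) by blast
  qed
qed

lemma zopen_nonzero:
  assumes "zopen N U" "is_form N d p"
  shows "zopen N {x \<in> U. peval p x \<noteq> 0}"
proof -
  have "zopen N {x \<in> cone_pts N. peval p x \<noteq> 0}"
    unfolding zopen_def by (rule exI[of _ "{p}"]) (use assms in auto)
  from zopen_Int[OF assms(1) this] show ?thesis
    using zopen_subset[OF assms(1)] by (auto elim!: back_subst[of "zopen N"])
qed

subsection \<open>Regular functions\<close>

text \<open>Unlike \<open>line_sections\<close> this does not mention the domain of
  \<open>s\<close>, so sections over different open sets can be combined without restricting them
  first; \<open>line_sections_iff\<close> shrinks \<open>V\<close> into \<open>U\<close> when
  needed.\<close>

definition regular_at :: "nat \<Rightarrow> int \<Rightarrow> pt \<Rightarrow> (pt \<Rightarrow> complex) \<Rightarrow> bool" where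
  "regular_at N d x s \<longleftrightarrow> (\<exists>V a b e. zopen N V \<and> x \<in> V \<and> is_form N (e + d) a \<and> is_form N e b \<and>
     (\<forall>y\<in>V. peval b y \<noteq> 0 \<and> s y = peval a y / peval b y))"

lemma line_sections_iff:
  assumes "zopen N U"
  shows "s \<in> line_sections N d U \<longleftrightarrow> (\<forall>x. x \<notin> U \<longrightarrow> s x = 0) \<and> (\<forall>x\<in>U. regular_at N d x s)"
proof -
  have "(\<exists>V a b e. zopen N V \<and> x \<in> V \<and> V \<subseteq> U \<and> is_form N (e + d) a \<and> is_form N e b \<and>
        (\<forall>y\<in>V. peval b y \<noteq> 0 \<and> s y = peval a y / peval b y)) \<longleftrightarrow> regular_at N d x s"
    (is "?L \<longleftrightarrow> ?R") if "x \<in> U" for x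
  proof
    assume ?R
    then obtain V a b e where "zopen N V" "x \<in> V" "is_form N (e + d) a" "is_form N e b"
        "\<forall>y\<in>V. peval b y \<noteq> 0 \<and> s y = peval a y / peval b y"
      unfolding regular_at_def by blast
    with assms that show ?L
      by (intro exI[of _ "U \<inter> V"] exI[of _ a] exI[of _ b] exI[of _ e]) (auto intro: zopen_Int)
  qed (unfold regular_at_def, blast)
  then show ?thesis unfolding line_sections_def by blast
qed

lemma regular_at_cong:
  assumes "regular_at N d x s" "zopen N V" "x \<in> V" "\<And>y. y \<in> V \<Longrightarrow> s y = t y"
  shows "regular_at N d x t"
proof -
  obtain V' a b e where "zopen N V'" "x \<in> V'" "is_form N (e + d) a" "is_form N e b"
      "\<forall>y\<in>V'. peval b y \<noteq> 0 \<and> s y = peval a y / peval b y"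
    using assms(1) unfolding regular_at_def by blast
  with assms show ?thesis unfolding regular_at_def
    by (intro exI[of _ "V \<inter> V'"] exI[of _ a] exI[of _ b] exI[of _ e]) (auto intro: zopen_Int)
qed

lemma regular_at_form:
  assumes "is_form N d p" "x \<in> cone_pts N"
  shows "regular_at N d x (peval p)"
  unfolding regular_at_def
  by (intro exI[of _ "cone_pts N"] exI[of _ p] exI[of _ 1] exI[of _ 0])
    (use assms zopen_cone in auto)

lemma regular_at_0: "x \<in> cone_pts N \<Longrightarrow> regular_at N d x (\<lambda>_. 0)"
  using regular_at_form[of N d 0 x] by (simp add: peval_0[abs_def])

lemma regular_at_add:
  assumes "regular_at N d x s" "regular_at N d x t"
  shows "regular_at N d x (\<lambda>y. s y + t y)"
proof -
  obtain V a b e where 1: "zopen N V" "x \<in> V" "is_form N (e + d) a" "is_form N e b"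
      "\<forall>y\<in>V. peval b y \<noteq> 0 \<and> s y = peval a y / peval b y"
    using assms(1) unfolding regular_at_def by blast
  obtain V' a' b' e' where 2: "zopen N V'" "x \<in> V'" "is_form N (e' + d) a'" "is_form N e' b'"
      "\<forall>y\<in>V'. peval b' y \<noteq> 0 \<and> t y = peval a' y / peval b' y"
    using assms(2) unfolding regular_at_def by blast
  show ?thesis unfolding regular_at_def
  proof (intro exI conjI ballI)
    show "zopen N (V \<inter> V')" "x \<in> V \<inter> V'" using 1 2 by (auto intro: zopen_Int)
    show "is_form N (e + e' + d) (a * b' + a' * b)"
      using 1 2 by (intro is_form_add) (auto intro: is_form_mult')
    show "is_form N (e + e') (b * b')" using 1 2 by (auto intro: is_form_mult)
  qed (use 1 2 in \<open>auto simp: peval_add peval_mult field_simps\<close>)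
qed

lemma regular_at_mult:
  assumes "regular_at N d x s" "regular_at N d' x t" "d + d' = c"
  shows "regular_at N c x (\<lambda>y. s y * t y)"
proof -
  obtain V a b e where 1: "zopen N V" "x \<in> V" "is_form N (e + d) a" "is_form N e b"
      "\<forall>y\<in>V. peval b y \<noteq> 0 \<and> s y = peval a y / peval b y"
    using assms(1) unfolding regular_at_def by blast
  obtain V' a' b' e' where 2: "zopen N V'" "x \<in> V'" "is_form N (e' + d') a'" "is_form N e' b'"
      "\<forall>y\<in>V'. peval b' y \<noteq> 0 \<and> t y = peval a' y / peval b' y"
    using assms(2) unfolding regular_at_def by blast
  show ?thesis unfolding regular_at_def
  proof (intro exI conjI ballI)
    show "zopen N (V \<inter> V')" "x \<in> V \<inter> V'" using 1 2 by (auto intro: zopen_Int)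
    show "is_form N (e + e' + c) (a * a')"
      using 1 2 assms(3) by (auto intro: is_form_mult')
    show "is_form N (e + e') (b * b')" using 1 2 by (auto intro: is_form_mult)
  qed (use 1 2 in \<open>auto simp: peval_add peval_mult field_simps\<close>)
qed

lemma regular_at_sum:
  assumes "x \<in> cone_pts N" "\<And>i. i \<in> A \<Longrightarrow> regular_at N d x (s i)"
  shows "regular_at N d x (\<lambda>y. \<Sum>i\<in>A. s i y)"
  using assms(2)
  by (induction A rule: infinite_finite_induct) (auto intro: regular_at_add regular_at_0 assms(1))

lemma regular_at_inverse_form:
  assumes "is_form N d p" "x \<in> cone_pts N" "peval p x \<noteq> 0"
  shows "regular_at N (- d) x (\<lambda>y. 1 / peval p y)"
  unfolding regular_at_def
  by (intro exI[of _ "{y \<in> cone_pts N. peval p y \<noteq> 0}"] exI[of _ 1] exI[of _ p] exI[of _ d])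
    (use assms zopen_cone zopen_nonzero in auto)

lemma line_sections_0 [simp]: "zopen N U \<Longrightarrow> (\<lambda>_. 0) \<in> line_sections N d U"
  using zopen_subset by (auto simp: line_sections_iff intro: regular_at_0)

lemma line_sections_outside: "s \<in> line_sections N d U \<Longrightarrow> x \<notin> U \<Longrightarrow> s x = 0"
  by (simp add: line_sections_def)

lemma line_sections_restrict:
  assumes "s \<in> line_sections N d U" "zopen N U" "zopen N V" "V \<subseteq> U"
  shows "fun_restrict V s \<in> line_sections N d V"
proof -
  have "regular_at N d x (fun_restrict V s)" if "x \<in> V" for x
    by (rule regular_at_cong[of N d x s V]) (use assms that in \<open>auto simp: line_sections_iff fun_restrict_def\<close>)
  with assms show ?thesis by (auto simp: line_sections_iff fun_restrict_def)
qed

subsection \<open>Independent columns and minors\<close>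

text \<open>A condition on a family indexed by \<open>C\<close>: two equal columns with different
  indices count as dependent, which a set of column vectors would hide.\<close>

definition indep_cols :: "'i set \<Rightarrow> 'c set \<Rightarrow> ('i \<Rightarrow> 'c \<Rightarrow> 'a::field) \<Rightarrow> bool" where
  "indep_cols I C X \<longleftrightarrow> (\<forall>a. (\<forall>i\<in>I. (\<Sum>c\<in>C. X i c * a c) = 0) \<longrightarrow> (\<forall>c\<in>C. a c = 0))"

text \<open>\<open>\<rho>\<close> and \<open>\<kappa>\<close> enumerate the chosen rows and columns.
  Their order affects only the sign, which matters neither for non-vanishing nor for the quotients
  in Cramer's rule.\<close>

definition minor :: "nat \<Rightarrow> (nat \<Rightarrow> 'i) \<Rightarrow> (nat \<Rightarrow> 'c) \<Rightarrow> ('i \<Rightarrow> 'c \<Rightarrow> 'a::comm_ring_1) \<Rightarrow> 'a" where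
  "minor k \<rho> \<kappa> X = det (mat k k (\<lambda>(i, j). X (\<rho> i) (\<kappa> j)))"

lemma indep_colsD:
  assumes "indep_cols I C X" "\<And>i. i \<in> I \<Longrightarrow> (\<Sum>c\<in>C. X i c * a c) = 0" "c \<in> C"
  shows "a c = 0"
  using assms unfolding indep_cols_def by blast

lemma (in comm_ring_hom) hom_minor: "hom (minor k \<rho> \<kappa> X) = minor k \<rho> \<kappa> (\<lambda>i c. hom (X i c))"
proof -
  have "map_mat hom (mat k k (\<lambda>(i, j). X (\<rho> i) (\<kappa> j))) = mat k k (\<lambda>(i, j). hom (X (\<rho> i) (\<kappa> j)))"
    by (intro eq_matI) auto
  then show ?thesis by (simp add: minor_def flip: hom_det)
qed

text \<open>A square matrix is singular iff it kills a nonzero vector; the bijections carry this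
  from the indices below \<open>k\<close> to \<open>R\<close> and \<open>C\<close>.\<close>

lemma minor_nonzero_iff:
  fixes X :: "'i \<Rightarrow> 'c \<Rightarrow> 'a::field"
  assumes \<rho>: "bij_betw \<rho> {..<k} R" and \<kappa>: "bij_betw \<kappa> {..<k} C"
  shows "minor k \<rho> \<kappa> X \<noteq> 0 \<longleftrightarrow> indep_cols R C X"
proof -
  let ?A = "mat k k (\<lambda>(i, j). X (\<rho> i) (\<kappa> j))"
  have A: "?A \<in> carrier_mat k k" by simp
  have sum: "(\<Sum>c\<in>C. X i c * a c) = (\<Sum>j<k. X i (\<kappa> j) * a (\<kappa> j))" for i a
    using sum.reindex_bij_betw[OF \<kappa>, of "\<lambda>c. X i c * a c"] by simp
  have mv: "(?A *\<^sub>v v) $ i = (\<Sum>j<k. X (\<rho> i) (\<kappa> j) * v $ j)" if "i < k" "v \<in> carrier_vec k" for i v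
    using that by (simp add: scalar_prod_def atLeast0LessThan)
  have "det ?A = 0 \<longleftrightarrow> \<not> indep_cols R C X"
  proof
    assume "det ?A = 0"
    then obtain v where v: "v \<in> carrier_vec k" "v \<noteq> 0\<^sub>v k" "?A *\<^sub>v v = 0\<^sub>v k"
      using det_0_iff_vec_prod_zero[OF A] by blast
    define a where "a c = v $ (the_inv_into {..<k} \<kappa> c)" for c
    have a: "a (\<kappa> j) = v $ j" if "j < k" for j
      using that \<kappa> by (simp add: a_def the_inv_into_f_f bij_betw_def)
    have "(\<Sum>c\<in>C. X i c * a c) = 0" if i: "i \<in> R" for i
    proof -
      obtain p where p: "p < k" "i = \<rho> p" using bij_betw_imp_surj_on[OF \<rho>] i by blast
      have "(\<Sum>c\<in>C. X i c * a c) = (?A *\<^sub>v v) $ p"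
        unfolding sum mv[OF p(1) v(1)] using p a by (intro sum.cong) auto
      then show ?thesis using v p by simp
    qed
    moreover obtain j where "j < k" "v $ j \<noteq> 0"
      using v(1,2) by (metis carrier_vecD eq_vecI index_zero_vec)
    then have "\<kappa> j \<in> C" "a (\<kappa> j) \<noteq> 0" using a \<kappa> by (auto simp: bij_betw_def)
    ultimately show "\<not> indep_cols R C X" unfolding indep_cols_def by blast
  next
    assume "\<not> indep_cols R C X"
    then obtain a c where a: "\<And>i. i \<in> R \<Longrightarrow> (\<Sum>c\<in>C. X i c * a c) = 0" and c: "c \<in> C" "a c \<noteq> 0"
      unfolding indep_cols_def by blast
    define v where "v = vec k (\<lambda>j. a (\<kappa> j))"
    have v: "v \<in> carrier_vec k" by (simp add: v_def)
    have "?A *\<^sub>v v = 0\<^sub>v k"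
    proof (rule eq_vecI)
      fix i assume "i < dim_vec (0\<^sub>v k :: 'a vec)"
      then have i: "i < k" by simp
      have "(?A *\<^sub>v v) $ i = (\<Sum>j<k. X (\<rho> i) (\<kappa> j) * a (\<kappa> j))"
        unfolding mv[OF i v] by (intro sum.cong) (auto simp: v_def)
      also have "\<dots> = 0" using a[of "\<rho> i"] \<rho> i unfolding sum by (auto simp: bij_betw_def)
      finally show "(?A *\<^sub>v v) $ i = 0\<^sub>v k $ i" using i by simp
    qed simp
    moreover obtain j where "j < k" "c = \<kappa> j" using bij_betw_imp_surj_on[OF \<kappa>] c by blast
    then have "v \<noteq> 0\<^sub>v k" using c by (auto simp: v_def dest!: arg_cong[of _ _ "\<lambda>v. v $ j"])
    ultimately show "det ?A = 0" using det_0_iff_vec_prod_zero[OF A] v by blast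
  qed
  then show ?thesis by (simp add: minor_def)
qed

lemma ex_enumeration: "finite A \<Longrightarrow> \<exists>\<rho>. bij_betw \<rho> {..<card A} A"
  using ex_bij_betw_nat_finite by (metis atLeast0LessThan)

lemma square_solve:
  fixes X :: "'i \<Rightarrow> 'c \<Rightarrow> 'a::field"
  assumes "finite R" "finite C" "card R = card C" "indep_cols R C X"
  shows "\<exists>a. \<forall>i\<in>R. (\<Sum>c\<in>C. X i c * a c) = b i"
proof -
  define k where "k = card C"
  obtain \<rho> where \<rho>: "bij_betw \<rho> {..<k} R" using ex_enumeration[OF assms(1)] assms(3) by (auto simp: k_def)
  obtain \<kappa> where \<kappa>: "bij_betw \<kappa> {..<k} C" using ex_enumeration[OF assms(2)] by (auto simp: k_def)
  let ?A = "mat k k (\<lambda>(i, j). X (\<rho> i) (\<kappa> j))"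
  have A: "?A \<in> carrier_mat k k" by simp
  have d: "det ?A \<noteq> 0" using minor_nonzero_iff[OF \<rho> \<kappa>, of X] assms(4) by (simp add: minor_def)
  define w where "w = vec k (\<lambda>i. b (\<rho> i))"
  \<comment> \<open>The inverse of \<open>?A\<close>, written with the adjugate, applied to the
    right-hand side.\<close>
  define v where "v = inverse (det ?A) \<cdot>\<^sub>v (adj_mat ?A *\<^sub>v w)"
  have w: "w \<in> carrier_vec k" by (simp add: w_def)
  note adj = adj_mat[OF A]
  have v: "v \<in> carrier_vec k" unfolding v_def by (intro smult_carrier_vec[THEN iffD2] mult_mat_vec_carrier[OF adj(1) w])
  have "?A *\<^sub>v v = inverse (det ?A) \<cdot>\<^sub>v (?A *\<^sub>v (adj_mat ?A *\<^sub>v w))"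
    unfolding v_def by (rule mult_mat_vec[OF A mult_mat_vec_carrier[OF adj(1) w]])
  also have "?A *\<^sub>v (adj_mat ?A *\<^sub>v w) = det ?A \<cdot>\<^sub>v w"
    unfolding assoc_mult_mat_vec[OF A adj(1) w, symmetric] adj(2)
    using w by (intro eq_vecI) auto
  also have "inverse (det ?A) \<cdot>\<^sub>v (det ?A \<cdot>\<^sub>v w) = w" using d by (simp add: smult_smult_assoc)
  finally have Av: "?A *\<^sub>v v = w" .
  define a where "a c = v $ (the_inv_into {..<k} \<kappa> c)" for c
  have a: "a (\<kappa> j) = v $ j" if "j < k" for j
    using that \<kappa> by (simp add: a_def the_inv_into_f_f bij_betw_def)
  have "(\<Sum>c\<in>C. X i c * a c) = b i" if i: "i \<in> R" for i
  proof -
    obtain p where p: "p < k" "i = \<rho> p" using bij_betw_imp_surj_on[OF \<rho>] i by blast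
    have "(\<Sum>c\<in>C. X i c * a c) = (\<Sum>j<k. X i (\<kappa> j) * a (\<kappa> j))"
      using sum.reindex_bij_betw[OF \<kappa>, of "\<lambda>c. X i c * a c"] by simp
    also have "\<dots> = (?A *\<^sub>v v) $ p"
      using p v a by (auto simp: scalar_prod_def atLeast0LessThan intro!: sum.cong)
    finally show ?thesis using p by (simp add: Av w_def)
  qed
  then show ?thesis by blast
qed

lemma indep_cols_subset_rows: "indep_cols R C X \<Longrightarrow> R \<subseteq> I \<Longrightarrow> indep_cols I C X"
  unfolding indep_cols_def by blast

text \<open>Induction on the columns. On the rows found so far the new column \<open>c\<close> is a
  combination of the old ones; by independence that combination fails in some row of
  \<open>I\<close>, and this row is added.\<close>

lemma indep_cols_select_rows:
  fixes X :: "'i \<Rightarrow> 'c \<Rightarrow> 'a::field"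
  assumes "finite I" "finite C" "indep_cols I C X"
  shows "\<exists>R\<subseteq>I. card R = card C \<and> indep_cols R C X"
  using assms(2,3)
proof (induction C rule: finite_induct)
  case empty
  show ?case by (rule exI[of _ "{}"]) (simp add: indep_cols_def)
next
  case (insert c C)
  have "indep_cols I C X"
    unfolding indep_cols_def
  proof (intro allI impI)
    fix a assume a: "\<forall>i\<in>I. (\<Sum>c\<in>C. X i c * a c) = 0"
    have "(\<Sum>c'\<in>insert c C. X i c' * (a(c := 0)) c') = (\<Sum>c\<in>C. X i c * a c)" for i
      using insert(1,2) by (auto intro!: sum.cong)
    then have "(a(c := 0)) c' = 0" if "c' \<in> C" for c'
      using that a indep_colsD[OF insert.prems, of "a(c := 0)" c'] by simp
    moreover have "(a(c := 0)) c' = a c'" if "c' \<in> C" for c'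
      using that insert(2) by auto
    ultimately show "\<forall>c\<in>C. a c = 0" by simp
  qed
  from insert.IH[OF this] obtain R where R: "R \<subseteq> I" "card R = card C" "indep_cols R C X" by blast
  have finR: "finite R" using R(1) assms(1) finite_subset by blast
  obtain a where a: "\<And>i. i \<in> R \<Longrightarrow> (\<Sum>c'\<in>C. X i c' * a c') = X i c"
    using square_solve[OF finR insert(1) R(2,3), of "\<lambda>i. X i c"] by blast
  define u where "u i = X i c - (\<Sum>c'\<in>C. X i c' * a c')" for i
  have "\<exists>i\<in>I. u i \<noteq> 0"
  proof (rule ccontr)
    assume "\<not> ?thesis"
    moreover have "(\<Sum>c'\<in>insert c C. X i c' * (if c' = c then 1 else - a c')) = u i" for i
    proof -
      have "(\<Sum>c'\<in>C. X i c' * (if c' = c then 1 else - a c')) = (\<Sum>c'\<in>C. - (X i c' * a c'))"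
        using insert(2) by (intro sum.cong) auto
      then show ?thesis using insert(1,2) by (simp add: u_def sum_negf)
    qed
    ultimately show False
      using indep_colsD[OF insert.prems, of "\<lambda>c'. if c' = c then 1 else - a c'" c] by simp
  qed
  then obtain i0 where i0: "i0 \<in> I" "u i0 \<noteq> 0" by blast
  have "i0 \<notin> R" using a i0(2) by (auto simp: u_def)
  moreover have "indep_cols (insert i0 R) (insert c C) X"
    unfolding indep_cols_def
  proof (intro allI impI)
    fix b assume b: "\<forall>i\<in>insert i0 R. (\<Sum>c'\<in>insert c C. X i c' * b c') = 0"
    have b': "(\<Sum>c'\<in>C. X i c' * b c') = - (X i c * b c)" if "i \<in> insert i0 R" for i
    proof -
      have "X i c * b c + (\<Sum>c'\<in>C. X i c' * b c') = 0"
        using bspec[OF b that] insert(1,2) by simp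
      then show ?thesis by (simp add: eq_neg_iff_add_eq_0 add.commute)
    qed
    \<comment> \<open>Eliminating column \<open>c\<close> from a relation leaves the old columns
      with the defect \<open>u\<close>. It vanishes on \<open>R\<close>, so the old coefficients
      vanish, and then row \<open>i0\<close> forces \<open>b c = 0\<close>.\<close>
    have eq: "(\<Sum>c'\<in>C. X i c' * (b c' + b c * a c')) = - (b c * u i)" if "i \<in> insert i0 R" for i
    proof -
      have "(\<Sum>c'\<in>C. X i c' * (b c' + b c * a c')) =
          (\<Sum>c'\<in>C. X i c' * b c') + b c * (\<Sum>c'\<in>C. X i c' * a c')"
        by (simp add: algebra_simps sum.distrib sum_distrib_left)
      then show ?thesis using b'[OF that] by (simp add: u_def algebra_simps)
    qed
    have z: "\<forall>c'\<in>C. b c' + b c * a c' = 0"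
      using eq a indep_colsD[OF R(3), of "\<lambda>c'. b c' + b c * a c'"] by (simp add: u_def)
    with eq[of i0] i0(2) have "b c = 0" by simp
    with z show "\<forall>c'\<in>insert c C. b c' = 0" by simp
  qed
  ultimately show ?case using R insert finR i0
    by (intro exI[of _ "insert i0 R"]) auto
qed

text \<open>Solutions for the unit vectors are the columns of a right inverse, so the determinant is
  nonzero.\<close>

lemma square_surj_indep:
  fixes X :: "'i \<Rightarrow> 'c \<Rightarrow> 'a::field"
  assumes "finite R" "finite C" "card R = card C"
    and "\<And>b. \<exists>a. \<forall>i\<in>R. (\<Sum>c\<in>C. X i c * a c) = b i"
  shows "indep_cols R C X"
proof -
  define k where "k = card C"
  obtain \<rho> where \<rho>: "bij_betw \<rho> {..<k} R" using ex_enumeration[OF assms(1)] assms(3) by (auto simp: k_def)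
  obtain \<kappa> where \<kappa>: "bij_betw \<kappa> {..<k} C" using ex_enumeration[OF assms(2)] by (auto simp: k_def)
  let ?A = "mat k k (\<lambda>(i, j). X (\<rho> i) (\<kappa> j))"
  have A: "?A \<in> carrier_mat k k" by simp
  have "\<forall>j. \<exists>a. \<forall>i\<in>R. (\<Sum>c\<in>C. X i c * a c) = (if i = \<rho> j then 1 else 0)"
    by (intro allI assms(4))
  then obtain a where a: "\<And>j i. i \<in> R \<Longrightarrow> (\<Sum>c\<in>C. X i c * a j c) = (if i = \<rho> j then 1 else 0)"
    by metis
  let ?B = "mat k k (\<lambda>(i, j). a j (\<kappa> i))"
  have "?A * ?B = 1\<^sub>m k"
  proof (rule eq_matI)
    fix i j assume "i < dim_row (1\<^sub>m k :: 'a mat)" "j < dim_col (1\<^sub>m k :: 'a mat)"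
    then have ij: "i < k" "j < k" by auto
    have "(?A * ?B) $$ (i, j) = (\<Sum>l<k. X (\<rho> i) (\<kappa> l) * a j (\<kappa> l))"
      using ij by (auto simp: scalar_prod_def atLeast0LessThan intro!: sum.cong)
    also have "\<dots> = (\<Sum>c\<in>C. X (\<rho> i) c * a j c)"
      using sum.reindex_bij_betw[OF \<kappa>, of "\<lambda>c. X (\<rho> i) c * a j c"] by simp
    also have "\<dots> = (if \<rho> i = \<rho> j then 1 else 0)"
      using a ij \<rho> by (auto simp: bij_betw_def)
    also have "\<rho> i = \<rho> j \<longleftrightarrow> i = j" using \<rho> ij by (auto simp: bij_betw_def inj_on_def)
    finally show "(?A * ?B) $$ (i, j) = 1\<^sub>m k $$ (i, j)" using ij by simp
  qed auto
  then have "det ?A * det ?B = 1" using det_mult[of ?A k ?B] by simp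
  then have "det ?A \<noteq> 0" by auto
  then show ?thesis using minor_nonzero_iff[OF \<rho> \<kappa>, of X] by (simp add: minor_def)
qed

text \<open>Each coordinate of a solution is a quotient of minors; for matrices of forms this is
  what makes the solution regular.\<close>

lemma cramer:
  fixes X :: "'i \<Rightarrow> 'c \<Rightarrow> 'a::field"
  assumes \<rho>: "bij_betw \<rho> {..<k} R" and \<kappa>: "bij_betw \<kappa> {..<k} C" and "minor k \<rho> \<kappa> X \<noteq> 0"
    and sol: "\<And>i. i \<in> R \<Longrightarrow> (\<Sum>c\<in>C. X i c * a c) = b i" and j: "j < k"
  shows "a (\<kappa> j) = minor k \<rho> \<kappa> (\<lambda>i c. if c = \<kappa> j then b i else X i c) / minor k \<rho> \<kappa> X"
proof -
  let ?A = "mat k k (\<lambda>(i, j). X (\<rho> i) (\<kappa> j))"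
  define v where "v = vec k (\<lambda>j. a (\<kappa> j))"
  have v: "v \<in> carrier_vec k" by (simp add: v_def)
  have Av: "(?A *\<^sub>v v) $ i = b (\<rho> i)" if "i < k" for i
  proof -
    have "(?A *\<^sub>v v) $ i = (\<Sum>j<k. X (\<rho> i) (\<kappa> j) * a (\<kappa> j))"
      using that by (auto simp: v_def scalar_prod_def atLeast0LessThan intro!: sum.cong)
    also have "\<dots> = (\<Sum>c\<in>C. X (\<rho> i) c * a c)"
      using sum.reindex_bij_betw[OF \<kappa>, of "\<lambda>c. X (\<rho> i) c * a c"] by simp
    also have "\<dots> = b (\<rho> i)" using sol that \<rho> by (auto simp: bij_betw_def)
    finally show ?thesis .
  qed
  have "replace_col ?A (?A *\<^sub>v v) j =
      mat k k (\<lambda>(i, l). if \<kappa> l = \<kappa> j then b (\<rho> i) else X (\<rho> i) (\<kappa> l))"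
    using j Av \<kappa> by (intro eq_matI) (auto simp: replace_col_def bij_betw_def inj_on_def)
  with cramer_lemma_mat[of ?A k v j] v j
  have "minor k \<rho> \<kappa> (\<lambda>i c. if c = \<kappa> j then b i else X i c) = a (\<kappa> j) * minor k \<rho> \<kappa> X"
    by (simp add: minor_def v_def)
  then show ?thesis using assms(3) by (simp add: field_simps)
qed

text \<open>Some linear functional is 1 at \<open>t\<close> and 0 on a basis of the column span; its
  values at the unit vectors are the coefficients \<open>l\<close>.\<close>

lemma exists_annihilator:
  fixes X :: "'i \<Rightarrow> 'c \<Rightarrow> 'a::field"
  assumes I: "finite I" and C: "finite C" and "\<not> (\<exists>z. \<forall>i\<in>I. t i = (\<Sum>c\<in>C. X i c * z c))"
  shows "\<exists>l. (\<forall>c\<in>C. (\<Sum>i\<in>I. l i * X i c) = 0) \<and> (\<Sum>i\<in>I. l i * t i) \<noteq> 0"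
proof -
  \<comment> \<open>Vectors are functions on the whole index type, so columns and target are set to
    0 outside \<open>I\<close>; on them a functional is determined by its values at the unit vectors
    from \<open>I\<close>.\<close>
  define col where "col c i = (if i \<in> I then X i c else 0)" for c i
  define t' where "t' i = (if i \<in> I then t i else 0)" for i
  have comb: "\<exists>z. \<forall>i. v i = (\<Sum>c\<in>C. col c i * z c)" if "v \<in> fun_vs.span (col ` C)" for v
    using that
  proof (induction rule: fun_vs.span_induct_alt)
    case base
    show ?case by (rule exI[of _ "\<lambda>_. 0"]) simp
  next
    case (step k x y)
    then obtain z c where z: "\<forall>i. y i = (\<Sum>c\<in>C. col c i * z c)" and c: "c \<in> C" "x = col c" by blast
    have "(\<Sum>c'\<in>C. col c' i * (if c' = c then k else 0)) = k * col c i" for i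
      using c C by (simp add: sum.delta' if_distrib cong: if_cong)
    then show ?case
      by (intro exI[of _ "\<lambda>c'. (if c' = c then k else 0) + z c'"])
        (simp add: fscale_def z c(2) algebra_simps sum.distrib)
  qed
  have nt: "t' \<notin> fun_vs.span (col ` C)"
  proof
    assume "t' \<in> fun_vs.span (col ` C)"
    from comb[OF this] obtain z where z: "\<And>i. t' i = (\<Sum>c\<in>C. col c i * z c)" by blast
    have "t i = (\<Sum>c\<in>C. X i c * z c)" if "i \<in> I" for i
      using z[of i] that by (simp add: t'_def col_def)
    with assms(3) show False by blast
  qed
  obtain B where B: "B \<subseteq> col ` C" "fun_vs.independent B" "col ` C \<subseteq> fun_vs.span B"
    using fun_vs.basis_exists[of "col ` C"] by metis
  have "t' \<notin> fun_vs.span B" using nt fun_vs.span_mono[OF B(1)] by blast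
  with B(2) have ind: "fun_vs.independent (insert t' B)"
    by (simp add: fun_vs.independent_insertI)
  interpret vsp: vector_space_pair "fscale :: 'a \<Rightarrow> ('i \<Rightarrow> 'a) \<Rightarrow> 'i \<Rightarrow> 'a" "(*) :: 'a \<Rightarrow> 'a \<Rightarrow> 'a"
    by unfold_locales (auto simp: algebra_simps)
  obtain L where L: "Vector_Spaces.linear fscale (*) L" "\<forall>x\<in>insert t' B. L x = (if x = t' then 1 else 0)"
    using vsp.linear_independent_extend[OF ind, of "\<lambda>x. if x = t' then 1 else 0"] by blast
  interpret L: Vector_Spaces.linear fscale "(*)" L by (rule L(1))
  have tB: "t' \<notin> B" using nt B(1) fun_vs.span_superset by blast
  have zero: "L v = 0" if "v \<in> fun_vs.span B" for v
    using that
  proof (induction rule: fun_vs.span_induct_alt)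
    case (step k x y)
    with L(2) tB have "L x = 0" by auto
    with step show ?case by (simp only: L.add L.scale mult_zero_right add_0_left)
  qed (rule L.zero)
  define l where "l i = L (\<lambda>j. if j = i then 1 else 0)" for i
  have expand: "L v = (\<Sum>i\<in>I. l i * v i)" if "\<And>i. i \<notin> I \<Longrightarrow> v i = 0" for v
  proof -
    have "v = (\<Sum>i\<in>I. fscale (v i) (\<lambda>j. if j = i then 1 else 0))"
    proof
      fix j
      have "(\<Sum>i\<in>I. fscale (v i) (\<lambda>j. if j = i then 1 else 0)) j = (\<Sum>i\<in>I. if j = i then v i else 0)"
        unfolding fscale_def by (induction I rule: infinite_finite_induct) auto
      then show "v j = (\<Sum>i\<in>I. fscale (v i) (\<lambda>j. if j = i then 1 else 0)) j"
        using that I by (simp add: sum.delta)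
    qed
    then have "L v = L (\<Sum>i\<in>I. fscale (v i) (\<lambda>j. if j = i then 1 else 0))" by (rule arg_cong)
    also have "\<dots> = (\<Sum>i\<in>I. l i * v i)" by (simp add: L.sum L.scale l_def mult.commute)
    finally show ?thesis .
  qed
  have "(\<Sum>i\<in>I. l i * X i c) = 0" if "c \<in> C" for c
  proof -
    have "L (col c) = 0" using zero B(3) that by blast
    moreover have "L (col c) = (\<Sum>i\<in>I. l i * X i c)"
      by (subst expand) (auto simp: col_def intro!: sum.cong)
    ultimately show ?thesis by simp
  qed
  moreover have "(\<Sum>i\<in>I. l i * t i) = L t'"
    by (subst expand) (auto simp: t'_def intro!: sum.cong)
  moreover have "L t' = 1" using L(2) by simp
  ultimately show ?thesis by (intro exI[of _ l]) simp
qed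

subsection \<open>Determinants as alternating functions of their rows\<close>

text \<open>Row \<open>j\<close> is the function \<open>c j\<close>, so that multilinearity and
  alternation become statements about function updates.\<close>

definition alt :: "nat \<Rightarrow> (nat \<Rightarrow> nat \<Rightarrow> 'a::comm_ring_1) \<Rightarrow> 'a" where
  "alt k c = det (mat k k (\<lambda>(j, p). c j p))"

lemma alt_cong: "(\<And>j p. j < k \<Longrightarrow> p < k \<Longrightarrow> c j p = d j p) \<Longrightarrow> alt k c = alt k d"
  unfolding alt_def by (intro arg_cong[of _ _ det] eq_matI) auto

lemma alt_leibniz: "alt k c = (\<Sum>\<pi> | \<pi> permutes {0..<k}. of_int (sign \<pi>) * (\<Prod>j = 0..<k. c j (\<pi> j)))"
  unfolding alt_def
  by (subst det_def'[of _ k]) (auto intro!: sum.cong prod.cong simp: permutes_in_image)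

lemma (in comm_ring_hom) hom_alt: "hom (alt k c) = alt k (\<lambda>j p. hom (c j p))"
  unfolding alt_leibniz by (simp add: hom_distribs)

text \<open>Each Leibniz term contains exactly one factor from row \<open>j\<close>.\<close>

lemma alt_sum:
  assumes "finite A" "j < k"
  shows "alt k (c(j := \<lambda>p. \<Sum>i\<in>A. a i * u i p)) = (\<Sum>i\<in>A. a i * alt k (c(j := u i)))"
proof -
  have *: "(\<Prod>l = 0..<k. (c(j := v)) l (\<pi> l)) = v (\<pi> j) * (\<Prod>l \<in> {0..<k} - {j}. c l (\<pi> l))" for v \<pi>
    using assms(2) by (subst prod.remove[of _ j]) (auto intro!: prod.cong)
  show ?thesis
    unfolding alt_leibniz * sum_distrib_left
    by (subst sum.swap) (auto intro!: sum.cong simp: sum_distrib_right sum_distrib_left algebra_simps)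
qed

lemma alt_add_scaled:
  assumes "j < k"
  shows "alt k (c(j := \<lambda>p. u p + t * v p)) = alt k (c(j := u)) + t * alt k (c(j := v))"
  using alt_sum[of "{0, 1}" j k c "\<lambda>i. if i = 0 then 1 else t" "\<lambda>i::nat. if i = 0 then u else v"] assms
  by simp

lemma alt_same:
  assumes "i \<noteq> j" "i < k" "j < k" "c i = c j"
  shows "alt k c = 0"
  unfolding alt_def using assms
  by (intro det_identical_rows[of _ k i j]) (auto intro!: eq_vecI)

text \<open>Polarization: the determinant with \<open>u + v\<close> in both places vanishes, and so
  do the two terms of its expansion with a repeated row.\<close>

lemma alt_swap:
  assumes "i \<noteq> j" "i < k" "j < k"
  shows "alt k (c(i := u, j := v)) = - alt k (c(i := v, j := u))"
proof -
  let ?s = "\<lambda>p. u p + 1 * v p"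
  have "0 = alt k (c(i := ?s, j := ?s))" by (rule alt_same[of i j, symmetric]) (use assms in auto)
  also have "\<dots> = alt k (c(i := ?s, j := u)) + alt k (c(i := ?s, j := v))"
    using alt_add_scaled[of j k "c(i := ?s)" u 1 v] assms by simp
  also have "\<dots> = alt k (c(i := u, j := u)) + alt k (c(i := v, j := u))
      + (alt k (c(i := u, j := v)) + alt k (c(i := v, j := v)))"
    using alt_add_scaled[of i k "c(j := u)" u 1 v] alt_add_scaled[of i k "c(j := v)" u 1 v] assms
    by (simp add: fun_upd_twist[of i j])
  also have "alt k (c(i := u, j := u)) = 0" by (rule alt_same[of i j]) (use assms in auto)
  also have "alt k (c(i := v, j := v)) = 0" by (rule alt_same[of i j]) (use assms in auto)
  finally have "0 = 0 + alt k (c(i := v, j := u)) + (alt k (c(i := u, j := v)) + 0)" .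
  then have "alt k (c(i := u, j := v)) + alt k (c(i := v, j := u)) = 0"
    by (simp only: add_0_left add_0_right add.commute)
  then show ?thesis by (simp only: eq_neg_iff_add_eq_0)
qed

text \<open>Terms in which two rows have been replaced by \<open>z\<close> vanish, so the expansion
  stops after the linear part.\<close>

lemma alt_rank_one_update:
  assumes "finite S" "S \<subseteq> {..<k}"
  shows "alt k (\<lambda>j p. c j p + (if j \<in> S then t j * z p else 0)) =
    alt k c + (\<Sum>j\<in>S. t j * alt k (c(j := z)))"
  using assms
proof (induction S arbitrary: c rule: finite_induct)
  case (insert i S)
  let ?d = "\<lambda>j p. c j p + (if j \<in> S then t j * z p else 0)"
  have i: "i < k" using insert by auto
  have "alt k (\<lambda>j p. c j p + (if j \<in> insert i S then t j * z p else 0)) =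
      alt k (?d(i := \<lambda>p. c i p + t i * z p))"
    using insert by (intro alt_cong) auto
  also have "\<dots> = alt k (?d(i := c i)) + t i * alt k (?d(i := z))"
    using i by (rule alt_add_scaled)
  also have "?d(i := c i) = ?d" using insert by auto
  also have "alt k (?d(i := z)) = alt k (\<lambda>j p. (c(i := z)) j p + (if j \<in> S then t j * z p else 0))"
    using insert by (intro alt_cong) auto
  also have "\<dots> = alt k (c(i := z)) + (\<Sum>j\<in>S. t j * alt k (c(i := z, j := z)))"
    using insert by (intro insert.IH) auto
  also have "(\<Sum>j\<in>S. t j * alt k (c(i := z, j := z))) = 0"
  proof (intro sum.neutral ballI)
    fix j assume "j \<in> S"
    then have "alt k (c(i := z, j := z)) = 0"
      using insert i by (intro alt_same[of i j]) auto
    then show "t j * alt k (c(i := z, j := z)) = 0" by simp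
  qed
  finally show ?case using insert by (simp add: insert.IH algebra_simps)
qed simp

lemma alt_nonzero_iff:
  fixes c :: "nat \<Rightarrow> nat \<Rightarrow> 'a::field"
  shows "alt k c \<noteq> 0 \<longleftrightarrow> indep_cols {..<k} {..<k} (\<lambda>p j. c j p)"
proof -
  have "alt k c = det (transpose_mat (mat k k (\<lambda>(j, p). c j p)))"
    unfolding alt_def by (rule det_transpose[symmetric, of _ k]) simp
  also have "transpose_mat (mat k k (\<lambda>(j, p). c j p)) = mat k k (\<lambda>(p, j). c j p)"
    by (intro eq_matI) auto
  also have "det \<dots> = minor k id id (\<lambda>p j. c j p)" by (simp add: minor_def)
  finally show ?thesis using minor_nonzero_iff[of id k "{..<k}" id "{..<k}"] by simp
qed

lemma alt_transpose:
  assumes "i \<noteq> j" "i < k" "j < k" "d i = c j" "d j = c i" "\<And>l. l \<noteq> i \<Longrightarrow> l \<noteq> j \<Longrightarrow> d l = c l"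
  shows "alt k d = - alt k c"
proof -
  have "d = c(i := c j, j := c i)" "c = c(i := c i, j := c j)"
    using assms by (auto simp: fun_eq_iff)
  then show ?thesis using alt_swap[OF assms(1-3), of c "c j" "c i"] by metis
qed

lemma sum_antidiagonal:
  fixes f :: "nat \<Rightarrow> 'a::comm_monoid_add"
  shows "(\<Sum>j\<le>N. f (N - j)) = (\<Sum>j\<le>N. f j)"
  by (rule sum.reindex_bij_witness[of _ "\<lambda>j. N - j" "\<lambda>j. N - j"]) auto

subsection \<open>The contraction of the volume form with the symplectic form\<close>

definition unit_row :: "nat \<Rightarrow> nat \<Rightarrow> 'a::comm_ring_1" where
  "unit_row q = (\<lambda>p. if p = q then 1 else 0)"

text \<open>Row \<open>j\<close> up to \<open>N\<close> is column \<open>j\<close> of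
  \<open>B\<close>, and row \<open>N + 1\<close> is \<open>t\<close>, both cut down to the
  \<open>N\<close> coordinates enumerated by \<open>\<rho>\<close>. Columns \<open>N\<close> and
  \<open>N + 1\<close> are left zero for the unit rows.\<close>

definition psi_rows :: "nat \<Rightarrow> (nat \<Rightarrow> nat \<Rightarrow> 'a::comm_ring_1) \<Rightarrow> (nat \<Rightarrow> nat) \<Rightarrow> (nat \<Rightarrow> 'a) \<Rightarrow> nat \<Rightarrow> nat \<Rightarrow> 'a" where
  "psi_rows N B \<rho> t = (\<lambda>j p. if p < N then if j \<le> N then B (\<rho> p) j else t (\<rho> p) else 0)"

text \<open>The two unit rows in the places \<open>i\<close> and \<open>N - i\<close> delete these rows, without the signs that a
  minor with rows \<open>i\<close> and \<open>N - i\<close> removed would bring in.\<close>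

definition psi_term where
  "psi_term N B \<rho> t i = alt (N + 2) ((psi_rows N B \<rho> t)(i := unit_row N, N - i := unit_row (Suc N)))"

text \<open>Contracting the symplectic form removes pairs \<open>i\<close>, \<open>N - i\<close> of
  columns of \<open>B\<close>. In the intended case the sum meets each pair twice with equal
  contributions, as \<open>F\<close> and \<open>psi_term\<close> both change sign; hence the factor
  2 in \<open>psi_eq\<close>.\<close>

definition psi where
  "psi N F B \<rho> t = (\<Sum>i\<le>N. F i * psi_term N B \<rho> t i)"

lemma (in comm_ring_hom) hom_psi:
  "hom (psi N F B \<rho> t) = psi N (\<lambda>i. hom (F i)) (\<lambda>k j. hom (B k j)) \<rho> (\<lambda>k. hom (t k))"
  unfolding psi_def psi_term_def
  by (simp add: hom_distribs hom_alt)
    (intro sum.cong refl arg_cong2[of _ _ _ _ "(*)"] alt_cong, auto simp: psi_rows_def unit_row_def)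

lemma psi_linear:
  assumes "finite A"
  shows "psi N F B \<rho> (\<lambda>k. \<Sum>l\<in>A. a l * u l k) = (\<Sum>l\<in>A. a l * psi N F B \<rho> (u l))"
proof -
  have "psi_term N B \<rho> (\<lambda>k. \<Sum>l\<in>A. a l * u l k) i = (\<Sum>l\<in>A. a l * psi_term N B \<rho> (u l) i)"
    if "i \<le> N" for i
  proof -
    \<comment> \<open>Rows \<open>i\<close> and \<open>N - i\<close> are at most \<open>N\<close>,
      so the unit rows leave row \<open>N + 1\<close>, the only one containing \<open>t\<close>, in
      place.\<close>
    let ?c = "(psi_rows N B \<rho> (\<lambda>_. 0))(i := unit_row N, N - i := unit_row (Suc N))"
    let ?v = "\<lambda>l p. if p < N then u l (\<rho> p) else 0"
    have *: "psi_term N B \<rho> (u l) i = alt (N + 2) (?c(Suc N := ?v l))" for l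
      unfolding psi_term_def using that by (intro alt_cong) (auto simp: psi_rows_def)
    have "psi_term N B \<rho> (\<lambda>k. \<Sum>l\<in>A. a l * u l k) i = alt (N + 2) (?c(Suc N := \<lambda>p. \<Sum>l\<in>A. a l * ?v l p))"
      unfolding psi_term_def using that by (intro alt_cong) (auto simp: psi_rows_def)
    also have "\<dots> = (\<Sum>l\<in>A. a l * alt (N + 2) (?c(Suc N := ?v l)))"
      by (rule alt_sum) (use assms in auto)
    finally show ?thesis by (simp add: *)
  qed
  then show ?thesis
    unfolding psi_def
    by (simp add: sum_distrib_left) (subst sum.swap, simp add: algebra_simps)
qed

text \<open>One fibre over an arbitrary field: \<open>F\<close> holds the antidiagonal entries of
  the symplectic form, the only nonzero ones, \<open>G\<close> the values of the g_i, and
  \<open>B\<close> the map to the summands in \<open>K\<close>. The index \<open>m\<close> is a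
  pivot; oddness of \<open>N\<close> makes \<open>N - m\<close> a different index.\<close>

locale symplectic_fibre =
  fixes N :: nat and F G :: "nat \<Rightarrow> 'a::field" and K :: "nat set" and B :: "nat \<Rightarrow> nat \<Rightarrow> 'a" and m :: nat
  assumes odd_N: "odd N" and m_le: "m \<le> N" and Gm: "G m \<noteq> 0"
    and F_nz: "\<And>i. i \<le> N \<Longrightarrow> F i \<noteq> 0" and F_skew: "\<And>i. i \<le> N \<Longrightarrow> F (N - i) = - F i"
    and K_finite: "finite K" and BG: "\<And>k. k \<in> K \<Longrightarrow> (\<Sum>j\<le>N. B k j * G j) = 0"
    and rG: "(\<Sum>j\<le>N. F (N - j) * G (N - j) * G j) = 0"
begin

abbreviation "m' \<equiv> N - m"
text \<open>Modulo \<open>G\<close> the coordinate \<open>m\<close> of a vector can be made zero,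
  and then r = 0 determines the coordinate \<open>m'\<close>. The coordinates in \<open>L\<close>
  are free.\<close>

definition "L = {..N} - {m, m'}"
definition "r j = F (N - j) * G (N - j)"
definition "tt j = - r j / r m'"
text \<open>For \<open>j\<close> in \<open>L\<close>, column \<open>j\<close> is the image under
  \<open>B\<close> of the vector in the kernel of \<open>r\<close> with 1 at \<open>j\<close>,
  \<open>tt j\<close> at \<open>m'\<close> and 0 elsewhere.\<close>

definition "w k j = B k j + tt j * B k m'"
text \<open>The inverse of an antidiagonal matrix is antidiagonal, here with the entry
  \<open>1 / F (N - j)\<close> at \<open>(j, N - j)\<close>; hence a single sum for the product of
  \<open>B\<close>, the inverse form and the transpose of \<open>B\<close>.\<close>

definition "M k l = (\<Sum>j\<le>N. B k j * B l (N - j) / F (N - j))"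

lemma compl_neq: "i \<le> N \<Longrightarrow> N - i \<noteq> i"
  using odd_N by presburger

lemma m'_neq: "m' \<noteq> m" and m'_le: "m' \<le> N" and N_m': "N - m' = m"
  using compl_neq m_le by auto

lemma rm'_nz: "r m' \<noteq> 0"
  using F_nz[OF m_le] Gm m_le by (simp add: r_def)

lemma L_finite: "finite L" and L_le: "j \<in> L \<Longrightarrow> j \<le> N"
  by (auto simp: L_def)

lemma L_compl: "i \<in> L \<Longrightarrow> N - i \<in> L"
  using m_le by (auto simp: L_def)

lemma card_L: "card L + 1 = N"
proof -
  have "card L = card {..N} - card {m, m'}"
    unfolding L_def using m_le by (intro card_Diff_subset) auto
  moreover have "N \<ge> 1" using odd_N by (cases N) auto
  ultimately show ?thesis using m'_neq by (simp add: numeral_2_eq_2)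
qed

lemma sum_split: "(\<Sum>j\<le>N. f j) = f m + f m' + (\<Sum>j\<in>L. f j)"
proof -
  have "{..N} = insert m (insert m' L)" "m \<notin> L" "m' \<notin> L" using m_le by (auto simp: L_def)
  then show ?thesis using m'_neq L_finite by (simp add: add.assoc)
qed

text \<open>Subtracting a multiple of \<open>G\<close> to clear coordinate \<open>m\<close> changes
  neither \<open>B s\<close>, by \<open>BG\<close>, nor the value of \<open>r\<close>, by
  \<open>rG\<close>; coordinate \<open>m'\<close> is then solved from r = 0.\<close>

lemma image_in_span_w:
  assumes "(\<Sum>j\<le>N. r j * s j) = 0"
  shows "\<exists>p. \<forall>k\<in>K. (\<Sum>j\<le>N. B k j * s j) = (\<Sum>j\<in>L. w k j * p j)"
proof -
  define c where "c = s m / G m"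
  define s' where "s' j = s j - c * G j" for j
  have s'm: "s' m = 0" using Gm by (simp add: s'_def c_def)
  have "(\<Sum>j\<le>N. r j * s' j) = (\<Sum>j\<le>N. r j * s j) - c * (\<Sum>j\<le>N. F (N - j) * G (N - j) * G j)"
    by (simp add: s'_def r_def algebra_simps sum_subtractf sum_distrib_left)
  then have "(\<Sum>j\<le>N. r j * s' j) = 0" using assms rG by simp
  then have "r m' * s' m' = - (\<Sum>j\<in>L. r j * s' j)"
    unfolding sum_split using s'm by (simp add: eq_neg_iff_add_eq_0)
  then have "s' m' = - (\<Sum>j\<in>L. r j * s' j) / r m'"
    using rm'_nz by (simp add: field_simps)
  then have s'm': "s' m' = (\<Sum>j\<in>L. tt j * s' j)"
    by (simp add: tt_def sum_divide_distrib sum_negf)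
  have "(\<Sum>j\<le>N. B k j * s j) = (\<Sum>j\<in>L. w k j * s' j)" if "k \<in> K" for k
  proof -
    have "(\<Sum>j\<le>N. B k j * s j) = (\<Sum>j\<le>N. B k j * s' j) + c * (\<Sum>j\<le>N. B k j * G j)"
      by (simp add: s'_def algebra_simps sum_subtractf sum_distrib_left)
    also have "\<dots> = B k m' * (\<Sum>j\<in>L. tt j * s' j) + (\<Sum>j\<in>L. B k j * s' j)"
      unfolding BG[OF that] unfolding sum_split using s'm by (simp add: s'm')
    also have "\<dots> = (\<Sum>j\<in>L. w k j * s' j)"
      by (simp add: w_def algebra_simps sum_distrib_left sum.distrib)
    finally show ?thesis .
  qed
  then show ?thesis by blast
qed

text \<open>The clause \<open>s m = 0\<close> is what lets \<open>w_indep\<close> conclude that a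
  multiple of \<open>G\<close> is zero.\<close>

lemma span_w_in_image:
  "\<exists>s. (\<Sum>j\<le>N. r j * s j) = 0 \<and> (\<forall>j\<in>L. s j = p j) \<and> s m = 0 \<and>
    (\<forall>k. (\<Sum>j\<le>N. B k j * s j) = (\<Sum>j\<in>L. w k j * p j))"
proof -
  define s where "s j = (if j = m then 0 else if j = m' then \<Sum>j\<in>L. tt j * p j else p j)" for j
  have s: "s m = 0" "s m' = (\<Sum>j\<in>L. tt j * p j)" "\<And>j. j \<in> L \<Longrightarrow> s j = p j"
    using m'_neq by (auto simp: s_def L_def)
  have "(\<Sum>j\<le>N. r j * s j) = 0"
    unfolding sum_split using rm'_nz by (simp add: s tt_def sum_negf sum_divide_distrib[symmetric])
  moreover have "(\<Sum>j\<le>N. B k j * s j) = (\<Sum>j\<in>L. w k j * p j)" for k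
    unfolding sum_split by (simp add: s w_def algebra_simps sum_distrib_left sum.distrib)
  ultimately show ?thesis using s by (intro exI[of _ s]) simp
qed

text \<open>\<open>s\<close> is the inverse form applied to the transpose of \<open>B\<close>
  applied to \<open>z\<close>. Against it \<open>r\<close> becomes the pairing with
  \<open>G\<close>: the factor \<open>F (N - j)\<close> cancels, and \<open>BG\<close> gives
  zero.\<close>

lemma M_factor:
  fixes z :: "nat \<Rightarrow> 'a"
  assumes "finite C"
  defines "s \<equiv> \<lambda>j. (\<Sum>l\<in>C. B l (N - j) * z l) / F (N - j)"
  shows "(\<Sum>l\<in>C. M k l * z l) = (\<Sum>j\<le>N. B k j * s j)"
    and "C \<subseteq> K \<Longrightarrow> (\<Sum>j\<le>N. r j * s j) = 0"
proof -
  show "(\<Sum>l\<in>C. M k l * z l) = (\<Sum>j\<le>N. B k j * s j)"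
    unfolding M_def s_def sum_distrib_right sum_divide_distrib sum_distrib_left
    by (subst sum.swap) (simp add: algebra_simps)
  assume C: "C \<subseteq> K"
  have "(\<Sum>j\<le>N. r j * s j) = (\<Sum>j\<le>N. \<Sum>l\<in>C. z l * (B l (N - j) * G (N - j)))"
  proof (intro sum.cong refl)
    fix j assume "j \<in> {..N}"
    then have "r j * s j = G (N - j) * (\<Sum>l\<in>C. B l (N - j) * z l)"
      using F_nz[of "N - j"] by (simp add: r_def s_def)
    then show "r j * s j = (\<Sum>l\<in>C. z l * (B l (N - j) * G (N - j)))"
      by (simp add: sum_distrib_left algebra_simps)
  qed
  also have "\<dots> = (\<Sum>l\<in>C. z l * (\<Sum>j\<le>N. B l (N - j) * G (N - j)))"
    by (subst sum.swap) (simp add: sum_distrib_left)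
  also have "\<dots> = (\<Sum>l\<in>C. z l * (\<Sum>j\<le>N. B l j * G j))"
    using sum_antidiagonal[of "\<lambda>j. B l j * G j" N for l] by simp
  also have "\<dots> = 0" using C BG by (intro sum.neutral) auto
  finally show "(\<Sum>j\<le>N. r j * s j) = 0" .
qed

lemma M_skew: "M l k = - M k l"
proof -
  have "M l k = (\<Sum>j\<le>N. B l (N - j) * B k (N - (N - j)) / F (N - (N - j)))"
    unfolding M_def by (rule sum_antidiagonal[symmetric])
  also have "\<dots> = (\<Sum>j\<le>N. - (B k j * B l (N - j) / F (N - j)))"
    by (intro sum.cong) (auto simp: F_skew)
  finally show ?thesis by (simp add: M_def sum_negf)
qed

lemma M_in_span_w: "\<exists>p. \<forall>k\<in>K. (\<Sum>l\<in>K. M k l * z l) = (\<Sum>j\<in>L. w k j * p j)"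
  using image_in_span_w[OF M_factor(2)[OF K_finite order_refl]] by (simp add: M_factor(1)[OF K_finite])

text \<open>At points \<open>nondeg\<close> is supplied by the indecomposability of W. The lemmas
  outside this context serve the field of rational functions as well.\<close>

context
  assumes nondeg: "\<And>s. (\<And>k. k \<in> K \<Longrightarrow> (\<Sum>j\<le>N. B k j * s j) = 0) \<Longrightarrow> (\<Sum>j\<le>N. r j * s j) = 0 \<Longrightarrow>
    \<exists>c. \<forall>j\<le>N. s j = c * G j"
begin

lemma w_indep: "indep_cols K L w"
  unfolding indep_cols_def
proof (intro allI impI)
  fix p assume p: "\<forall>k\<in>K. (\<Sum>j\<in>L. w k j * p j) = 0"
  obtain s where s: "(\<Sum>j\<le>N. r j * s j) = 0" "\<And>j. j \<in> L \<Longrightarrow> s j = p j" "s m = 0"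
      "\<And>k. (\<Sum>j\<le>N. B k j * s j) = (\<Sum>j\<in>L. w k j * p j)"
    using span_w_in_image[of p] by blast
  obtain c where c: "\<forall>j\<le>N. s j = c * G j"
    using nondeg[OF _ s(1)] s(4) p by auto
  with s(3) Gm m_le have "c = 0" by simp
  with c s(2) L_le show "\<forall>j\<in>L. p j = 0" by fastforce
qed

text \<open>Otherwise some \<open>l\<close> annihilates the range of \<open>M\<close> but not
  \<open>B s\<close>. As \<open>M\<close> is skew, \<open>M l = 0\<close>, so the vector
  \<open>s0\<close> built from \<open>l\<close> is killed by \<open>B\<close> and by
  \<open>r\<close> and is a multiple of \<open>G\<close>. Undoing the inverse form, the transpose of
  \<open>B\<close> sends \<open>l\<close> to a multiple of \<open>r\<close>, which kills
  \<open>s\<close>.\<close>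

lemma image_in_range_M:
  assumes "(\<Sum>j\<le>N. r j * s j) = 0"
  shows "\<exists>z. \<forall>k\<in>K. (\<Sum>j\<le>N. B k j * s j) = (\<Sum>l\<in>K. M k l * z l)"
proof (rule ccontr)
  assume "\<not> ?thesis"
  from exists_annihilator[OF K_finite K_finite this] obtain l where
    l: "\<And>c. c \<in> K \<Longrightarrow> (\<Sum>k\<in>K. l k * M k c) = 0" "(\<Sum>k\<in>K. l k * (\<Sum>j\<le>N. B k j * s j)) \<noteq> 0"
    by blast
  define s0 where "s0 j = (\<Sum>k\<in>K. B k (N - j) * l k) / F (N - j)" for j
  have "(\<Sum>j\<le>N. B k j * s0 j) = 0" if "k \<in> K" for k
  proof -
    have "(\<Sum>j\<le>N. B k j * s0 j) = (\<Sum>c\<in>K. M k c * l c)"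
      unfolding s0_def by (rule M_factor(1)[OF K_finite, symmetric])
    also have "\<dots> = - (\<Sum>c\<in>K. l c * M c k)"
      by (subst M_skew) (simp add: sum_negf mult.commute)
    finally show ?thesis using l(1)[OF that] by simp
  qed
  moreover have "(\<Sum>j\<le>N. r j * s0 j) = 0"
    unfolding s0_def by (rule M_factor(2)[OF K_finite order_refl])
  ultimately obtain c where c: "\<And>j. j \<le> N \<Longrightarrow> s0 j = c * G j" using nondeg by blast
  have *: "(\<Sum>k\<in>K. B k j * l k) = - c * r j" if "j \<le> N" for j
    using c[of "N - j"] F_nz[OF that] F_skew[OF that] that by (simp add: s0_def r_def field_simps)
  have "(\<Sum>k\<in>K. l k * (\<Sum>j\<le>N. B k j * s j)) = (\<Sum>j\<le>N. s j * (\<Sum>k\<in>K. B k j * l k))"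
    unfolding sum_distrib_left by (subst sum.swap) (simp add: algebra_simps)
  also have "\<dots> = (\<Sum>j\<le>N. - c * (r j * s j))"
    by (intro sum.cong) (auto simp: *)
  also have "\<dots> = - c * (\<Sum>j\<le>N. r j * s j)" by (simp add: sum_distrib_left sum_negf)
  finally show False using assms l(2) by simp
qed

end

section \<open>The contraction expressed through the vectors \<open>w\<close>\<close>

lemma psi_term_compl:
  assumes "i \<le> N"
  shows "psi_term N B \<rho> t (N - i) = - psi_term N B \<rho> t i"
  unfolding psi_term_def
  using assms compl_neq[OF assms] by (intro alt_transpose[of i "N - i"]) auto

text \<open>The relation \<open>BG\<close> expresses row \<open>m\<close> through the other rows; all but rows \<open>i\<close> and \<open>N - i\<close>, which
  unit rows have replaced, give determinants with two equal rows.\<close>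

lemma psi_term_eliminate:
  fixes \<rho> :: "nat \<Rightarrow> nat" and t :: "nat \<Rightarrow> 'a"
  defines "c \<equiv> psi_rows N B \<rho> t"
  defines "D \<equiv> \<lambda>j. alt (N + 2) (c(m := unit_row N, m' := unit_row (Suc N), j := c m'))"
  assumes i: "i \<in> L" and \<rho>: "\<And>p. p < N \<Longrightarrow> \<rho> p \<in> K"
  shows "G m * psi_term N B \<rho> t i = G (N - i) * D i - G i * D (N - i)"
proof -
  have ne: "i \<noteq> m" "i \<noteq> m'" "N - i \<noteq> m" "N - i \<noteq> m'" "N - i \<noteq> i" "m' \<noteq> m" "i \<le> N"
    using i L_compl[OF i] compl_neq L_le[OF i] m'_neq by (auto simp: L_def)
  let ?d = "c(i := unit_row N, N - i := unit_row (Suc N))"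
  have rel: "G m * c m p = (\<Sum>j\<in>{..N} - {m}. - G j * c j p)" for p
  proof (cases "p < N")
    case True
    have "(\<Sum>j\<le>N. c j p * G j) = 0" using True BG[OF \<rho>[OF True]] by (simp add: c_def psi_rows_def)
    then have "c m p * G m + (\<Sum>j\<in>{..N} - {m}. c j p * G j) = 0"
      using m_le by (subst (asm) sum.remove[of _ m]) auto
    then show ?thesis by (simp add: sum_negf algebra_simps eq_neg_iff_add_eq_0)
  qed (simp add: c_def psi_rows_def)
  have "G m * psi_term N B \<rho> t i = G m * alt (N + 2) (?d(m := c m))"
    using ne by (simp add: psi_term_def c_def fun_upd_idem)
  also have "\<dots> = alt (N + 2) (?d(m := \<lambda>p. G m * c m p))"
    using alt_sum[of "{0::nat}" m "N + 2" ?d "\<lambda>_. G m" "\<lambda>_. c m"] m_le by simp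
  also have "\<dots> = (\<Sum>j\<in>{..N} - {m}. - G j * alt (N + 2) (?d(m := c j)))"
    unfolding rel using m_le by (intro alt_sum) auto
  also have "\<dots> = (\<Sum>j\<in>{i, N - i}. - G j * alt (N + 2) (?d(m := c j)))"
  proof (rule sum.mono_neutral_right)
    show "\<forall>j\<in>{..N} - {m} - {i, N - i}. - G j * alt (N + 2) (?d(m := c j)) = 0"
    proof
      fix j assume "j \<in> {..N} - {m} - {i, N - i}"
      then have "alt (N + 2) (?d(m := c j)) = 0"
        using m_le by (intro alt_same[of m j]) auto
      then show "- G j * alt (N + 2) (?d(m := c j)) = 0" by simp
    qed
  qed (use ne in auto)
  also have "\<dots> = - G i * alt (N + 2) (?d(m := c i)) - G (N - i) * alt (N + 2) (?d(m := c (N - i)))"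
    using ne by simp
  also have "alt (N + 2) (?d(m := c i)) = D (N - i)"
  proof -
    have "alt (N + 2) (?d(m := c i)) = - alt (N + 2) (c(N - i := unit_row (Suc N), m := unit_row N))"
      using ne m_le by (intro alt_transpose[of i m]) auto
    also have "alt (N + 2) (c(N - i := unit_row (Suc N), m := unit_row N)) = - D (N - i)"
      unfolding D_def using ne m_le by (intro alt_transpose[of "N - i" m']) auto
    finally show ?thesis by (simp only: minus_minus)
  qed
  \<comment> \<open>Three transpositions here against two in the case of \<open>c i\<close>; this is
    the source of the opposite signs of the two terms.\<close>
  also have "alt (N + 2) (?d(m := c (N - i))) = - D i"
  proof -
    have "alt (N + 2) (?d(m := c (N - i))) =
        - alt (N + 2) (c(i := c (N - i), N - i := unit_row (Suc N), m := unit_row N))"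
      using ne m_le by (intro alt_transpose[of i m]) auto
    also have "alt (N + 2) (c(i := c (N - i), N - i := unit_row (Suc N), m := unit_row N)) =
        - alt (N + 2) (c(i := c (N - i), N - i := c m', m := unit_row N, m' := unit_row (Suc N)))"
      using ne m_le by (intro alt_transpose[of "N - i" m']) auto
    also have "alt (N + 2) (c(i := c (N - i), N - i := c m', m := unit_row N, m' := unit_row (Suc N))) = - D i"
      unfolding D_def using ne m_le by (intro alt_transpose[of "N - i" i]) auto
    finally show ?thesis by (simp only: minus_minus)
  qed
  finally show ?thesis by simp
qed

text \<open>The unit rows sit in the pivot places, so the determinant is, up to sign, that of the
  vectors \<open>w j\<close>, \<open>j \<in> L\<close>, and \<open>t\<close> in the coordinates
  \<open>\<rho>\<close>.\<close>

definition psi_w :: "(nat \<Rightarrow> nat) \<Rightarrow> (nat \<Rightarrow> 'a) \<Rightarrow> nat \<Rightarrow> nat \<Rightarrow> 'a" where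
  "psi_w \<rho> t = (\<lambda>j p. if j = m then unit_row N p else if j = m' then unit_row (Suc N) p
     else if p < N then if j \<le> N then w (\<rho> p) j else t (\<rho> p) else 0)"

text \<open>Each \<open>w j\<close> is column \<open>j\<close> of \<open>B\<close> plus
  \<open>tt j\<close> times column \<open>m'\<close>, so the rank-one expansion writes the
  determinant of \<open>psi_w\<close> through \<open>T m\<close> and the \<open>D j\<close>. In
  \<open>psi\<close> the places \<open>m\<close> and \<open>m'\<close> give
  \<open>2 * F m * T m\<close>; the others, after elimination by the relation with \<open>G\<close>,
  give each \<open>D j\<close> twice.\<close>

lemma psi_eq:
  assumes \<rho>: "\<And>p. p < N \<Longrightarrow> \<rho> p \<in> K"
  shows "psi N F B \<rho> t = 2 * F m * alt (N + 2) (psi_w \<rho> t)"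
proof -
  define c where "c = psi_rows N B \<rho> t"
  define D where "D j = alt (N + 2) (c(m := unit_row N, m' := unit_row (Suc N), j := c m'))" for j
  define T where "T = psi_term N B \<rho> t"
  \<comment> \<open>This identity, from the skewness of \<open>F\<close>, matches the coefficients
    of the two expansions.\<close>
  have tt: "tt i * (F m * G m) = F i * G (N - i)" if "i \<in> L" for i
    using F_nz[OF m_le] Gm F_skew[OF L_le[OF that]] m_le by (simp add: tt_def r_def field_simps)
  have "psi_w \<rho> t j p = (c(m := unit_row N, m' := unit_row (Suc N))) j p + (if j \<in> L then tt j * c m' p else 0)" for j p
    using m'_neq m_le by (auto simp: psi_w_def c_def psi_rows_def L_def w_def)
  then have "alt (N + 2) (psi_w \<rho> t) = alt (N + 2)
      (\<lambda>j p. (c(m := unit_row N, m' := unit_row (Suc N))) j p + (if j \<in> L then tt j * c m' p else 0))"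
    by (intro alt_cong)
  also have "\<dots> = T m + (\<Sum>j\<in>L. tt j * D j)"
    unfolding T_def psi_term_def D_def c_def[symmetric]
    by (rule alt_rank_one_update) (auto simp: L_def)
  finally have W: "alt (N + 2) (psi_w \<rho> t) = T m + (\<Sum>j\<in>L. tt j * D j)" .
  have reindex: "(\<Sum>i\<in>L. F i * (G i * D (N - i))) = - (\<Sum>i\<in>L. F i * (G (N - i) * D i))"
  proof -
    have "(\<Sum>i\<in>L. F i * (G i * D (N - i))) = (\<Sum>i\<in>L. F (N - i) * (G (N - i) * D i))"
      by (rule sum.reindex_bij_witness[of _ "\<lambda>i. N - i" "\<lambda>i. N - i"]) (auto simp: L_compl L_le)
    also have "\<dots> = (\<Sum>i\<in>L. - (F i * (G (N - i) * D i)))"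
      by (intro sum.cong) (auto simp: F_skew L_le)
    finally show ?thesis by (simp add: sum_negf)
  qed
  \<comment> \<open>Everything is multiplied by \<open>G m\<close>, since the elimination expresses
    only \<open>G m * T i\<close>; the factor is cancelled at the end.\<close>
  have "G m * psi N F B \<rho> t = G m * (F m * T m + F m' * T m') + (\<Sum>i\<in>L. F i * (G m * T i))"
    unfolding psi_def T_def[symmetric] sum_split by (simp add: algebra_simps sum_distrib_left)
  also have "F m' * T m' = F m * T m"
    using psi_term_compl[OF m_le] F_skew[OF m_le] by (simp add: T_def)
  also have "(\<Sum>i\<in>L. F i * (G m * T i)) = (\<Sum>i\<in>L. F i * (G (N - i) * D i - G i * D (N - i)))"
    using psi_term_eliminate[OF _ \<rho>] by (intro sum.cong) (auto simp: T_def D_def c_def)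
  also have "\<dots> = (\<Sum>i\<in>L. F i * (G (N - i) * D i)) - (\<Sum>i\<in>L. F i * (G i * D (N - i)))"
    by (simp only: right_diff_distrib sum_subtractf)
  also have "\<dots> = 2 * (\<Sum>i\<in>L. F i * G (N - i) * D i)"
    unfolding reindex by (simp add: algebra_simps)
  also have "(\<Sum>i\<in>L. F i * G (N - i) * D i) = F m * G m * (\<Sum>i\<in>L. tt i * D i)"
    unfolding sum_distrib_left
  proof (intro sum.cong refl)
    fix i assume "i \<in> L"
    then show "F i * G (N - i) * D i = F m * G m * (tt i * D i)"
      using tt[of i] by (metis mult.assoc mult.commute)
  qed
  finally have "G m * psi N F B \<rho> t = G m * (2 * F m * alt (N + 2) (psi_w \<rho> t))"
    unfolding W by (simp add: algebra_simps)
  then show ?thesis using Gm by simp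
qed

lemma psi_zero:
  assumes \<rho>: "\<And>p. p < N \<Longrightarrow> \<rho> p \<in> K" and t: "\<And>k. k \<in> K \<Longrightarrow> t k = (\<Sum>j\<in>L. w k j * q j)"
  shows "psi N F B \<rho> t = 0"
proof -
  \<comment> \<open>The relation that the \<open>q\<close>-combination of the \<open>w j\<close>
    minus \<open>t\<close> vanishes; the unit rows get coefficient 0, and the -1 makes it
    nontrivial.\<close>
  define a where "a j = (if j \<in> L then q j else if j = Suc N then -1 else 0)" for j
  have sub: "insert (Suc N) L \<subseteq> {..<N + 2}" "Suc N \<notin> L" by (auto simp: L_def)
  have "(\<Sum>j<N + 2. psi_w \<rho> t j p * a j) = 0" for p
  proof -
    have "(\<Sum>j<N + 2. psi_w \<rho> t j p * a j) = (\<Sum>j\<in>insert (Suc N) L. psi_w \<rho> t j p * a j)"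
      using sub by (intro sum.mono_neutral_right) (auto simp: a_def)
    also have "\<dots> = psi_w \<rho> t (Suc N) p * a (Suc N) + (\<Sum>j\<in>L. psi_w \<rho> t j p * a j)"
      using sub L_finite by simp
    also have "psi_w \<rho> t (Suc N) p = (if p < N then t (\<rho> p) else 0)"
      using m_le m'_le by (auto simp: psi_w_def)
    also have "a (Suc N) = - 1" using sub by (simp add: a_def)
    also have "(\<Sum>j\<in>L. psi_w \<rho> t j p * a j) = (\<Sum>j\<in>L. (if p < N then w (\<rho> p) j else 0) * q j)"
      by (intro sum.cong) (auto simp: psi_w_def a_def L_def)
    also have "\<dots> = (if p < N then t (\<rho> p) else 0)" using t[OF \<rho>] by auto
    finally show ?thesis by simp
  qed
  moreover have "a (Suc N) \<noteq> 0" using sub by (simp add: a_def)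
  ultimately have "\<not> indep_cols {..<N + 2} {..<N + 2} (\<lambda>p j. psi_w \<rho> t j p)"
    unfolding indep_cols_def by (metis add_2_eq_Suc' lessI lessThan_iff)
  then show ?thesis using alt_nonzero_iff[of "N + 2" "psi_w \<rho> t"] psi_eq[OF \<rho>] by simp
qed

text \<open>Coordinates \<open>N\<close> and \<open>N + 1\<close> force the coefficients of the two
  unit rows to vanish, and what is left is a relation among the \<open>w j\<close> and
  \<open>t\<close>. The factor 2 of \<open>psi_eq\<close> explains the condition on the
  characteristic.\<close>

lemma psi_nonzero:
  assumes \<rho>: "bij_betw \<rho> {..<N} R" "R \<subseteq> K" and "(2::'a) \<noteq> 0"
    and ind: "indep_cols R (insert (Suc N) L) (\<lambda>k j. if j = Suc N then t k else w k j)"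
  shows "psi N F B \<rho> t \<noteq> 0"
proof -
  have \<rho>K: "\<rho> p \<in> R" if "p < N" for p using \<rho> that by (auto simp: bij_betw_def)
  have "indep_cols {..<N + 2} {..<N + 2} (\<lambda>p j. psi_w \<rho> t j p)"
    unfolding indep_cols_def
  proof (intro allI impI)
    fix a assume a: "\<forall>p\<in>{..<N + 2}. (\<Sum>j<N + 2. psi_w \<rho> t j p * a j) = 0"
    have split: "(\<Sum>j<N + 2. f j) = f m + f m' + (\<Sum>j\<in>L. f j) + f (Suc N)" for f :: "nat \<Rightarrow> 'a"
    proof -
      have "(\<Sum>j<N + 2. f j) = (\<Sum>j\<le>N. f j) + f (Suc N)"
        by (simp add: lessThan_Suc_atMost)
      then show ?thesis by (simp add: sum_split)
    qed
    have v: "psi_w \<rho> t m p = unit_row N p" "psi_w \<rho> t m' p = unit_row (Suc N) p"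
      "psi_w \<rho> t (Suc N) p = (if p < N then t (\<rho> p) else 0)"
      "\<And>j. j \<in> L \<Longrightarrow> psi_w \<rho> t j p = (if p < N then w (\<rho> p) j else 0)" for p
      using m_le m'_le m'_neq by (auto simp: psi_w_def L_def)
    from a have e: "unit_row N p * a m + unit_row (Suc N) p * a m' + (\<Sum>j\<in>L. (if p < N then w (\<rho> p) j else 0) * a j)
        + (if p < N then t (\<rho> p) else 0) * a (Suc N) = 0" if "p < N + 2" for p
    proof -
      have "(\<Sum>j\<in>L. psi_w \<rho> t j p * a j) = (\<Sum>j\<in>L. (if p < N then w (\<rho> p) j else 0) * a j)"
        by (intro sum.cong) (auto simp: v)
      moreover have "(\<Sum>j<N + 2. psi_w \<rho> t j p * a j) = 0" using a that by blast
      ultimately show ?thesis by (simp only: split v(1-3))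
    qed
    have am: "a m = 0" "a m' = 0" using e[of N] e[of "Suc N"] by (auto simp: unit_row_def)
    have "(\<Sum>j\<in>insert (Suc N) L. (if j = Suc N then t k else w k j) * a j) = 0" if k: "k \<in> R" for k
    proof -
      obtain p where p: "p < N" "k = \<rho> p" using bij_betw_imp_surj_on[OF \<rho>(1)] k by blast
      have "(\<Sum>j\<in>L. (if j = Suc N then t k else w k j) * a j) = (\<Sum>j\<in>L. w k j * a j)"
        by (intro sum.cong) (auto simp: L_def)
      moreover have "Suc N \<notin> L" by (simp add: L_def)
      ultimately show ?thesis
        using e[of p] p am L_finite by (simp add: unit_row_def algebra_simps)
    qed
    from indep_colsD[OF ind this] have "\<forall>j\<in>insert (Suc N) L. a j = 0" by blast
    moreover have "{..<N + 2} = {m, m'} \<union> insert (Suc N) L" using m_le by (auto simp: L_def)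
    ultimately show "\<forall>j\<in>{..<N + 2}. a j = 0" using am by auto
  qed
  then have "alt (N + 2) (psi_w \<rho> t) \<noteq> 0" by (simp add: alt_nonzero_iff)
  moreover have "psi N F B \<rho> t = 2 * F m * alt (N + 2) (psi_w \<rho> t)"
    using \<rho>K \<rho>(2) by (intro psi_eq) auto
  ultimately show ?thesis using F_nz[OF m_le] assms(3) by simp
qed

end

subsection \<open>Lifting sections along a matrix of constant rank\<close>

lemma minor_leibniz:
  "minor k \<rho> \<kappa> X = (\<Sum>\<pi> | \<pi> permutes {0..<k}. of_int (sign \<pi>) * (\<Prod>i = 0..<k. X (\<rho> i) (\<kappa> (\<pi> i))))"
  unfolding minor_def
  by (subst det_def'[of _ k]) (auto intro!: sum.cong prod.cong simp: permutes_in_image)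

lemma minor_transpose: "minor k \<kappa> \<rho> (\<lambda>c i. X i c) = minor k \<rho> \<kappa> X"
proof -
  have "transpose_mat (mat k k (\<lambda>(i, j). X (\<rho> i) (\<kappa> j))) = mat k k (\<lambda>(i, j). X (\<rho> j) (\<kappa> i))"
    by (intro eq_matI) auto
  then show ?thesis unfolding minor_def
    using det_transpose[of "mat k k (\<lambda>(i, j). X (\<rho> i) (\<kappa> j))" k] by simp
qed

lemma indep_cols_transpose:
  fixes X :: "'i \<Rightarrow> 'c \<Rightarrow> 'a::field"
  assumes "finite R" "finite C" "card R = card C" "indep_cols R C X"
  shows "indep_cols C R (\<lambda>c i. X i c)"
proof -
  obtain \<rho> where \<rho>: "bij_betw \<rho> {..<card C} R" using ex_enumeration[OF assms(1)] assms(3) by auto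
  obtain \<kappa> where \<kappa>: "bij_betw \<kappa> {..<card C} C" using ex_enumeration[OF assms(2)] by auto
  show ?thesis
    using minor_nonzero_iff[OF \<rho> \<kappa>, of X] minor_nonzero_iff[OF \<kappa> \<rho>, of "\<lambda>c i. X i c"] assms(4)
    unfolding minor_transpose[of "card C" \<kappa> \<rho> X] by simp
qed

lemma regular_at_const: "x \<in> cone_pts N \<Longrightarrow> regular_at N 0 x (\<lambda>_. c)"
  using regular_at_form[of N 0 "cst c" x] by (simp add: peval_cst[abs_def])

lemma regular_at_prod:
  assumes "x \<in> cone_pts N" "finite A" "\<And>i. i \<in> A \<Longrightarrow> regular_at N (d i) x (s i)"
  shows "regular_at N (sum d A) x (\<lambda>y. \<Prod>i\<in>A. s i y)"
  using assms(2,3)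
  by (induction A rule: finite_induct) (auto intro!: regular_at_mult[OF _ _ refl] regular_at_const assms(1))

text \<open>The degree count of \<open>is_form_det\<close> for entries that are only regular
  functions: in Cramer's rule one column consists of components of a section.\<close>

lemma regular_at_minor:
  assumes x: "x \<in> cone_pts N"
    and X: "\<And>i j. i < k \<Longrightarrow> j < k \<Longrightarrow> regular_at N (e i - d j) x (X (\<rho> i) (\<kappa> j))"
  shows "regular_at N ((\<Sum>i<k. e i) - (\<Sum>j<k. d j)) x (\<lambda>y. minor k \<rho> \<kappa> (\<lambda>i j. X i j y))"
  unfolding minor_leibniz
proof (intro regular_at_sum x)
  fix \<pi> assume "\<pi> \<in> {\<pi>. \<pi> permutes {0..<k}}"
  then have \<pi>: "\<pi> permutes {0..<k}" by simp
  have "regular_at N (\<Sum>i = 0..<k. e i - d (\<pi> i)) x (\<lambda>y. \<Prod>i = 0..<k. X (\<rho> i) (\<kappa> (\<pi> i)) y)"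
    using \<pi> by (intro regular_at_prod x X) (auto simp: permutes_in_image)
  moreover have "(\<Sum>i = 0..<k. d (\<pi> i)) = (\<Sum>j = 0..<k. d j)"
    using sum.permute[OF \<pi>, of d] by (simp add: o_def)
  ultimately show "regular_at N ((\<Sum>i<k. e i) - (\<Sum>j<k. d j)) x
      (\<lambda>y. of_int (sign \<pi>) * (\<Prod>i = 0..<k. X (\<rho> i) (\<kappa> (\<pi> i)) y))"
    by (intro regular_at_mult[OF regular_at_const[OF x]]) (auto simp: sum_subtractf atLeast0LessThan)
qed

section \<open>Sections of sums of line bundles and the maps given by matrices of forms\<close>

lemma line_sum_carrier_iff:
  assumes "zopen N U"
  shows "s \<in> carrier (Sec (line_sum N I d) U) \<longleftrightarrow>
    (\<forall>i x. i \<notin> I \<or> x \<notin> U \<longrightarrow> s i x = 0) \<and> (\<forall>i\<in>I. \<forall>x\<in>U. regular_at N (d i) x (s i))"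
  by (auto simp: line_sum_def line_sections_iff[OF assms] fun_eq_iff)

lemma line_sum_zero [simp]: "\<zero>\<^bsub>Sec (line_sum N I d) U\<^esub> = (\<lambda>i x. 0)"
  and line_sum_add [simp]: "s \<oplus>\<^bsub>Sec (line_sum N I d) U\<^esub> t = (\<lambda>i x. s i x + t i x)"
  and line_sum_smult [simp]: "r \<odot>\<^bsub>Sec (line_sum N I d) U\<^esub> s = (\<lambda>i x. r x * s i x)"
  and line_sum_Res [simp]: "Res (line_sum N I d) U V s = (\<lambda>i. fun_restrict V (s i))"
  by (auto simp: line_sum_def)

lemma line_sum_outside:
  assumes "s \<in> carrier (Sec (line_sum N I d) U)" "i \<notin> I \<or> x \<notin> U"
  shows "s i x = 0"
  using assms line_sections_outside[of "s i" N "d i" U x] by (cases "i \<in> I") (auto simp: line_sum_def)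

lemma line_sum_mono:
  assumes "s \<in> carrier (Sec (line_sum N I d) U)" "zopen N U" "I \<subseteq> I'"
  shows "s \<in> carrier (Sec (line_sum N I' d) U)"
  unfolding line_sum_carrier_iff[OF assms(2)]
proof (intro conjI allI impI ballI)
  fix i x assume i: "i \<in> I'" and x: "x \<in> U"
  show "regular_at N (d i) x (s i)"
  proof (cases "i \<in> I")
    case False
    then have "s i = (\<lambda>_. 0)" using assms by (auto simp: line_sum_carrier_iff)
    then show ?thesis using regular_at_0 x zopen_subset[OF assms(2)] by (simp add: subset_iff)
  qed (use assms x in \<open>simp add: line_sum_carrier_iff\<close>)
qed (use assms in \<open>auto simp: line_sum_carrier_iff\<close>)

lemma line_sum_restrict:
  assumes "s \<in> carrier (Sec (line_sum N I d) U)" "zopen N U" "zopen N V" "V \<subseteq> U"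
  shows "(\<lambda>i. fun_restrict V (s i)) \<in> carrier (Sec (line_sum N I d) V)"
proof -
  have "fun_restrict V (s i) \<in> line_sections N (d i) V" if "i \<in> I" for i
    by (rule line_sections_restrict[OF _ assms(2-4)]) (use assms(1) that in \<open>auto simp: line_sum_def\<close>)
  moreover have "fun_restrict V (s i) = (\<lambda>_. 0)" if "i \<notin> I" for i
    using assms(1) that by (auto simp: line_sum_def fun_restrict_def)
  ultimately show ?thesis by (simp add: line_sum_def)
qed

lemma line_sum_closed_zero: "zopen N U \<Longrightarrow> (\<lambda>i x. 0) \<in> carrier (Sec (line_sum N I d) U)"
  by (simp add: line_sum_def)

lemma line_sum_closed_add:
  assumes "zopen N U" "s \<in> carrier (Sec (line_sum N I d) U)" "t \<in> carrier (Sec (line_sum N I d) U)"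
  shows "(\<lambda>i x. s i x + t i x) \<in> carrier (Sec (line_sum N I d) U)"
  using assms by (auto simp: line_sum_carrier_iff intro: regular_at_add)

lemma line_sum_closed_smult:
  assumes "zopen N U" "r \<in> line_sections N 0 U" "s \<in> carrier (Sec (line_sum N I d) U)"
  shows "(\<lambda>i x. r x * s i x) \<in> carrier (Sec (line_sum N I d) U)"
  using assms
  by (auto simp: line_sum_carrier_iff line_sections_iff intro!: regular_at_mult[OF _ _ add_0_left])

lemma constant_line_sections:
  assumes "zopen N U"
  shows "fun_restrict U (\<lambda>_. c) \<in> line_sections N 0 U"
  unfolding line_sections_iff[OF assms]
proof (intro conjI ballI)
  fix x assume x: "x \<in> U"
  show "regular_at N 0 x (fun_restrict U (\<lambda>_. c))"
    by (rule regular_at_cong[OF regular_at_const assms x])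
      (use x zopen_subset[OF assms] in \<open>auto simp: fun_restrict_def\<close>)
qed (simp add: fun_restrict_def)

lemma line_sum_closed_uminus:
  assumes U: "zopen N U" and s: "s \<in> carrier (Sec (line_sum N I d) U)"
  shows "(\<lambda>i x. - s i x) \<in> carrier (Sec (line_sum N I d) U)"
proof -
  have "(\<lambda>i x. - s i x) = (\<lambda>i x. fun_restrict U (\<lambda>_. -1) x * s i x)"
    using s by (auto simp: fun_eq_iff fun_restrict_def line_sum_carrier_iff[OF U])
  then show ?thesis using line_sum_closed_smult[OF U constant_line_sections[OF U] s] by simp
qed

text \<open>Negative degrees are allowed and mean a zero entry; their absence is part of
  \<open>form_matrix_of_rank\<close> and is secured by the bound on \<gamma>.\<close>

definition form_matrix :: "nat \<Rightarrow> 'i set \<Rightarrow> ('i \<Rightarrow> int) \<Rightarrow> 'j set \<Rightarrow> ('j \<Rightarrow> int) \<Rightarrow> ('i \<Rightarrow> 'j \<Rightarrow> cpoly) \<Rightarrow> bool" where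
  "form_matrix N I d J d' M \<longleftrightarrow> (\<forall>i\<in>I. \<forall>j\<in>J. is_form N (d i - d' j) (M i j))"

lemma matrix_map_closed:
  assumes "form_matrix N I d J d' M" "zopen N U" "s \<in> carrier (Sec (line_sum N J d') U)"
  shows "matrix_map I J M U s \<in> carrier (Sec (line_sum N I d) U)"
  unfolding line_sum_carrier_iff[OF assms(2)]
proof (intro conjI allI ballI impI)
  fix i x assume i: "i \<in> I" and x: "x \<in> U"
  with assms(2) have x': "x \<in> cone_pts N" using zopen_subset by blast
  have "regular_at N (d i) x (\<lambda>x. \<Sum>j\<in>J. peval (M i j) x * s j x)"
  proof (intro regular_at_sum x')
    fix j assume j: "j \<in> J"
    show "regular_at N (d i) x (\<lambda>x. peval (M i j) x * s j x)"
      by (rule regular_at_mult[OF regular_at_form[of N "d i - d' j"], of _ _ "d' j"])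
        (use assms i j x x' in \<open>auto simp: form_matrix_def line_sum_carrier_iff[OF assms(2)]\<close>)
  qed
  then show "regular_at N (d i) x (matrix_map I J M U s i)"
    using i by (simp add: matrix_map_def)
qed (use assms in \<open>auto simp: matrix_map_def line_sum_carrier_iff[OF assms(2)]\<close>)

lemma matrix_map_add:
  "matrix_map I J M U (\<lambda>j x. s j x + t j x) = (\<lambda>i x. matrix_map I J M U s i x + matrix_map I J M U t i x)"
  by (auto simp: matrix_map_def fun_eq_iff algebra_simps sum.distrib)

lemma matrix_map_smult:
  "matrix_map I J M U (\<lambda>j x. r x * s j x) = (\<lambda>i x. r x * matrix_map I J M U s i x)"
  by (auto simp: matrix_map_def fun_eq_iff algebra_simps sum_distrib_left)

lemma matrix_map_restrict:
  "matrix_map I J M V (\<lambda>j. fun_restrict V (s j)) = (\<lambda>i. fun_restrict V (matrix_map I J M U s i))"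
  by (auto simp: matrix_map_def fun_eq_iff fun_restrict_def)

lemma matrix_map_zero: "matrix_map I J M U (\<lambda>j x. 0) = (\<lambda>i x. 0)"
  by (auto simp: matrix_map_def fun_eq_iff)

lemma shf_hom_matrix_map:
  assumes "form_matrix N I d J d' M"
  shows "shf_hom N (line_sum N J d') (line_sum N I d) (matrix_map I J M)"
  unfolding shf_hom_def
  using matrix_map_closed[OF assms]
  by (auto simp: matrix_map_add matrix_map_smult matrix_map_restrict)

text \<open>\<open>X\<close> and \<open>w\<close> have the same column span. The coordinates
  \<open>q\<close> of the columns of \<open>X\<close> with respect to \<open>w\<close> have full
  rank because these columns also span each column of \<open>w\<close>; an invertible square block
  of \<open>q\<close> selects \<open>C\<close>.\<close>

lemma select_columns:
  fixes X :: "'i \<Rightarrow> 'j \<Rightarrow> 'a::field"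
  assumes fin: "finite I" "finite J" "finite L" and ind: "indep_cols I L w"
    and sub: "\<And>z. \<exists>p. \<forall>i\<in>I. (\<Sum>j\<in>J. X i j * z j) = (\<Sum>l\<in>L. w i l * p l)"
    and sup: "\<And>p. \<exists>z. \<forall>i\<in>I. (\<Sum>l\<in>L. w i l * p l) = (\<Sum>j\<in>J. X i j * z j)"
  shows "\<exists>C\<subseteq>J. card C = card L \<and> indep_cols I C X"
proof -
  have "\<exists>p. \<forall>i\<in>I. X i j = (\<Sum>l\<in>L. w i l * p l)" if "j \<in> J" for j
    using sub[of "\<lambda>j'. if j' = j then 1 else 0"] that fin by (simp add: if_distrib cong: if_cong)
  then have "\<forall>j. \<exists>p. j \<in> J \<longrightarrow> (\<forall>i\<in>I. X i j = (\<Sum>l\<in>L. w i l * p l))"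
    by blast
  then obtain q where q: "\<And>j i. j \<in> J \<Longrightarrow> i \<in> I \<Longrightarrow> X i j = (\<Sum>l\<in>L. w i l * q j l)"
    by metis
  have "indep_cols J L q"
    unfolding indep_cols_def
  proof (intro allI impI ballI)
    fix b l assume b: "\<forall>j\<in>J. (\<Sum>l\<in>L. q j l * b l) = 0" and l: "l \<in> L"
    obtain z where z: "\<forall>i\<in>I. (\<Sum>l'\<in>L. w i l' * (if l' = l then 1 else 0)) = (\<Sum>j\<in>J. X i j * z j)"
      using sup[of "\<lambda>l'. if l' = l then 1 else 0"] by blast
    have "(\<Sum>l'\<in>L. w i l' * ((\<Sum>j\<in>J. q j l' * z j) - (if l' = l then 1 else 0))) = 0" if "i \<in> I" for i
    proof -
      have "(\<Sum>l'\<in>L. w i l' * (\<Sum>j\<in>J. q j l' * z j)) = (\<Sum>j\<in>J. (\<Sum>l'\<in>L. w i l' * q j l') * z j)"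
        unfolding sum_distrib_left sum_distrib_right by (subst sum.swap) (simp add: mult.assoc)
      also have "\<dots> = (\<Sum>j\<in>J. X i j * z j)" using that by (simp add: q)
      finally show ?thesis using z that by (simp add: right_diff_distrib sum_subtractf)
    qed
    from indep_colsD[OF ind this]
    have qz: "(\<Sum>j\<in>J. q j l' * z j) = (if l' = l then 1 else 0)" if "l' \<in> L" for l'
      using that by fastforce
    have "b l = (\<Sum>l'\<in>L. (if l' = l then 1 else 0) * b l')"
      using l fin by (simp add: if_distrib[of "\<lambda>c. c * _"] cong: if_cong)
    also have "\<dots> = (\<Sum>l'\<in>L. (\<Sum>j\<in>J. q j l' * z j) * b l')" using qz by simp
    also have "\<dots> = (\<Sum>j\<in>J. z j * (\<Sum>l'\<in>L. q j l' * b l'))"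
      unfolding sum_distrib_left sum_distrib_right by (subst sum.swap) (simp add: algebra_simps)
    also have "\<dots> = 0" using b by simp
    finally show "b l = 0" .
  qed
  from indep_cols_select_rows[OF fin(2,3) this] obtain C where
    C: "C \<subseteq> J" "card C = card L" "indep_cols C L q" by auto
  have finC: "finite C" using C(1) fin(2) finite_subset by blast
  have qC: "indep_cols L C (\<lambda>l j. q j l)"
    by (rule indep_cols_transpose) (use finC fin C in auto)
  have "indep_cols I C X"
    unfolding indep_cols_def
  proof (intro allI impI)
    fix a assume a: "\<forall>i\<in>I. (\<Sum>c\<in>C. X i c * a c) = 0"
    have "(\<Sum>l\<in>L. w i l * (\<Sum>c\<in>C. q c l * a c)) = 0" if "i \<in> I" for i
    proof -
      have "(\<Sum>l\<in>L. w i l * (\<Sum>c\<in>C. q c l * a c)) = (\<Sum>c\<in>C. (\<Sum>l\<in>L. w i l * q c l) * a c)"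
        unfolding sum_distrib_left sum_distrib_right by (subst sum.swap) (simp add: mult.assoc)
      also have "\<dots> = (\<Sum>c\<in>C. X i c * a c)"
        using that C(1) by (intro sum.cong) (auto simp: q)
      finally show ?thesis using a that by simp
    qed
    from indep_colsD[OF ind this] have "\<And>l. l \<in> L \<Longrightarrow> (\<Sum>c\<in>C. q c l * a c) = 0" .
    from indep_colsD[OF qC this] show "\<forall>c\<in>C. a c = 0" by blast
  qed
  with C show ?thesis by blast
qed

text \<open>Cramer's rule on a minor of order \<open>k\<close> that is nonzero at \<open>x\<close>
  yields a candidate \<open>a\<close> near \<open>x\<close> that solves the equations of the rows in
  \<open>R\<close>. The remaining equations follow because the image at each point has dimension
  exactly \<open>k\<close>, so its elements are determined by their coordinates in \<open>R\<close>.
  The bases \<open>w y\<close> are chosen pointwise and carry no regularity in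
  \<open>y\<close>.\<close>

lemma constant_rank_lift:
  fixes I :: "'i set" and J :: "'j set" and L :: "pt \<Rightarrow> 'l set"
  assumes M: "form_matrix N I d J d' M" and fin: "finite I" "finite J" and U: "zopen N U" and x: "x \<in> U"
    and L: "\<And>y. y \<in> U \<Longrightarrow> finite (L y) \<and> card (L y) = k"
    and ind: "\<And>y. y \<in> U \<Longrightarrow> indep_cols I (L y) (w y)"
    and sub: "\<And>y z. y \<in> U \<Longrightarrow> \<exists>p. \<forall>i\<in>I. (\<Sum>j\<in>J. peval (M i j) y * z j) = (\<Sum>l\<in>L y. w y i l * p l)"
    and sup: "\<And>y p. y \<in> U \<Longrightarrow> \<exists>z. \<forall>i\<in>I. (\<Sum>l\<in>L y. w y i l * p l) = (\<Sum>j\<in>J. peval (M i j) y * z j)"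
    and t: "t \<in> carrier (Sec (line_sum N I d) U)"
    and tM: "\<And>y. y \<in> U \<Longrightarrow> \<exists>z. \<forall>i\<in>I. t i y = (\<Sum>j\<in>J. peval (M i j) y * z j)"
  shows "\<exists>V a. zopen N V \<and> x \<in> V \<and> V \<subseteq> U \<and> a \<in> carrier (Sec (line_sum N J d') V) \<and>
    (\<forall>y\<in>V. \<forall>i. t i y = matrix_map I J M V a i y)"
proof -
  have Lx: "finite (L x)" "card (L x) = k" using L[OF x] by auto
  obtain C where C: "C \<subseteq> J" "card C = k" and IC: "indep_cols I C (\<lambda>i j. peval (M i j) x)"
    using select_columns[where X = "\<lambda>i j. peval (M i j) x", OF fin Lx(1) ind[OF x] sub[OF x] sup[OF x]] Lx by auto
  have finC: "finite C" using C(1) fin(2) finite_subset by blast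
  from indep_cols_select_rows[OF fin(1) finC IC] obtain R where
    R: "R \<subseteq> I" "card R = k" "indep_cols R C (\<lambda>i j. peval (M i j) x)" using C by auto
  have finR: "finite R" using R(1) fin(1) finite_subset by blast
  obtain \<rho> where \<rho>: "bij_betw \<rho> {..<k} R" using ex_enumeration[OF finR] R by auto
  obtain \<kappa> where \<kappa>: "bij_betw \<kappa> {..<k} C" using ex_enumeration[OF finC] C by auto
  have \<rho>I: "\<rho> i \<in> I" "\<rho> i \<in> R" if "i < k" for i using bij_betw_apply[OF \<rho>, of i] R that by auto
  have \<kappa>J: "\<kappa> i \<in> J" "\<kappa> i \<in> C" if "i < k" for i using bij_betw_apply[OF \<kappa>, of i] C that by auto
  define \<delta> where "\<delta> = minor k \<rho> \<kappa> M"
  have \<delta>_form: "is_form N ((\<Sum>i<k. d (\<rho> i)) - (\<Sum>j<k. d' (\<kappa> j))) \<delta>"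
    unfolding \<delta>_def minor_def
    by (rule is_form_det) (use M \<rho>I \<kappa>J in \<open>auto simp: form_matrix_def\<close>)
  have \<delta>_eval: "peval \<delta> y = minor k \<rho> \<kappa> (\<lambda>i j. peval (M i j) y)" for y
    unfolding \<delta>_def by (rule peval_hom.hom_minor)
  have \<delta>x: "peval \<delta> x \<noteq> 0" unfolding \<delta>_eval minor_nonzero_iff[OF \<rho> \<kappa>] by (rule R(3))
  define V where "V = {y \<in> U. peval \<delta> y \<noteq> 0}"
  have V: "zopen N V" "x \<in> V" "V \<subseteq> U"
    using zopen_nonzero[OF U \<delta>_form] x \<delta>x by (auto simp: V_def)
  define num where "num j y = minor k \<rho> \<kappa> (\<lambda>i c. if c = j then t i y else peval (M i c) y)" for j y
  define a where "a j y = (if j \<in> C \<and> y \<in> V then num j y / peval \<delta> y else 0)" for j y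
  have reg: "regular_at N (d' j) y (a j)" if "j \<in> C" "y \<in> V" for j y
  proof -
    have y: "y \<in> cone_pts N" "y \<in> U" "peval \<delta> y \<noteq> 0" using that V zopen_subset V_def by auto
    obtain l where l: "l < k" "j = \<kappa> l" using bij_betw_imp_surj_on[OF \<kappa>] \<open>j \<in> C\<close> by blast
    have \<kappa>l: "\<kappa> c = j \<longleftrightarrow> c = l" if "c < k" for c
      using \<kappa> l that by (auto simp: bij_betw_def inj_on_def)
    \<comment> \<open>Column \<open>l\<close> is replaced by the section \<open>t\<close>, whose
      components have degree \<open>d i\<close>; so that column counts with degree 0 instead of
      \<open>d' j\<close>.\<close>
    have num: "regular_at N ((\<Sum>i<k. d (\<rho> i)) - (\<Sum>c<k. if c = l then 0 else d' (\<kappa> c))) y (num j)"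
      unfolding num_def
    proof (intro regular_at_minor y)
      fix i c assume ic: "i < k" "c < k"
      show "regular_at N (d (\<rho> i) - (if c = l then 0 else d' (\<kappa> c))) y
          (\<lambda>y. if \<kappa> c = j then t (\<rho> i) y else peval (M (\<rho> i) (\<kappa> c)) y)"
        using t y M \<rho>I[OF ic(1)] \<kappa>J[OF ic(2)]
        by (auto simp: \<kappa>l[OF ic(2)] line_sum_carrier_iff[OF U] form_matrix_def intro!: regular_at_form)
    qed
    have s: "(\<Sum>c<k. d' (\<kappa> c)) = d' j + (\<Sum>c<k. if c = l then 0 else d' (\<kappa> c))"
    proof -
      have "(\<Sum>c\<in>{..<k} - {l}. if c = l then 0 else d' (\<kappa> c)) = (\<Sum>c\<in>{..<k} - {l}. d' (\<kappa> c))"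
        by (intro sum.cong) auto
      then show ?thesis
        using l sum.remove[of "{..<k}" l "\<lambda>c. d' (\<kappa> c)"]
          sum.remove[of "{..<k}" l "\<lambda>c. if c = l then 0 else d' (\<kappa> c)"] by simp
    qed
    have "regular_at N (d' j) y (\<lambda>y. num j y * (1 / peval \<delta> y))"
      by (rule regular_at_mult[OF num regular_at_inverse_form[OF \<delta>_form y(1,3)]]) (simp add: s)
    then show ?thesis
      by (rule regular_at_cong[OF _ V(1) that(2)]) (use that in \<open>simp add: a_def\<close>)
  qed
  have "a \<in> carrier (Sec (line_sum N J d') V)"
    unfolding line_sum_carrier_iff[OF V(1)]
  proof (intro conjI allI impI ballI)
    fix j y assume "j \<in> J" "y \<in> V"
    then show "regular_at N (d' j) y (a j)"
      using reg[of j y] regular_at_0[of y N "d' j"] V(1) zopen_subset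
      by (cases "j \<in> C") (auto simp: a_def[abs_def])
  qed (use C V in \<open>auto simp: a_def\<close>)
  moreover have "t i y = matrix_map I J M V a i y" if y: "y \<in> V" for i y
  proof (cases "i \<in> I")
    case i: True
    have yU: "y \<in> U" "peval \<delta> y \<noteq> 0" using y by (auto simp: V_def)
    let ?M = "\<lambda>i j. peval (M i j) y"
    have inv: "indep_cols R C ?M" using yU(2) unfolding \<delta>_eval minor_nonzero_iff[OF \<rho> \<kappa>] .
    have card: "card R = card C" using R C by simp
    have extend: "(\<Sum>j\<in>J. ?M i j * (if j \<in> C then b j else 0)) = (\<Sum>c\<in>C. ?M i c * b c)" for b i
      using C(1) fin(2) by (intro sum.mono_neutral_cong_right) auto
    \<comment> \<open>The block of \<open>M\<close> on \<open>R\<close> and \<open>C\<close> is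
      invertible and its values lie in the span of \<open>w y\<close>, so the rows \<open>R\<close>
      of \<open>w y\<close> are onto, hence independent.\<close>
    have wR: "indep_cols R (L y) (w y)"
    proof (rule square_surj_indep)
      fix b
      obtain z where z: "\<forall>i\<in>R. (\<Sum>c\<in>C. ?M i c * z c) = b i"
        using square_solve[OF finR finC card inv] by blast
      obtain p where "\<forall>i\<in>I. (\<Sum>j\<in>J. ?M i j * (if j \<in> C then z j else 0)) = (\<Sum>l\<in>L y. w y i l * p l)"
        using sub[OF yU(1), of "\<lambda>j. if j \<in> C then z j else 0"] by blast
      with z extend R(1) show "\<exists>a. \<forall>i\<in>R. (\<Sum>c\<in>L y. w y i c * a c) = b i"
        by (intro exI[of _ p]) (auto simp: subset_iff)
    qed (use finR L[OF yU(1)] R in auto)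
    obtain b where b: "\<And>i. i \<in> R \<Longrightarrow> (\<Sum>c\<in>C. ?M i c * b c) = t i y"
      using square_solve[OF finR finC card inv, of "\<lambda>i. t i y"] by blast
    have ab: "a c y = b c" if "c \<in> C" for c
    proof -
      obtain l where l: "l < k" "c = \<kappa> l" using bij_betw_imp_surj_on[OF \<kappa>] \<open>c \<in> C\<close> by blast
      show ?thesis
        using cramer[OF \<rho> \<kappa> _ b l(1)] yU(2) y that l unfolding \<delta>_eval a_def num_def by simp
    qed
    obtain z where z: "\<forall>i\<in>I. t i y = (\<Sum>j\<in>J. ?M i j * z j)" using tM[OF yU(1)] by blast
    \<comment> \<open>Both \<open>t\<close> and the value at the solution \<open>b\<close> lie in
      the image, so their difference has coordinates \<open>p\<close>; it vanishes on
      \<open>R\<close>, and \<open>wR\<close> gives \<open>p = 0\<close>.\<close>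
    obtain p where p: "\<forall>i\<in>I. (\<Sum>j\<in>J. ?M i j * (z j - (if j \<in> C then b j else 0))) = (\<Sum>l\<in>L y. w y i l * p l)"
      using sub[OF yU(1), of "\<lambda>j. z j - (if j \<in> C then b j else 0)"] by blast
    have diff: "(\<Sum>l\<in>L y. w y i l * p l) = t i y - (\<Sum>c\<in>C. ?M i c * b c)" if "i \<in> I" for i
    proof -
      have "(\<Sum>l\<in>L y. w y i l * p l) = (\<Sum>j\<in>J. ?M i j * z j) - (\<Sum>j\<in>J. ?M i j * (if j \<in> C then b j else 0))"
        using p that by (simp add: right_diff_distrib sum_subtractf)
      then show ?thesis using z that by (simp add: extend)
    qed
    have "\<forall>l\<in>L y. p l = 0"
      using indep_colsD[OF wR, of p] diff b R(1) by (auto simp: subset_iff)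
    with diff[OF i] have "t i y = (\<Sum>c\<in>C. ?M i c * b c)" by simp
    also have "\<dots> = (\<Sum>j\<in>J. ?M i j * (if j \<in> C then b j else 0))" by (simp add: extend)
    also have "\<dots> = (\<Sum>j\<in>J. ?M i j * a j y)"
      using ab by (intro sum.cong) (auto simp: a_def)
    finally show ?thesis using i by (simp add: matrix_map_def)
  next
    case False
    then show ?thesis using t by (auto simp: matrix_map_def line_sum_carrier_iff[OF U])
  qed
  ultimately show ?thesis using V by blast
qed

subsection \<open>Cokernels of matrices of forms\<close>

lemma line_sum_restrict_Int1:
  assumes "s \<in> carrier (Sec (line_sum N I d) U)" "zopen N U" "zopen N V"
  shows "(\<lambda>i. fun_restrict (U \<inter> V) (s i)) \<in> carrier (Sec (line_sum N I d) (U \<inter> V))"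
  by (rule line_sum_restrict[OF assms(1,2) zopen_Int[OF assms(2,3)]]) simp

lemma line_sum_restrict_Int2:
  assumes "s \<in> carrier (Sec (line_sum N I d) U)" "zopen N U" "zopen N V"
  shows "(\<lambda>i. fun_restrict (V \<inter> U) (s i)) \<in> carrier (Sec (line_sum N I d) (V \<inter> U))"
  using line_sum_restrict_Int1[OF assms] by (simp add: Int_commute)

locale matrix_coker =
  fixes N :: nat and I :: "'i set" and dI :: "'i \<Rightarrow> int" and J :: "'j set" and dJ :: "'j \<Rightarrow> int"
    and M :: "'j \<Rightarrow> 'i \<Rightarrow> cpoly"
  assumes M: "form_matrix N J dJ I dI M"
begin

abbreviation "SA \<equiv> line_sum N I dI"
abbreviation "SB \<equiv> line_sum N J dJ"
abbreviation "\<phi> \<equiv> matrix_map J I M"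
abbreviation "Q \<equiv> shf_coker N SA SB \<phi>"
abbreviation "germ \<equiv> coker_germ N SA SB \<phi>"

text \<open>\<open>csim x b b'\<close> means that \<open>b\<close> and \<open>b'\<close> have the same germ at \<open>x\<close> in the cokernel.  It does not
  refer to the domains of the sections.\<close>

definition csim :: "pt \<Rightarrow> ('j \<Rightarrow> pt \<Rightarrow> complex) \<Rightarrow> ('j \<Rightarrow> pt \<Rightarrow> complex) \<Rightarrow> bool" where
  "csim x b b' \<longleftrightarrow> (\<exists>X a. zopen N X \<and> x \<in> X \<and> a \<in> carrier (Sec SA X) \<and>
     (\<forall>y\<in>X. \<forall>j. b j y = b' j y + \<phi> X a j y))"

lemma csimI:
  "zopen N X \<Longrightarrow> x \<in> X \<Longrightarrow> a \<in> carrier (Sec SA X) \<Longrightarrow>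
    (\<And>y j. y \<in> X \<Longrightarrow> b j y = b' j y + \<phi> X a j y) \<Longrightarrow> csim x b b'"
  unfolding csim_def by blast

lemma csimE:
  assumes "csim x b b'" "zopen N V" "x \<in> V"
  obtains X a where "zopen N X" "x \<in> X" "X \<subseteq> V" "a \<in> carrier (Sec SA X)"
    "\<And>y j. y \<in> X \<Longrightarrow> b j y = b' j y + \<phi> X a j y"
proof -
  obtain X a where X: "zopen N X" "x \<in> X" "a \<in> carrier (Sec SA X)"
    "\<And>y j. y \<in> X \<Longrightarrow> b j y = b' j y + \<phi> X a j y"
    using assms(1) unfolding csim_def by blast
  let ?a = "\<lambda>i. fun_restrict (X \<inter> V) (a i)"
  show ?thesis
  proof (rule that[of "X \<inter> V" ?a])
    show "?a \<in> carrier (Sec SA (X \<inter> V))"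
      by (rule line_sum_restrict) (use X assms zopen_Int in auto)
    show "b j y = b' j y + \<phi> (X \<inter> V) ?a j y" if "y \<in> X \<inter> V" for y j
      using X(4)[of y j] that by (simp add: matrix_map_restrict fun_restrict_def matrix_map_def)
  qed (use X assms zopen_Int in auto)
qed

lemma csim_cong:
  assumes "zopen N V" "x \<in> V" "\<And>y j. y \<in> V \<Longrightarrow> b j y = b' j y"
  shows "csim x b b'"
  by (rule csimI[OF assms(1,2) line_sum_closed_zero]) (use assms in \<open>auto simp: matrix_map_zero\<close>)

lemma csim_refl: "x \<in> cone_pts N \<Longrightarrow> csim x b b"
  by (rule csim_cong[OF zopen_cone]) auto

lemma csim_sym:
  assumes "csim x b b'" "x \<in> cone_pts N"
  shows "csim x b' b"
proof -
  from assms zopen_cone obtain X a where X: "zopen N X" "x \<in> X" "a \<in> carrier (Sec SA X)"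
    "\<And>y j. y \<in> X \<Longrightarrow> b j y = b' j y + \<phi> X a j y"
    by (metis csimE)
  show ?thesis
  proof (rule csimI[OF X(1,2) line_sum_closed_uminus[OF X(1,3)]])
    fix y j assume y: "y \<in> X"
    have "\<phi> X (\<lambda>i x. - a i x) j y = - \<phi> X a j y"
      by (simp add: matrix_map_def sum_negf)
    then show "b' j y = b j y + \<phi> X (\<lambda>i x. - a i x) j y"
      using X(4)[OF y, of j] by simp
  qed
qed

lemma csim_add:
  assumes "csim x b b'" "csim x c c'" "x \<in> cone_pts N"
  shows "csim x (\<lambda>j y. b j y + c j y) (\<lambda>j y. b' j y + c' j y)"
proof -
  obtain X a where X: "zopen N X" "x \<in> X" "a \<in> carrier (Sec SA X)"
    "\<And>y j. y \<in> X \<Longrightarrow> b j y = b' j y + \<phi> X a j y"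
    using csimE[OF assms(1) zopen_cone assms(3)] by metis
  obtain Y a' where Y: "zopen N Y" "x \<in> Y" "Y \<subseteq> X" "a' \<in> carrier (Sec SA Y)"
    "\<And>y j. y \<in> Y \<Longrightarrow> c j y = c' j y + \<phi> Y a' j y"
    using csimE[OF assms(2) X(1,2)] by metis
  let ?a = "\<lambda>i. fun_restrict Y (a i)"
  have "?a \<in> carrier (Sec SA Y)" by (rule line_sum_restrict) (use X Y in auto)
  then show ?thesis
  proof (rule csimI[OF Y(1,2) line_sum_closed_add[OF Y(1) _ Y(4)]])
    fix y j assume y: "y \<in> Y"
    with Y(3) have "b j y = b' j y + \<phi> X a j y" by (intro X(4)) auto
    with Y(5)[OF y, of j] y
    show "b j y + c j y = b' j y + c' j y + \<phi> Y (\<lambda>i x. fun_restrict Y (a i) x + a' i x) j y"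
      by (simp add: fun_restrict_def matrix_map_def distrib_left sum.distrib)
  qed
qed

lemma csim_trans:
  assumes "csim x b b'" "csim x b' b''" "x \<in> cone_pts N"
  shows "csim x b b''"
proof -
  \<comment> \<open>Adding the two relations puts \<open>b'\<close> on both sides, where it
    cancels.\<close>
  have "csim x (\<lambda>j y. b j y + b' j y) (\<lambda>j y. b' j y + b'' j y)"
    by (rule csim_add[OF assms])
  then obtain X a where X: "zopen N X" "x \<in> X" "a \<in> carrier (Sec SA X)"
    "\<And>y j. y \<in> X \<Longrightarrow> b j y + b' j y = b' j y + b'' j y + \<phi> X a j y"
    unfolding csim_def by blast
  have "b j y = b'' j y + \<phi> X a j y" if "y \<in> X" for y j
    using X(4)[OF that, of j] by simp
  then show ?thesis by (rule csimI[OF X(1-3)])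
qed

lemma csim_smult:
  assumes "csim x b b'" "zopen N U" "x \<in> U" "r \<in> line_sections N 0 U"
  shows "csim x (\<lambda>j y. r y * b j y) (\<lambda>j y. r y * b' j y)"
proof -
  obtain X a where X: "zopen N X" "x \<in> X" "X \<subseteq> U" "a \<in> carrier (Sec SA X)"
    "\<And>y j. y \<in> X \<Longrightarrow> b j y = b' j y + \<phi> X a j y"
    using csimE[OF assms(1-3)] by metis
  have r: "fun_restrict X r \<in> line_sections N 0 X"
    using line_sections_restrict assms X by blast
  show ?thesis
  proof (rule csimI[OF X(1,2) line_sum_closed_smult[OF X(1) r X(4)]])
    fix y j assume y: "y \<in> X"
    have "\<phi> X (\<lambda>i x. fun_restrict X r x * a i x) j y = r y * \<phi> X a j y"
      using y by (simp add: matrix_map_smult fun_restrict_def)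
    then show "r y * b j y = r y * b' j y + \<phi> X (\<lambda>i x. fun_restrict X r x * a i x) j y"
      using X(5)[OF y, of j] by (simp add: distrib_left)
  qed
qed

text \<open>Sections vanish outside their domain, so the equality of restrictions demanded by
  \<open>coker_germ\<close>, an equality of total functions, amounts to equality on
  \<open>X\<close>.\<close>

lemma mem_germ_iff:
  assumes V: "zopen N V" "x \<in> V" and b: "b \<in> carrier (Sec SB V)"
  shows "(V', b') \<in> germ x V b \<longleftrightarrow> zopen N V' \<and> x \<in> V' \<and> b' \<in> carrier (Sec SB V') \<and> csim x b b'"
proof
  assume "(V', b') \<in> germ x V b"
  then obtain X a where V': "zopen N V'" "x \<in> V'" "b' \<in> carrier (Sec SB V')"
    and X: "zopen N X" "x \<in> X" "X \<subseteq> V \<inter> V'" "a \<in> carrier (Sec SA X)"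
    and eq: "(\<lambda>j. fun_restrict X (b j)) = (\<lambda>j y. fun_restrict X (b' j) y + \<phi> X a j y)"
    unfolding coker_germ_def by auto
  have "b j y = b' j y + \<phi> X a j y" if "y \<in> X" for y j
    using fun_cong[OF fun_cong[OF eq, of j], of y] that by (simp add: fun_restrict_def)
  then have "csim x b b'" by (rule csimI[OF X(1,2,4)])
  with V' show "zopen N V' \<and> x \<in> V' \<and> b' \<in> carrier (Sec SB V') \<and> csim x b b'" by blast
next
  assume R: "zopen N V' \<and> x \<in> V' \<and> b' \<in> carrier (Sec SB V') \<and> csim x b b'"
  obtain X a where X: "zopen N X" "x \<in> X" "X \<subseteq> V \<inter> V'" "a \<in> carrier (Sec SA X)"
    "\<And>y j. y \<in> X \<Longrightarrow> b j y = b' j y + \<phi> X a j y"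
    using csimE[of x b b' "V \<inter> V'"] R V zopen_Int by (metis IntI)
  have "a i y = 0" if "y \<notin> X" for i y
    using X(4) that unfolding line_sum_carrier_iff[OF X(1)] by blast
  then have "(\<lambda>j. fun_restrict X (b j)) = (\<lambda>j y. fun_restrict X (b' j) y + \<phi> X a j y)"
    using X(5) by (auto simp: fun_eq_iff fun_restrict_def matrix_map_def)
  with X R show "(V', b') \<in> germ x V b"
    unfolding coker_germ_def by auto
qed

lemma self_mem_germ:
  assumes "zopen N V" "x \<in> V" "b \<in> carrier (Sec SB V)"
  shows "(V, b) \<in> germ x V b"
  using assms zopen_subset by (auto simp: mem_germ_iff intro!: csim_refl)

lemma germ_eq_iff:
  assumes V: "zopen N V" "x \<in> V" "b \<in> carrier (Sec SB V)"
    and V': "zopen N V'" "x \<in> V'" "b' \<in> carrier (Sec SB V')"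
  shows "germ x V b = germ x V' b' \<longleftrightarrow> csim x b b'"
proof
  assume eq: "germ x V b = germ x V' b'"
  have "(V', b') \<in> germ x V b" unfolding eq by (rule self_mem_germ[OF V'])
  then show "csim x b b'" by (simp add: mem_germ_iff[OF V])
next
  assume s: "csim x b b'"
  have x: "x \<in> cone_pts N" using V zopen_subset by blast
  have "csim x b c \<longleftrightarrow> csim x b' c" for c
    using s csim_sym csim_trans x by blast
  then show "germ x V b = germ x V' b'"
    by (auto simp: mem_germ_iff[OF V] mem_germ_iff[OF V'])
qed

lemma Q_carrier_iff:
  "t \<in> carrier (Sec Q U) \<longleftrightarrow> (\<forall>x. x \<notin> U \<longrightarrow> t x = {}) \<and> (\<forall>x\<in>U. \<exists>V b. zopen N V \<and> x \<in> V \<and> V \<subseteq> U \<and>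
     b \<in> carrier (Sec SB V) \<and> (\<forall>y\<in>V. t y = germ y V b))"
  by (simp add: shf_coker_def Bex_def)

lemma Q_Res [simp]: "Res Q U V t = (\<lambda>x. if x \<in> V then t x else {})"
  by (simp add: shf_coker_def)

lemma Q_zero: "\<zero>\<^bsub>Sec Q U\<^esub> = coker_proj N SA SB \<phi> U (\<lambda>j x. 0)"
  by (simp add: shf_coker_def)

lemma Q_repE:
  assumes "t \<in> carrier (Sec Q U)" "x \<in> U"
  obtains V b where "zopen N V" "x \<in> V" "V \<subseteq> U" "b \<in> carrier (Sec SB V)" "\<forall>y\<in>V. t y = germ y V b"
proof -
  from assms(1) have "\<forall>x\<in>U. \<exists>V b. zopen N V \<and> x \<in> V \<and> V \<subseteq> U \<and>
      b \<in> carrier (Sec SB V) \<and> (\<forall>y\<in>V. t y = germ y V b)"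
    unfolding Q_carrier_iff by (rule conjunct2)
  from bspec[OF this assms(2)] show ?thesis
    by (elim exE conjE) (rule that)
qed

lemma Q_repE_at:
  assumes "t \<in> carrier (Sec Q U)" "x \<in> U"
  obtains V b where "zopen N V" "x \<in> V" "b \<in> carrier (Sec SB V)" "t x = germ x V b"
  by (rule Q_repE[OF assms]) (auto intro: that)

lemma Q_memD:
  assumes "t \<in> carrier (Sec Q U)" "x \<in> U" "(V, b) \<in> t x"
  shows "zopen N V" "x \<in> V" "b \<in> carrier (Sec SB V)" "t x = germ x V b"
proof -
  obtain V' b' where 1: "zopen N V'" "x \<in> V'" "b' \<in> carrier (Sec SB V')" "t x = germ x V' b'"
    by (rule Q_repE_at[OF assms(1,2)])
  have "(V, b) \<in> germ x V' b'" using assms(3) 1(4) by simp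
  then have 2: "zopen N V \<and> x \<in> V \<and> b \<in> carrier (Sec SB V) \<and> csim x b' b"
    unfolding mem_germ_iff[OF 1(1-3)] .
  then show 3: "zopen N V" "x \<in> V" "b \<in> carrier (Sec SB V)" by auto
  from 2 have "germ x V' b' = germ x V b" unfolding germ_eq_iff[OF 1(1-3) 3] by blast
  then show "t x = germ x V b" using 1(4) by simp
qed

lemma proj_closed:
  assumes "zopen N U" "b \<in> carrier (Sec SB U)"
  shows "coker_proj N SA SB \<phi> U b \<in> carrier (Sec Q U)"
  unfolding Q_carrier_iff
proof (intro conjI allI impI ballI)
  fix x assume "x \<in> U"
  with assms show "\<exists>V c. zopen N V \<and> x \<in> V \<and> V \<subseteq> U \<and> c \<in> carrier (Sec SB V) \<and>
      (\<forall>y\<in>V. coker_proj N SA SB \<phi> U b y = germ y V c)"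
    by (intro exI[of _ U] exI[of _ b]) (simp add: coker_proj_def)
qed (simp add: coker_proj_def)

lemma germ_restrict:
  assumes V: "zopen N V" "b \<in> carrier (Sec SB V)" and V': "zopen N V'" "V' \<subseteq> V" "x \<in> V'"
  shows "germ x V' (\<lambda>j. fun_restrict V' (b j)) = germ x V b"
proof -
  have "csim x (\<lambda>j. fun_restrict V' (b j)) b"
    by (rule csim_cong[OF V'(1,3)]) (simp add: fun_restrict_def)
  from iffD2[OF germ_eq_iff[OF V'(1,3) line_sum_restrict[OF V(2,1) V'(1,2)] V(1) subsetD[OF V'(2,3)] V(2)] this]
  show ?thesis .
qed

text \<open>Addition in the cokernel is a union over all representatives; they all yield the same
  germ, so the union is the germ computed from any one pair.\<close>

lemma Q_add_germ:
  assumes 1: "zopen N V" "x \<in> V" "b \<in> carrier (Sec SB V)" "s x = germ x V b"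
    and 2: "zopen N V'" "x \<in> V'" "b' \<in> carrier (Sec SB V')" "t x = germ x V' b'"
  shows "(s \<oplus>\<^bsub>Sec Q U\<^esub> t) x =
    germ x (V \<inter> V') (\<lambda>j y. fun_restrict (V \<inter> V') (b j) y + fun_restrict (V \<inter> V') (b' j) y)" (is "_ = ?g V b V' b'")
proof -
  have x: "x \<in> cone_pts N" using 1 zopen_subset by blast
  have closed: "(\<lambda>j y. fun_restrict (V \<inter> V') (b j) y + fun_restrict (V \<inter> V') (b' j) y) \<in> carrier (Sec SB (V \<inter> V'))"
    if "zopen N V" "zopen N V'" "b \<in> carrier (Sec SB V)" "b' \<in> carrier (Sec SB V')" for V b V' b'
    using that by (intro line_sum_closed_add line_sum_restrict_Int1 line_sum_restrict_Int2 zopen_Int)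
  have "?g W c W' c' = ?g V b V' b'" if "(W, c) \<in> s x" "(W', c') \<in> t x" for W c W' c'
  proof -
    have W: "zopen N W" "x \<in> W" "c \<in> carrier (Sec SB W)" "csim x b c"
      using that(1) unfolding 1(4) mem_germ_iff[OF 1(1-3)] by auto
    have W': "zopen N W'" "x \<in> W'" "c' \<in> carrier (Sec SB W')" "csim x b' c'"
      using that(2) unfolding 2(4) mem_germ_iff[OF 2(1-3)] by auto
    have WV: "zopen N (W \<inter> W')" "x \<in> W \<inter> W'" "zopen N (V \<inter> V')" "x \<in> V \<inter> V'"
      using W W' 1 2 by (auto intro: zopen_Int)
    have r: "csim x (\<lambda>j. fun_restrict X (e j)) e" if "zopen N X" "x \<in> X" for X e
      by (rule csim_cong[OF that]) (simp add: fun_restrict_def)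
    have "csim x (\<lambda>j. fun_restrict (W \<inter> W') (c j)) (\<lambda>j. fun_restrict (V \<inter> V') (b j))"
      by (rule csim_trans[OF csim_trans[OF r[OF WV(1,2)] csim_sym[OF W(4) x] x] csim_sym[OF r[OF WV(3,4)] x] x])
    moreover have "csim x (\<lambda>j. fun_restrict (W \<inter> W') (c' j)) (\<lambda>j. fun_restrict (V \<inter> V') (b' j))"
      by (rule csim_trans[OF csim_trans[OF r[OF WV(1,2)] csim_sym[OF W'(4) x] x] csim_sym[OF r[OF WV(3,4)] x] x])
    ultimately show ?thesis
      unfolding germ_eq_iff[OF WV(1,2) closed[OF W(1) W'(1) W(3) W'(3)] WV(3,4) closed[OF 1(1) 2(1) 1(3) 2(3)]]
      by (rule csim_add[OF _ _ x])
  qed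
  moreover have "(V, b) \<in> s x" "(V', b') \<in> t x"
    unfolding 1(4) 2(4) by (rule self_mem_germ[OF 1(1-3)], rule self_mem_germ[OF 2(1-3)])
  ultimately have "(\<Union>(W, c) \<in> s x. \<Union>(W', c') \<in> t x. ?g W c W' c') = ?g V b V' b'"
    by blast
  then show ?thesis by (simp add: shf_coker_def)
qed

lemma Q_smult_germ:
  assumes 1: "zopen N V" "x \<in> V" "b \<in> carrier (Sec SB V)" "t x = germ x V b"
    and U: "zopen N U" "x \<in> U" and r: "r \<in> line_sections N 0 U"
  shows "(r \<odot>\<^bsub>Sec Q U\<^esub> t) x =
    germ x (U \<inter> V) (\<lambda>j y. fun_restrict (U \<inter> V) r y * fun_restrict (U \<inter> V) (b j) y)" (is "_ = ?g V b")
proof -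
  have x: "x \<in> cone_pts N" using 1 zopen_subset by blast
  have closed: "(\<lambda>j y. fun_restrict (U \<inter> V) r y * fun_restrict (U \<inter> V) (b j) y) \<in> carrier (Sec SB (U \<inter> V))"
    if "zopen N V" "b \<in> carrier (Sec SB V)" for V b
    using that zopen_Int U line_sections_restrict[OF r U(1), of "U \<inter> V"]
    by (intro line_sum_closed_smult line_sum_restrict_Int2) auto
  have "?g W c = ?g V b" if "(W, c) \<in> t x" for W c
  proof -
    have W: "zopen N W" "x \<in> W" "c \<in> carrier (Sec SB W)" "csim x b c"
      using that unfolding 1(4) mem_germ_iff[OF 1(1-3)] by auto
    have WV: "zopen N (U \<inter> W)" "x \<in> U \<inter> W" "zopen N (U \<inter> V)" "x \<in> U \<inter> V"
      using W 1 U by (auto intro: zopen_Int)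
    have e: "csim x (\<lambda>j y. fun_restrict (U \<inter> X) r y * fun_restrict (U \<inter> X) (e j) y) (\<lambda>j y. r y * e j y)"
      if "zopen N X" "x \<in> X" for X e
      by (rule csim_cong[of "U \<inter> X"]) (use that U in \<open>auto simp: fun_restrict_def intro: zopen_Int\<close>)
    have "csim x (\<lambda>j y. r y * c j y) (\<lambda>j y. r y * b j y)"
      by (rule csim_smult[OF csim_sym[OF W(4) x] U r])
    then have "csim x (\<lambda>j y. fun_restrict (U \<inter> W) r y * fun_restrict (U \<inter> W) (c j) y)
        (\<lambda>j y. fun_restrict (U \<inter> V) r y * fun_restrict (U \<inter> V) (b j) y)"
      by (rule csim_trans[OF csim_trans[OF e[OF W(1,2)] _ x] csim_sym[OF e[OF 1(1,2)] x] x])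
    then show ?thesis
      unfolding germ_eq_iff[OF WV(1,2) closed[OF W(1,3)] WV(3,4) closed[OF 1(1,3)]] .
  qed
  moreover have "(V, b) \<in> t x" unfolding 1(4) by (rule self_mem_germ[OF 1(1-3)])
  ultimately have "(\<Union>(W, c) \<in> t x. ?g W c) = ?g V b" by blast
  then show ?thesis by (simp add: shf_coker_def)
qed

lemma Q_add_outside: "s x = {} \<Longrightarrow> (s \<oplus>\<^bsub>Sec Q U\<^esub> t) x = {}"
  and Q_smult_outside: "t x = {} \<Longrightarrow> (r \<odot>\<^bsub>Sec Q U\<^esub> t) x = {}"
  by (simp_all add: shf_coker_def)

lemma Q_add_rep:
  assumes s: "s \<in> carrier (Sec Q U)" and t: "t \<in> carrier (Sec Q U)" and x: "x \<in> U"
  obtains V b b' where "zopen N V" "x \<in> V" "V \<subseteq> U" "b \<in> carrier (Sec SB V)" "b' \<in> carrier (Sec SB V)"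
    "\<forall>y\<in>V. s y = germ y V b" "\<forall>y\<in>V. t y = germ y V b'"
    "\<forall>y\<in>V. (s \<oplus>\<^bsub>Sec Q U\<^esub> t) y = germ y V (\<lambda>j y. b j y + b' j y)"
proof -
  obtain V1 b1 where 1: "zopen N V1" "x \<in> V1" "V1 \<subseteq> U" "b1 \<in> carrier (Sec SB V1)" "\<forall>y\<in>V1. s y = germ y V1 b1"
    by (rule Q_repE[OF s x])
  obtain V2 b2 where 2: "zopen N V2" "x \<in> V2" "V2 \<subseteq> U" "b2 \<in> carrier (Sec SB V2)" "\<forall>y\<in>V2. t y = germ y V2 b2"
    by (rule Q_repE[OF t x])
  show ?thesis
  proof (rule that[of "V1 \<inter> V2" "\<lambda>j. fun_restrict (V1 \<inter> V2) (b1 j)" "\<lambda>j. fun_restrict (V1 \<inter> V2) (b2 j)"])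
    have W: "zopen N (V1 \<inter> V2)" using 1 2 by (auto intro: zopen_Int)
    show "\<forall>y\<in>V1 \<inter> V2. s y = germ y (V1 \<inter> V2) (\<lambda>j. fun_restrict (V1 \<inter> V2) (b1 j))"
      using 1(5) germ_restrict[OF 1(1,4) W] by auto
    show "\<forall>y\<in>V1 \<inter> V2. t y = germ y (V1 \<inter> V2) (\<lambda>j. fun_restrict (V1 \<inter> V2) (b2 j))"
      using 2(5) germ_restrict[OF 2(1,4) W] by auto
    show "\<forall>y\<in>V1 \<inter> V2. (s \<oplus>\<^bsub>Sec Q U\<^esub> t) y =
        germ y (V1 \<inter> V2) (\<lambda>j y. fun_restrict (V1 \<inter> V2) (b1 j) y + fun_restrict (V1 \<inter> V2) (b2 j) y)"
      using 1 2 by (intro ballI Q_add_germ) auto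
    show "(\<lambda>j. fun_restrict (V1 \<inter> V2) (b1 j)) \<in> carrier (Sec SB (V1 \<inter> V2))"
      by (rule line_sum_restrict_Int1[OF 1(4,1) 2(1)])
    show "(\<lambda>j. fun_restrict (V1 \<inter> V2) (b2 j)) \<in> carrier (Sec SB (V1 \<inter> V2))"
      by (rule line_sum_restrict_Int2[OF 2(4,1) 1(1)])
  qed (use 1 2 zopen_Int in auto)
qed

lemma Q_smult_rep:
  assumes t: "t \<in> carrier (Sec Q U)" and x: "x \<in> U" and U: "zopen N U" and r: "r \<in> line_sections N 0 U"
  obtains V b where "zopen N V" "x \<in> V" "V \<subseteq> U" "b \<in> carrier (Sec SB V)" "\<forall>y\<in>V. t y = germ y V b"
    "fun_restrict V r \<in> line_sections N 0 V"
    "\<forall>y\<in>V. (r \<odot>\<^bsub>Sec Q U\<^esub> t) y = germ y V (\<lambda>j y. fun_restrict V r y * b j y)"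
proof -
  obtain V b where 1: "zopen N V" "x \<in> V" "V \<subseteq> U" "b \<in> carrier (Sec SB V)" "\<forall>y\<in>V. t y = germ y V b"
    by (rule Q_repE[OF t x])
  have UV: "U \<inter> V = V" using 1 by auto
  have bV: "fun_restrict V (b j) = b j" for j
    using 1(4) by (auto simp: fun_eq_iff fun_restrict_def line_sum_carrier_iff[OF 1(1)])
  show ?thesis
  proof (rule that[OF 1])
    show "\<forall>y\<in>V. (r \<odot>\<^bsub>Sec Q U\<^esub> t) y = germ y V (\<lambda>j y. fun_restrict V r y * b j y)"
    proof
      fix y assume y: "y \<in> V"
      show "(r \<odot>\<^bsub>Sec Q U\<^esub> t) y = germ y V (\<lambda>j y. fun_restrict V r y * b j y)"
        using Q_smult_germ[OF 1(1) y 1(4), of t U r] 1(3,5) y U r by (auto simp: UV bV)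
    qed
  next
    show "fun_restrict V r \<in> line_sections N 0 V"
      using line_sections_restrict 1 U r by blast
  qed
qed

lemma Q_add_closed:
  assumes "s \<in> carrier (Sec Q U)" "t \<in> carrier (Sec Q U)"
  shows "s \<oplus>\<^bsub>Sec Q U\<^esub> t \<in> carrier (Sec Q U)"
  unfolding Q_carrier_iff
proof (intro conjI allI impI ballI)
  fix x assume "x \<notin> U"
  with assms(1) show "(s \<oplus>\<^bsub>Sec Q U\<^esub> t) x = {}" by (intro Q_add_outside) (simp add: Q_carrier_iff)
next
  fix x assume "x \<in> U"
  then show "\<exists>V b. zopen N V \<and> x \<in> V \<and> V \<subseteq> U \<and>
     b \<in> carrier (Sec SB V) \<and> (\<forall>y\<in>V. (s \<oplus>\<^bsub>Sec Q U\<^esub> t) y = germ y V b)"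
    by (rule Q_add_rep[OF assms]) (blast intro: line_sum_closed_add)
qed

lemma Q_smult_closed:
  assumes "zopen N U" "r \<in> line_sections N 0 U" "t \<in> carrier (Sec Q U)"
  shows "r \<odot>\<^bsub>Sec Q U\<^esub> t \<in> carrier (Sec Q U)"
  unfolding Q_carrier_iff
proof (intro conjI allI impI ballI)
  fix x assume "x \<notin> U"
  with assms(3) show "(r \<odot>\<^bsub>Sec Q U\<^esub> t) x = {}" by (intro Q_smult_outside) (simp add: Q_carrier_iff)
next
  fix x assume "x \<in> U"
  then show "\<exists>V b. zopen N V \<and> x \<in> V \<and> V \<subseteq> U \<and>
     b \<in> carrier (Sec SB V) \<and> (\<forall>y\<in>V. (r \<odot>\<^bsub>Sec Q U\<^esub> t) y = germ y V b)"
    by (rule Q_smult_rep[OF assms(3) _ assms(1,2)]) (blast intro: line_sum_closed_smult)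
qed

lemma Q_res_closed:
  assumes "t \<in> carrier (Sec Q U)" "zopen N U" "zopen N V" "V \<subseteq> U"
  shows "Res Q U V t \<in> carrier (Sec Q V)"
  unfolding Q_carrier_iff
proof (intro conjI allI impI ballI)
  fix x assume x: "x \<in> V"
  obtain W b where W: "zopen N W" "x \<in> W" "W \<subseteq> U" "b \<in> carrier (Sec SB W)" "\<forall>y\<in>W. t y = germ y W b"
    by (rule Q_repE[OF assms(1) subsetD[OF assms(4) x]])
  show "\<exists>X b. zopen N X \<and> x \<in> X \<and> X \<subseteq> V \<and> b \<in> carrier (Sec SB X) \<and> (\<forall>y\<in>X. Res Q U V t y = germ y X b)"
  proof (intro exI conjI ballI)
    show "(\<lambda>j. fun_restrict (W \<inter> V) (b j)) \<in> carrier (Sec SB (W \<inter> V))"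
      by (rule line_sum_restrict) (use W assms zopen_Int in auto)
    show "Res Q U V t y = germ y (W \<inter> V) (\<lambda>j. fun_restrict (W \<inter> V) (b j))" if "y \<in> W \<inter> V" for y
      using W assms that zopen_Int by (subst germ_restrict[of W]) auto
  qed (use W assms x zopen_Int in auto)
qed simp

lemma Q_glue:
  assumes "\<And>x. x \<notin> U \<Longrightarrow> t x = {}"
    and "\<And>x. x \<in> U \<Longrightarrow> \<exists>V. zopen N V \<and> x \<in> V \<and> V \<subseteq> U \<and> Res Q U V t \<in> carrier (Sec Q V)"
  shows "t \<in> carrier (Sec Q U)"
  unfolding Q_carrier_iff
proof (intro conjI allI impI ballI)
  fix x assume "x \<in> U"
  then obtain V where V: "zopen N V" "x \<in> V" "V \<subseteq> U" "Res Q U V t \<in> carrier (Sec Q V)"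
    using assms(2) by blast
  obtain W b where "zopen N W" "x \<in> W" "W \<subseteq> V" "b \<in> carrier (Sec SB W)" "\<forall>y\<in>W. Res Q U V t y = germ y W b"
    by (rule Q_repE[OF V(4,2)])
  then show "\<exists>V b. zopen N V \<and> x \<in> V \<and> V \<subseteq> U \<and> b \<in> carrier (Sec SB V) \<and> (\<forall>y\<in>V. t y = germ y V b)"
    using V by (intro exI[of _ W] exI[of _ b]) (auto simp: subset_iff)
qed (use assms in simp)

end

section \<open>Maps induced on a cokernel and their kernels\<close>

locale matrix_complex = matrix_coker N I dI J dJ M
  for N :: nat and I :: "'i set" and dI :: "'i \<Rightarrow> int" and J :: "'j set" and dJ :: "'j \<Rightarrow> int"
    and M :: "'j \<Rightarrow> 'i \<Rightarrow> cpoly" +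
  fixes K :: "'k set" and dK :: "'k \<Rightarrow> int" and P :: "'k \<Rightarrow> 'j \<Rightarrow> cpoly"
  assumes P: "form_matrix N K dK J dJ P"
    and PM: "\<And>x k i. x \<in> cone_pts N \<Longrightarrow> k \<in> K \<Longrightarrow> i \<in> I \<Longrightarrow> (\<Sum>j\<in>J. peval (P k j) x * peval (M j i) x) = 0"
begin

abbreviation "SC \<equiv> line_sum N K dK"
abbreviation "\<psi> \<equiv> matrix_map K J P"
abbreviation "ind \<equiv> coker_induced SC \<psi>"
abbreviation "Ker \<equiv> shf_ker Q SC ind"

text \<open>Changing the representative adds an element of the image of \<open>M\<close>, which
  \<open>P\<close> kills by \<open>PM\<close>.\<close>

lemma csim_induced:
  assumes "csim x b b'" "x \<in> cone_pts N"
  shows "\<psi> V b k x = \<psi> V' b' k x"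
proof (cases "k \<in> K")
  case True
  obtain X a where X: "x \<in> X" "\<And>y j. y \<in> X \<Longrightarrow> b j y = b' j y + \<phi> X a j y"
    using csimE[OF assms(1) zopen_cone assms(2)] by metis
  have "(\<Sum>j\<in>J. peval (P k j) x * \<phi> X a j x) = (\<Sum>j\<in>J. \<Sum>i\<in>I. peval (P k j) x * (peval (M j i) x * a i x))"
    by (intro sum.cong) (auto simp: matrix_map_def sum_distrib_left)
  also have "\<dots> = (\<Sum>i\<in>I. (\<Sum>j\<in>J. peval (P k j) x * peval (M j i) x) * a i x)"
    by (subst sum.swap) (simp add: sum_distrib_right mult.assoc)
  also have "\<dots> = 0" using PM[OF assms(2) True] by simp
  finally show ?thesis using True X by (simp add: matrix_map_def distrib_left sum.distrib)
qed (simp add: matrix_map_def)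

text \<open>The section is built pointwise from arbitrary representatives, of which it is
  independent by \<open>csim_induced\<close>. It satisfies the defining condition of
  \<open>coker_induced\<close>, and every section that does so agrees with it pointwise, so the
  definite description denotes it.\<close>

lemma induced:
  assumes U: "zopen N U" and t: "t \<in> carrier (Sec Q U)"
  shows induced_closed: "ind U t \<in> carrier (Sec SC U)"
    and induced_value: "\<And>x V b k. x \<in> U \<Longrightarrow> (V, b) \<in> t x \<Longrightarrow> ind U t k x = \<psi> V b k x"
proof -
  define c0 where "c0 k x = (if x \<in> U then let p = SOME p. p \<in> t x in \<psi> (fst p) (snd p) k x else 0)" for k x
  have val: "c0 k x = \<psi> V b k x" if x: "x \<in> U" and Vb: "(V, b) \<in> t x" for x V b k
  proof -
    have xc: "x \<in> cone_pts N" using U x zopen_subset by blast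
    obtain V' b' where p: "(SOME p. p \<in> t x) = (V', b')" by force
    then have "(V', b') \<in> t x" using Vb by (metis someI)
    then have "csim x b b'"
      unfolding Q_memD(4)[OF t x Vb] mem_germ_iff[OF Q_memD(1-3)[OF t x Vb]] by blast
    from csim_induced[OF this xc, of V k V'] show ?thesis using x p by (simp add: c0_def)
  qed
  have c0: "c0 \<in> carrier (Sec SC U)"
    unfolding line_sum_carrier_iff[OF U]
  proof (intro conjI allI impI ballI)
    fix k x assume k: "k \<in> K" and x: "x \<in> U"
    obtain V b where V: "zopen N V" "x \<in> V" "V \<subseteq> U" "b \<in> carrier (Sec SB V)" "\<forall>y\<in>V. t y = germ y V b"
      by (rule Q_repE[OF t x])
    have "regular_at N (dK k) x (\<psi> V b k)"
      using matrix_map_closed[OF P V(1,4)] k V(2) by (auto simp: line_sum_carrier_iff[OF V(1)])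
    then show "regular_at N (dK k) x (c0 k)"
    proof (rule regular_at_cong[OF _ V(1,2)])
      fix y assume y: "y \<in> V"
      have "(V, b) \<in> t y"
        unfolding bspec[OF V(5) y] by (rule self_mem_germ[OF V(1) y V(4)])
      from val[OF subsetD[OF V(3) y] this] show "\<psi> V b k y = c0 k y" by simp
    qed
  qed (auto simp: c0_def matrix_map_def Let_def)
  define S where "S c \<longleftrightarrow> c \<in> carrier (Sec SC U) \<and> (\<forall>x\<in>U. \<exists>(V, b)\<in>t x. V \<subseteq> U \<and> Res SC U V c = \<psi> V b)" for c
  have "S c0"
    unfolding S_def
  proof (intro conjI ballI c0)
    fix x assume x: "x \<in> U"
    obtain V b where V: "zopen N V" "x \<in> V" "V \<subseteq> U" "b \<in> carrier (Sec SB V)" "\<forall>y\<in>V. t y = germ y V b"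
      by (rule Q_repE[OF t x])
    have mem: "(V, b) \<in> t y" if y: "y \<in> V" for y
      unfolding bspec[OF V(5) y] by (rule self_mem_germ[OF V(1) y V(4)])
    have "c0 k y = \<psi> V b k y" if "y \<in> V" for k y
      using val[OF subsetD[OF V(3) that] mem[OF that]] .
    moreover have "b j y = 0" if "y \<notin> V" for j y
      using V(4) that by (auto simp: line_sum_carrier_iff[OF V(1)])
    ultimately have "Res SC U V c0 = \<psi> V b"
      by (auto simp: fun_eq_iff fun_restrict_def matrix_map_def)
    moreover note mem[OF V(2)]
    ultimately show "\<exists>(V, b)\<in>t x. V \<subseteq> U \<and> Res SC U V c0 = \<psi> V b" using V by blast
  qed
  moreover have "c = c0" if c: "S c" for c
  proof (intro ext)
    fix k x show "c k x = c0 k x"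
    proof (cases "x \<in> U")
      case True
      then obtain V b where Vb: "(V, b) \<in> t x" and eq: "Res SC U V c = \<psi> V b"
        using c unfolding S_def by blast
      have "x \<in> V" using Q_memD[OF t True Vb] by blast
      with fun_cong[OF fun_cong[OF eq, of k], of x] val[OF True Vb, of k] show ?thesis
        by (simp add: fun_restrict_def)
    next
      case False
      then show ?thesis using c c0 by (auto simp: S_def line_sum_carrier_iff[OF U])
    qed
  qed
  ultimately have "ind U t = c0"
    unfolding coker_induced_def S_def[symmetric] by (rule the_equality)
  with c0 val show "ind U t \<in> carrier (Sec SC U)"
    "\<And>x V b k. x \<in> U \<Longrightarrow> (V, b) \<in> t x \<Longrightarrow> ind U t k x = \<psi> V b k x" by auto
qed

text \<open>Replaces the definite description in \<open>coker_induced\<close> by a condition on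
  representatives.\<close>

lemma Ker_carrier_iff:
  assumes U: "zopen N U"
  shows "t \<in> carrier (Sec Ker U) \<longleftrightarrow> t \<in> carrier (Sec Q U) \<and> (\<forall>x\<in>U. \<forall>V b. (V, b) \<in> t x \<longrightarrow> (\<forall>k\<in>K. \<psi> V b k x = 0))"
proof -
  have "ind U t = (\<lambda>k x. 0) \<longleftrightarrow> (\<forall>x\<in>U. \<forall>V b. (V, b) \<in> t x \<longrightarrow> (\<forall>k\<in>K. \<psi> V b k x = 0))" if t: "t \<in> carrier (Sec Q U)"
  proof
    assume "ind U t = (\<lambda>k x. 0)"
    then show "\<forall>x\<in>U. \<forall>V b. (V, b) \<in> t x \<longrightarrow> (\<forall>k\<in>K. \<psi> V b k x = 0)" using induced_value[OF U t] by auto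
  next
    assume R: "\<forall>x\<in>U. \<forall>V b. (V, b) \<in> t x \<longrightarrow> (\<forall>k\<in>K. \<psi> V b k x = 0)"
    show "ind U t = (\<lambda>k x. 0)"
    proof (intro ext)
      fix k x show "ind U t k x = 0"
      proof (cases "k \<in> K \<and> x \<in> U")
        case True
        then have x: "x \<in> U" by simp
        obtain V b where V: "zopen N V" "x \<in> V" "b \<in> carrier (Sec SB V)" "t x = germ x V b"
          by (rule Q_repE_at[OF t x])
        have "(V, b) \<in> t x" unfolding V(4) by (rule self_mem_germ[OF V(1-3)])
        with R True induced_value[OF U t x] show ?thesis by auto
      next
        case False
        with induced_closed[OF U t] show ?thesis by (auto simp: line_sum_carrier_iff[OF U])
      qed
    qed
  qed
  then show ?thesis by (auto simp: shf_ker_def)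
qed

lemma Ker_add [simp]: "s \<oplus>\<^bsub>Sec Ker U\<^esub> t = s \<oplus>\<^bsub>Sec Q U\<^esub> t"
  and Ker_smult [simp]: "r \<odot>\<^bsub>Sec Ker U\<^esub> t = r \<odot>\<^bsub>Sec Q U\<^esub> t"
  and Ker_Res [simp]: "Res Ker U V t = Res Q U V t"
  by (auto simp: shf_ker_def)

lemma Ker_mem_iff:
  assumes "zopen N V" "x \<in> V" "b \<in> carrier (Sec SB V)" "t x = germ x V b"
  shows "(\<forall>V b. (V, b) \<in> t x \<longrightarrow> (\<forall>k\<in>K. \<psi> V b k x = 0)) \<longleftrightarrow> (\<forall>k\<in>K. \<psi> V b k x = 0)"
proof -
  have x: "x \<in> cone_pts N" using assms zopen_subset by blast
  have mem: "(V, b) \<in> t x" unfolding assms(4) by (rule self_mem_germ[OF assms(1-3)])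
  have eq: "\<psi> V' b' k x = \<psi> V b k x" if "(V', b') \<in> t x" for V' b' k
  proof -
    have "csim x b b'" using that unfolding assms(4) mem_germ_iff[OF assms(1-3)] by blast
    from csim_induced[OF this x, of V k V'] show ?thesis by simp
  qed
  show ?thesis
  proof (intro iffI allI impI)
    fix W c assume "\<forall>k\<in>K. \<psi> V b k x = 0" "(W, c) \<in> t x"
    then show "\<forall>k\<in>K. \<psi> W c k x = 0" using eq[of W c] by metis
  qed (use mem in blast)
qed

lemma Ker_add_closed:
  assumes U: "zopen N U" and s: "s \<in> carrier (Sec Ker U)" and t: "t \<in> carrier (Sec Ker U)"
  shows "s \<oplus>\<^bsub>Sec Ker U\<^esub> t \<in> carrier (Sec Ker U)"
  unfolding Ker_carrier_iff[OF U] Ker_add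
proof (intro conjI)
  have sQ: "s \<in> carrier (Sec Q U)" and tQ: "t \<in> carrier (Sec Q U)"
    using s t by (auto simp: Ker_carrier_iff[OF U])
  then show "s \<oplus>\<^bsub>Sec Q U\<^esub> t \<in> carrier (Sec Q U)" by (rule Q_add_closed)
  show "\<forall>x\<in>U. \<forall>V b. (V, b) \<in> (s \<oplus>\<^bsub>Sec Q U\<^esub> t) x \<longrightarrow> (\<forall>k\<in>K. \<psi> V b k x = 0)"
  proof
    fix x assume x: "x \<in> U"
    obtain V b b' where
      V: "zopen N V" "x \<in> V" "V \<subseteq> U" "b \<in> carrier (Sec SB V)" "b' \<in> carrier (Sec SB V)"
      and g: "\<forall>y\<in>V. s y = germ y V b" "\<forall>y\<in>V. t y = germ y V b'"
      "\<forall>y\<in>V. (s \<oplus>\<^bsub>Sec Q U\<^esub> t) y = germ y V (\<lambda>j y. b j y + b' j y)"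
      by (rule Q_add_rep[OF sQ tQ x])
    note g = g[THEN bspec, OF V(2)]
    have "\<forall>k\<in>K. \<psi> V b k x = 0" "\<forall>k\<in>K. \<psi> V b' k x = 0"
      using s t x Ker_mem_iff[where t = s, OF V(1,2,4) g(1)] Ker_mem_iff[where t = t, OF V(1,2,5) g(2)]
      unfolding Ker_carrier_iff[OF U] by blast+
    then show "\<forall>V b. (V, b) \<in> (s \<oplus>\<^bsub>Sec Q U\<^esub> t) x \<longrightarrow> (\<forall>k\<in>K. \<psi> V b k x = 0)"
      using Ker_mem_iff[where t = "s \<oplus>\<^bsub>Sec Q U\<^esub> t", OF V(1,2) line_sum_closed_add[OF V(1,4,5)] g(3)]
      by (simp add: matrix_map_add)
  qed
qed

lemma Ker_smult_closed:
  assumes U: "zopen N U" and r: "r \<in> line_sections N 0 U" and t: "t \<in> carrier (Sec Ker U)"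
  shows "r \<odot>\<^bsub>Sec Ker U\<^esub> t \<in> carrier (Sec Ker U)"
  unfolding Ker_carrier_iff[OF U] Ker_smult
proof (intro conjI)
  have tQ: "t \<in> carrier (Sec Q U)" using t by (auto simp: Ker_carrier_iff[OF U])
  then show "r \<odot>\<^bsub>Sec Q U\<^esub> t \<in> carrier (Sec Q U)" by (rule Q_smult_closed[OF U r])
  show "\<forall>x\<in>U. \<forall>V b. (V, b) \<in> (r \<odot>\<^bsub>Sec Q U\<^esub> t) x \<longrightarrow> (\<forall>k\<in>K. \<psi> V b k x = 0)"
  proof
    fix x assume x: "x \<in> U"
    obtain V b where
      V: "zopen N V" "x \<in> V" "V \<subseteq> U" "b \<in> carrier (Sec SB V)" and g1: "\<forall>y\<in>V. t y = germ y V b"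
      and r': "fun_restrict V r \<in> line_sections N 0 V"
      and g2: "\<forall>y\<in>V. (r \<odot>\<^bsub>Sec Q U\<^esub> t) y = germ y V (\<lambda>j y. fun_restrict V r y * b j y)"
      by (rule Q_smult_rep[OF tQ x U r])
    note g = g1[THEN bspec, OF V(2)] g2[THEN bspec, OF V(2)]
    have "\<forall>k\<in>K. \<psi> V b k x = 0"
      using t x Ker_mem_iff[where t = t, OF V(1,2,4) g(1)] unfolding Ker_carrier_iff[OF U] by blast
    then show "\<forall>V b. (V, b) \<in> (r \<odot>\<^bsub>Sec Q U\<^esub> t) x \<longrightarrow> (\<forall>k\<in>K. \<psi> V b k x = 0)"
      using Ker_mem_iff[where t = "r \<odot>\<^bsub>Sec Q U\<^esub> t", OF V(1,2) line_sum_closed_smult[OF V(1) r' V(4)] g(2)]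
      by (simp add: matrix_map_smult)
  qed
qed

lemma Ker_res_closed:
  assumes "t \<in> carrier (Sec Ker U)" "zopen N U" "zopen N V" "V \<subseteq> U"
  shows "Res Ker U V t \<in> carrier (Sec Ker V)"
  unfolding Ker_carrier_iff[OF assms(3)] Ker_Res
proof (intro conjI ballI)
  have t: "t \<in> carrier (Sec Q U)" "\<forall>x\<in>U. \<forall>V b. (V, b) \<in> t x \<longrightarrow> (\<forall>k\<in>K. \<psi> V b k x = 0)"
    using assms(1) unfolding Ker_carrier_iff[OF assms(2)] by blast+
  from t(1) show "Res Q U V t \<in> carrier (Sec Q V)" by (rule Q_res_closed[OF _ assms(2-4)])
  fix x assume x: "x \<in> V"
  from bspec[OF t(2) subsetD[OF assms(4) x]] x
  show "\<forall>W b. (W, b) \<in> Res Q U V t x \<longrightarrow> (\<forall>k\<in>K. \<psi> W b k x = 0)" by simp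
qed

lemma Ker_glue:
  assumes U: "zopen N U" and out: "\<And>x. x \<notin> U \<Longrightarrow> t x = {}"
    and loc: "\<And>x. x \<in> U \<Longrightarrow> \<exists>V. zopen N V \<and> x \<in> V \<and> V \<subseteq> U \<and> Res Ker U V t \<in> carrier (Sec Ker V)"
  shows "t \<in> carrier (Sec Ker U)"
  unfolding Ker_carrier_iff[OF U]
proof (intro conjI ballI)
  show "t \<in> carrier (Sec Q U)"
  proof (rule Q_glue[OF out])
    fix x assume "x \<in> U"
    with loc obtain V where V: "zopen N V" "x \<in> V" "V \<subseteq> U" "Res Ker U V t \<in> carrier (Sec Ker V)" by blast
    from V(4) have "Res Q U V t \<in> carrier (Sec Q V)" unfolding Ker_carrier_iff[OF V(1)] Ker_Res by blast
    with V show "\<exists>V. zopen N V \<and> x \<in> V \<and> V \<subseteq> U \<and> Res Q U V t \<in> carrier (Sec Q V)" by blast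
  qed
  fix x assume x: "x \<in> U"
  then obtain V where V: "zopen N V" "x \<in> V" "Res Ker U V t \<in> carrier (Sec Ker V)" using loc by blast
  then have "\<forall>W b. (W, b) \<in> Res Ker U V t x \<longrightarrow> (\<forall>k\<in>K. \<psi> W b k x = 0)"
    unfolding Ker_carrier_iff[OF V(1)] by blast
  with V(2) show "\<forall>V b. (V, b) \<in> t x \<longrightarrow> (\<forall>k\<in>K. \<psi> V b k x = 0)" by simp
qed

end

subsection \<open>Factoring through an injection and through a cokernel\<close>

lemma shf_hom_closed: "shf_hom N F G \<phi> \<Longrightarrow> zopen N U \<Longrightarrow> s \<in> carrier (Sec F U) \<Longrightarrow> \<phi> U s \<in> carrier (Sec G U)"
  and shf_hom_add: "shf_hom N F G \<phi> \<Longrightarrow> zopen N U \<Longrightarrow> s \<in> carrier (Sec F U) \<Longrightarrow> t \<in> carrier (Sec F U) \<Longrightarrow>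
    \<phi> U (s \<oplus>\<^bsub>Sec F U\<^esub> t) = \<phi> U s \<oplus>\<^bsub>Sec G U\<^esub> \<phi> U t"
  and shf_hom_smult: "shf_hom N F G \<phi> \<Longrightarrow> zopen N U \<Longrightarrow> r \<in> line_sections N 0 U \<Longrightarrow> s \<in> carrier (Sec F U) \<Longrightarrow>
    \<phi> U (r \<odot>\<^bsub>Sec F U\<^esub> s) = r \<odot>\<^bsub>Sec G U\<^esub> \<phi> U s"
  and shf_hom_res: "shf_hom N F G \<phi> \<Longrightarrow> zopen N U \<Longrightarrow> zopen N V \<Longrightarrow> V \<subseteq> U \<Longrightarrow> s \<in> carrier (Sec F U) \<Longrightarrow>
    \<phi> V (Res F U V s) = Res G U V (\<phi> U s)"
  unfolding shf_hom_def by blast+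

lemma fun_restrict_restrict: "W \<subseteq> V \<Longrightarrow> fun_restrict W (fun_restrict V s) = fun_restrict W s"
  by (auto simp: fun_restrict_def fun_eq_iff)

context matrix_complex
begin

text \<open>Injectivity makes local preimages agree on overlaps, so they glue.\<close>

lemma lift_along_injection:
  fixes \<pi> :: "(('j \<Rightarrow> pt \<Rightarrow> complex) germ_fun, 'l \<Rightarrow> pt \<Rightarrow> complex) shf_map"
    and J' :: "'l set" and dJ' :: "'l \<Rightarrow> int"
  defines "G \<equiv> line_sum N J' dJ'"
  assumes \<pi>: "shf_hom N Ker G \<pi>" and inj: "shf_inj N Ker \<pi>"
    and U: "zopen N U" and t: "t \<in> carrier (Sec G U)" and loc: "locally_in_image N Ker G \<pi> U t"
  shows "\<exists>n \<in> carrier (Sec Ker U). \<pi> U n = t"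
proof -
  from loc have "\<forall>x\<in>U. \<exists>V n. zopen N V \<and> x \<in> V \<and> V \<subseteq> U \<and> n \<in> carrier (Sec Ker V) \<and> \<pi> V n = Res G U V t"
    unfolding locally_in_image_def by blast
  then have "\<exists>V n. \<forall>x\<in>U. zopen N (V x) \<and> x \<in> V x \<and> V x \<subseteq> U \<and> n x \<in> carrier (Sec Ker (V x)) \<and>
      \<pi> (V x) (n x) = Res G U (V x) t"
    by (simp only: bchoice_iff)
  then obtain V n where V: "\<And>x. x \<in> U \<Longrightarrow> zopen N (V x)" "\<And>x. x \<in> U \<Longrightarrow> x \<in> V x" "\<And>x. x \<in> U \<Longrightarrow> V x \<subseteq> U"
    and n: "\<And>x. x \<in> U \<Longrightarrow> n x \<in> carrier (Sec Ker (V x))" "\<And>x. x \<in> U \<Longrightarrow> \<pi> (V x) (n x) = Res G U (V x) t"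
    by auto
  have agree: "n x z = n y z" if x: "x \<in> U" and y: "y \<in> U" and z: "z \<in> V x" "z \<in> V y" for x y z
  proof -
    let ?W = "V x \<inter> V y"
    have W: "zopen N ?W" using V x y by (intro zopen_Int)
    have p: "\<pi> ?W (Res Ker (V u) ?W (n u)) = Res G U ?W t" if u: "u \<in> U" "?W \<subseteq> V u" for u
      using shf_hom_res[OF \<pi> V(1)[OF u(1)] W u(2) n(1)[OF u(1)]] n(2)[OF u(1)]
      by (simp add: G_def fun_restrict_restrict[OF u(2)])
    have "Res Ker (V x) ?W (n x) = Res Ker (V y) ?W (n y)"
    proof (rule inj_onD)
      show "inj_on (\<pi> ?W) (carrier (Sec Ker ?W))" using inj W unfolding shf_inj_def by blast
      show "\<pi> ?W (Res Ker (V x) ?W (n x)) = \<pi> ?W (Res Ker (V y) ?W (n y))"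
        using p[OF x] p[OF y] by simp
    qed (use V n x y W in \<open>auto intro!: Ker_res_closed simp del: Ker_Res\<close>)
    from fun_cong[OF this, of z] z show ?thesis by simp
  qed
  \<comment> \<open>At \<open>y\<close> the value is taken from the preimage chosen around
    \<open>y\<close> itself; by \<open>agree\<close> it coincides with the others.\<close>
  define n0 where "n0 y = (if y \<in> U then n y y else {})" for y
  have res: "Res Ker U (V x) n0 = n x" if x: "x \<in> U" for x
  proof
    fix y
    show "Res Ker U (V x) n0 y = n x y"
    proof (cases "y \<in> V x")
      case True
      then have y: "y \<in> U" using V(3)[OF x] by blast
      then show ?thesis using True agree[OF x y True V(2)[OF y]] by (simp add: n0_def)
    next
      case False
      then show ?thesis using n(1)[OF x] by (simp add: Ker_carrier_iff[OF V(1)[OF x]] Q_carrier_iff)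
    qed
  qed
  have n0: "n0 \<in> carrier (Sec Ker U)"
  proof (rule Ker_glue[OF U])
    fix x assume "x \<in> U"
    then show "\<exists>W. zopen N W \<and> x \<in> W \<and> W \<subseteq> U \<and> Res Ker U W n0 \<in> carrier (Sec Ker W)"
      using V n(1) res by (intro exI[of _ "V x"]) simp
  qed (simp add: n0_def)
  have "\<pi> U n0 = t"
  proof (intro ext)
    fix j y
    show "\<pi> U n0 j y = t j y"
    proof (cases "y \<in> U")
      case True
      have "Res G U (V y) (\<pi> U n0) = Res G U (V y) t"
        using shf_hom_res[OF \<pi> U V(1,3)[OF True] n0] res[OF True] n(2)[OF True] by simp
      from fun_cong[OF fun_cong[OF this, of j], of y] V(2)[OF True] show ?thesis
        by (simp add: G_def fun_restrict_def)
    next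
      case False
      then show ?thesis using shf_hom_closed[OF \<pi> U n0] t
        by (simp add: G_def line_sum_carrier_iff[OF U])
    qed
  qed
  with n0 show ?thesis by blast
qed

text \<open>Preimages under \<open>\<pi>\<close> are unique, so linearity and compatibility with
  restriction can be checked after applying \<open>\<pi>\<close>. Surjectivity is the inclusion
  \<open>im'\<close> of local images.\<close>

lemma factor_through_injection:
  fixes \<pi> :: "(('j \<Rightarrow> pt \<Rightarrow> complex) germ_fun, 'l \<Rightarrow> pt \<Rightarrow> complex) shf_map"
    and J' :: "'l set" and dJ' :: "'l \<Rightarrow> int"
    and \<theta> :: "('m \<Rightarrow> pt \<Rightarrow> complex, 'l \<Rightarrow> pt \<Rightarrow> complex) shf_map"
    and I' :: "'m set" and dI' :: "'m \<Rightarrow> int"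
  defines "G \<equiv> line_sum N J' dJ'" and "A \<equiv> line_sum N I' dI'"
  assumes \<pi>: "shf_hom N Ker G \<pi>" and inj: "shf_inj N Ker \<pi>" and \<theta>: "shf_hom N A G \<theta>"
    and im: "\<And>U s. zopen N U \<Longrightarrow> s \<in> carrier (Sec A U) \<Longrightarrow> locally_in_image N Ker G \<pi> U (\<theta> U s)"
    and im': "\<And>U n. zopen N U \<Longrightarrow> n \<in> carrier (Sec Ker U) \<Longrightarrow> locally_in_image N A G \<theta> U (\<pi> U n)"
  shows "\<exists>\<sigma>. shf_hom N A Ker \<sigma> \<and> shf_surj N A Ker \<sigma> \<and> shf_map_eq N A \<theta> (shf_comp \<pi> \<sigma>)"
proof -
  define \<sigma> where "\<sigma> U s = (SOME n. n \<in> carrier (Sec Ker U) \<and> \<pi> U n = \<theta> U s)" for U s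
  have \<sigma>: "\<sigma> U s \<in> carrier (Sec Ker U) \<and> \<pi> U (\<sigma> U s) = \<theta> U s" if "zopen N U" "s \<in> carrier (Sec A U)" for U s
  proof -
    have "\<exists>n \<in> carrier (Sec Ker U). \<pi> U n = \<theta> U s"
      using lift_along_injection[OF \<pi>[unfolded G_def] inj that(1)] shf_hom_closed[OF \<theta> that] im[OF that]
      by (simp add: G_def)
    then have "\<exists>n. n \<in> carrier (Sec Ker U) \<and> \<pi> U n = \<theta> U s" unfolding Bex_def .
    then show ?thesis unfolding \<sigma>_def by (rule someI_ex)
  qed
  have eqI: "n = n'" if "zopen N U" "n \<in> carrier (Sec Ker U)" "n' \<in> carrier (Sec Ker U)" "\<pi> U n = \<pi> U n'" for U n n'
    using inj_onD[OF inj[unfolded shf_inj_def, rule_format, OF that(1)] that(4,2,3)] .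
  have "shf_hom N A Ker \<sigma>"
    unfolding shf_hom_def
  proof (intro allI impI conjI ballI)
    fix U assume U: "zopen N U"
    show "\<sigma> U s \<in> carrier (Sec Ker U)" if "s \<in> carrier (Sec A U)" for s using \<sigma> U that by blast
    show "\<sigma> U (s \<oplus>\<^bsub>Sec A U\<^esub> t) = \<sigma> U s \<oplus>\<^bsub>Sec Ker U\<^esub> \<sigma> U t"
      if s: "s \<in> carrier (Sec A U)" and t: "t \<in> carrier (Sec A U)" for s t
    proof (rule eqI[OF U])
      have st: "s \<oplus>\<^bsub>Sec A U\<^esub> t \<in> carrier (Sec A U)"
        using line_sum_closed_add[OF U] s t by (simp add: A_def)
      show "\<sigma> U (s \<oplus>\<^bsub>Sec A U\<^esub> t) \<in> carrier (Sec Ker U)" using \<sigma>[OF U st] by blast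
      show "\<sigma> U s \<oplus>\<^bsub>Sec Ker U\<^esub> \<sigma> U t \<in> carrier (Sec Ker U)"
        using \<sigma>[OF U s] \<sigma>[OF U t] Ker_add_closed[OF U] by blast
      show "\<pi> U (\<sigma> U (s \<oplus>\<^bsub>Sec A U\<^esub> t)) = \<pi> U (\<sigma> U s \<oplus>\<^bsub>Sec Ker U\<^esub> \<sigma> U t)"
        using \<sigma>[OF U st] \<sigma>[OF U s] \<sigma>[OF U t] shf_hom_add[OF \<pi> U, of "\<sigma> U s" "\<sigma> U t"]
          shf_hom_add[OF \<theta> U s t] by simp
    qed
    show "\<sigma> U (r \<odot>\<^bsub>Sec A U\<^esub> s) = r \<odot>\<^bsub>Sec Ker U\<^esub> \<sigma> U s"
      if r: "r \<in> line_sections N 0 U" and s: "s \<in> carrier (Sec A U)" for r s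
    proof (rule eqI[OF U])
      have rs: "r \<odot>\<^bsub>Sec A U\<^esub> s \<in> carrier (Sec A U)"
        using line_sum_closed_smult[OF U r] s by (simp add: A_def)
      show "\<sigma> U (r \<odot>\<^bsub>Sec A U\<^esub> s) \<in> carrier (Sec Ker U)" using \<sigma>[OF U rs] by blast
      show "r \<odot>\<^bsub>Sec Ker U\<^esub> \<sigma> U s \<in> carrier (Sec Ker U)"
        using \<sigma>[OF U s] Ker_smult_closed[OF U r] by blast
      show "\<pi> U (\<sigma> U (r \<odot>\<^bsub>Sec A U\<^esub> s)) = \<pi> U (r \<odot>\<^bsub>Sec Ker U\<^esub> \<sigma> U s)"
        using \<sigma>[OF U rs] \<sigma>[OF U s] shf_hom_smult[OF \<pi> U r, of "\<sigma> U s"] shf_hom_smult[OF \<theta> U r s] by simp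
    qed
    show "\<sigma> V (Res A U V s) = Res Ker U V (\<sigma> U s)"
      if V: "zopen N V" "V \<subseteq> U" and s: "s \<in> carrier (Sec A U)" for V s
    proof (rule eqI[OF V(1)])
      have rs: "Res A U V s \<in> carrier (Sec A V)"
        using line_sum_restrict[of s N I' dI' U V] U V s by (simp add: A_def)
      show "\<sigma> V (Res A U V s) \<in> carrier (Sec Ker V)" using \<sigma>[OF V(1) rs] by blast
      show "Res Ker U V (\<sigma> U s) \<in> carrier (Sec Ker V)"
        using \<sigma>[OF U s] Ker_res_closed[OF _ U V] by blast
      show "\<pi> V (\<sigma> V (Res A U V s)) = \<pi> V (Res Ker U V (\<sigma> U s))"
        using \<sigma>[OF V(1) rs] \<sigma>[OF U s] shf_hom_res[OF \<pi> U V, of "\<sigma> U s"] shf_hom_res[OF \<theta> U V s] by simp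
    qed
  qed
  moreover have "shf_surj N A Ker \<sigma>"
    unfolding shf_surj_def locally_in_image_def
  proof (intro allI impI ballI)
    fix U n x assume U: "zopen N U" and n: "n \<in> carrier (Sec Ker U)" and x: "x \<in> U"
    obtain V s where V: "zopen N V" "x \<in> V" "V \<subseteq> U" and s: "s \<in> carrier (Sec A V)" "\<theta> V s = Res G U V (\<pi> U n)"
      using im'[OF U n] x unfolding locally_in_image_def by blast
    have "\<sigma> V s = Res Ker U V n"
    proof (rule eqI[OF V(1)])
      show "Res Ker U V n \<in> carrier (Sec Ker V)" by (rule Ker_res_closed[OF n U V(1,3)])
      show "\<pi> V (\<sigma> V s) = \<pi> V (Res Ker U V n)"
        using \<sigma>[OF V(1) s(1)] s(2) shf_hom_res[OF \<pi> U V(1,3) n] by simp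
    qed (use \<sigma>[OF V(1) s(1)] in blast)
    with V s(1) show "\<exists>V. zopen N V \<and> x \<in> V \<and> V \<subseteq> U \<and> (\<exists>s\<in>carrier (Sec A V). \<sigma> V s = Res Ker U V n)"
      by blast
  qed
  moreover have "shf_map_eq N A \<theta> (shf_comp \<pi> \<sigma>)"
    using \<sigma> by (simp add: shf_map_eq_def shf_comp_def)
  ultimately show ?thesis by blast
qed

end

context matrix_coker
begin

text \<open>The summands in \<open>J1\<close> already surject onto the cokernel, so a section of it
  is evaluated on a local representative from them. \<open>zero\<close> makes this well defined,
  \<open>exact\<close> makes it injective.\<close>

lemma factor_through_coker:
  fixes J1 :: "'j set" and X :: "'k set" and dX :: "'k \<Rightarrow> int" and P :: "'k \<Rightarrow> 'j \<Rightarrow> cpoly"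
  defines "B1 \<equiv> line_sum N J1 dJ" and "C \<equiv> line_sum N X dX" and "\<psi> \<equiv> matrix_map X J1 P"
  assumes J1: "J1 \<subseteq> J" and P: "form_matrix N X dX J1 dJ P"
    and zero: "\<And>x V b k. zopen N V \<Longrightarrow> x \<in> V \<Longrightarrow> b \<in> carrier (Sec B1 V) \<Longrightarrow> csim x b (\<lambda>j y. 0) \<Longrightarrow> \<psi> V b k x = 0"
    and exact: "\<And>x V b. zopen N V \<Longrightarrow> x \<in> V \<Longrightarrow> b \<in> carrier (Sec B1 V) \<Longrightarrow>
      (\<And>y k. y \<in> V \<Longrightarrow> \<psi> V b k y = 0) \<Longrightarrow> csim x b (\<lambda>j y. 0)"
    and surj: "shf_surj N B1 Q (coker_proj N SA SB \<phi>)"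
  shows "\<exists>\<tau>. shf_hom N Q C \<tau> \<and> shf_inj N Q \<tau> \<and> shf_map_eq N B1 \<psi> (shf_comp \<tau> (coker_proj N SA SB \<phi>))"
proof -
  have B1_B: "b \<in> carrier (Sec SB V)" if "b \<in> carrier (Sec B1 V)" "zopen N V" for b V
    by (rule line_sum_mono[OF that(1)[unfolded B1_def] that(2) J1])
  have rep: "\<exists>V b. zopen N V \<and> x \<in> V \<and> V \<subseteq> U \<and> b \<in> carrier (Sec B1 V) \<and> (\<forall>y\<in>V. t y = germ y V b)"
    if U: "zopen N U" and t: "t \<in> carrier (Sec Q U)" and x: "x \<in> U" for U t x
  proof -
    obtain V b where V: "zopen N V" "x \<in> V" "V \<subseteq> U" "b \<in> carrier (Sec B1 V)"
        "coker_proj N SA SB \<phi> V b = Res Q U V t"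
      using surj U t x unfolding shf_surj_def locally_in_image_def by blast
    have "t y = germ y V b" if "y \<in> V" for y
      using fun_cong[OF V(5), of y] that by (simp add: coker_proj_def)
    with V show ?thesis by blast
  qed
  \<comment> \<open>Representatives with different domains are compared through their difference on
    the intersection, so that \<open>zero\<close> and \<open>exact\<close>, which speak of the zero
    class, apply.\<close>
  define diff where "diff V V' b b' = (\<lambda>j y. fun_restrict (V \<inter> V') (b j) y + - fun_restrict (V \<inter> V') (b' j) y)"
    for V V' and b b' :: "'j \<Rightarrow> pt \<Rightarrow> complex"
  have diff_closed: "diff V V' b b' \<in> carrier (Sec B1 (V \<inter> V'))"
    if "zopen N V" "zopen N V'" "b \<in> carrier (Sec B1 V)" "b' \<in> carrier (Sec B1 V')" for V V' b b'
    unfolding diff_def B1_def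
    by (intro line_sum_closed_add line_sum_closed_uminus zopen_Int that
        line_sum_restrict_Int1[OF that(3)[unfolded B1_def]] line_sum_restrict_Int2[OF that(4)[unfolded B1_def]])
  have diff_psi: "\<psi> (V \<inter> V') (diff V V' b b') k y = \<psi> V b k y - \<psi> V' b' k y" if "y \<in> V \<inter> V'" for V V' b b' k y
    using that by (simp add: \<psi>_def matrix_map_def diff_def fun_restrict_def right_diff_distrib sum_subtractf)
  have diff_csim: "csim x (diff V V' b b') (\<lambda>j y. 0) \<longleftrightarrow> csim x b b'"
    if V: "zopen N V" "zopen N V'" "x \<in> V \<inter> V'" for x V V' b b'
  proof -
    have W: "zopen N (V \<inter> V')" using V by (intro zopen_Int)
    have x: "x \<in> cone_pts N" using V zopen_subset by blast
    have d: "csim x (diff V V' b b') (\<lambda>j y. b j y + - b' j y)"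
      by (rule csim_cong[OF W V(3)]) (simp add: diff_def fun_restrict_def)
    show ?thesis
    proof
      assume "csim x (diff V V' b b') (\<lambda>j y. 0)"
      then have "csim x (\<lambda>j y. b j y + - b' j y) (\<lambda>j y. 0)"
        using csim_trans[OF csim_sym[OF d x] _ x] by blast
      from csim_add[OF this csim_refl[OF x, of b'] x] show "csim x b b'" by simp
    next
      assume "csim x b b'"
      from csim_add[OF this csim_refl[OF x, of "\<lambda>j y. - b' j y"] x]
      have "csim x (\<lambda>j y. b j y + - b' j y) (\<lambda>j y. 0)" by simp
      then show "csim x (diff V V' b b') (\<lambda>j y. 0)" by (rule csim_trans[OF d _ x])
    qed
  qed
  \<comment> \<open>A germ also contains representatives with components outside \<open>J1\<close>,
    which \<open>\<psi>\<close> ignores; the choice is restricted to those in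
    \<open>B1\<close>.\<close>
  define \<tau> where "\<tau> U t = (\<lambda>k x. if x \<in> U
      then let p = SOME p. p \<in> t x \<and> snd p \<in> carrier (Sec B1 (fst p)) in \<psi> (fst p) (snd p) k x else 0)"
    for U t
  have \<tau>: "\<tau> U t k x = \<psi> V b k x"
    if U: "zopen N U" and x: "x \<in> U" and V: "zopen N V" "x \<in> V" and b: "b \<in> carrier (Sec B1 V)"
      and t: "t x = germ x V b" for U t x V b k
  proof -
    have "(V, b) \<in> t x" unfolding t by (rule self_mem_germ[OF V B1_B[OF b V(1)]])
    then have "\<exists>p. p \<in> t x \<and> snd p \<in> carrier (Sec B1 (fst p))" using b by (intro exI[of _ "(V, b)"]) simp
    from someI_ex[OF this] obtain V' b' where
      p: "(SOME p. p \<in> t x \<and> snd p \<in> carrier (Sec B1 (fst p))) = (V', b')"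
      and b': "(V', b') \<in> t x" "b' \<in> carrier (Sec B1 V')"
      by (cases "SOME p. p \<in> t x \<and> snd p \<in> carrier (Sec B1 (fst p))") simp
    from b'(1) have V': "zopen N V'" "x \<in> V'" "csim x b b'"
      unfolding t mem_germ_iff[OF V B1_B[OF b V(1)]] by auto
    have "csim x (diff V V' b b') (\<lambda>j y. 0)"
      using diff_csim[OF V(1) V'(1)] V V' by simp
    from zero[OF zopen_Int[OF V(1) V'(1)] _ diff_closed[OF V(1) V'(1) b b'(2)] this, of k]
    have "\<psi> V b k x = \<psi> V' b' k x" using diff_psi[of x V V'] V V' by simp
    then show ?thesis using x p by (simp add: \<tau>_def)
  qed
  have \<tau>_closed: "\<tau> U t \<in> carrier (Sec C U)" if U: "zopen N U" and t: "t \<in> carrier (Sec Q U)" for U t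
    unfolding C_def line_sum_carrier_iff[OF U]
  proof (intro conjI allI impI ballI)
    fix k x assume k: "k \<in> X" and x: "x \<in> U"
    obtain V b where V: "zopen N V" "x \<in> V" "V \<subseteq> U" "b \<in> carrier (Sec B1 V)" "\<forall>y\<in>V. t y = germ y V b"
      using rep[OF U t x] by blast
    have "regular_at N (dX k) x (\<psi> V b k)"
      using matrix_map_closed[OF P V(1), of b] V(2,4) k
      by (simp add: \<psi>_def B1_def line_sum_carrier_iff[OF V(1)])
    then show "regular_at N (dX k) x (\<tau> U t k)"
    proof (rule regular_at_cong[OF _ V(1,2)])
      fix y assume y: "y \<in> V"
      show "\<psi> V b k y = \<tau> U t k y"
        by (rule \<tau>[where t = t, symmetric, OF U subsetD[OF V(3) y] V(1) y V(4) bspec[OF V(5) y]])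
    qed
  qed (auto simp: \<tau>_def \<psi>_def matrix_map_def Let_def)
  have "shf_hom N Q C \<tau>"
    unfolding shf_hom_def
  proof (intro allI impI conjI ballI)
    fix U assume U: "zopen N U"
    show "\<tau> U t \<in> carrier (Sec C U)" if "t \<in> carrier (Sec Q U)" for t by (rule \<tau>_closed[OF U that])
    show "\<tau> U (s \<oplus>\<^bsub>Sec Q U\<^esub> t) = \<tau> U s \<oplus>\<^bsub>Sec C U\<^esub> \<tau> U t"
      if s: "s \<in> carrier (Sec Q U)" and t: "t \<in> carrier (Sec Q U)" for s t
    proof (intro ext)
      fix k x
      show "\<tau> U (s \<oplus>\<^bsub>Sec Q U\<^esub> t) k x = (\<tau> U s \<oplus>\<^bsub>Sec C U\<^esub> \<tau> U t) k x"
      proof (cases "x \<in> U")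
        case x: True
        obtain V b where V: "zopen N V" "x \<in> V" "b \<in> carrier (Sec B1 V)" "s x = germ x V b"
          using rep[OF U s x] by blast
        obtain V' b' where V': "zopen N V'" "x \<in> V'" "b' \<in> carrier (Sec B1 V')" "t x = germ x V' b'"
          using rep[OF U t x] by blast
        let ?b = "\<lambda>j y. fun_restrict (V \<inter> V') (b j) y + fun_restrict (V \<inter> V') (b' j) y"
        have W: "zopen N (V \<inter> V')" "x \<in> V \<inter> V'" using V V' by (auto intro: zopen_Int)
        have b: "?b \<in> carrier (Sec B1 (V \<inter> V'))"
          unfolding B1_def
          by (intro line_sum_closed_add W line_sum_restrict_Int1[OF V(3)[unfolded B1_def]]
              line_sum_restrict_Int2[OF V'(3)[unfolded B1_def]] V(1) V'(1))
        have "\<tau> U (s \<oplus>\<^bsub>Sec Q U\<^esub> t) k x = \<psi> (V \<inter> V') ?b k x"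
          by (rule \<tau>[OF U x W b])
            (rule Q_add_germ[where s = s and t = t, OF V(1,2) B1_B[OF V(3,1)] V(4) V'(1,2) B1_B[OF V'(3,1)] V'(4)])
        also have "\<dots> = \<psi> V b k x + \<psi> V' b' k x"
          using W by (simp add: \<psi>_def matrix_map_def fun_restrict_def distrib_left sum.distrib)
        finally show ?thesis
          using \<tau>[where t = s, OF U x V] \<tau>[where t = t, OF U x V'] by (simp add: C_def)
      qed (simp add: \<tau>_def C_def)
    qed
    show "\<tau> U (r \<odot>\<^bsub>Sec Q U\<^esub> t) = r \<odot>\<^bsub>Sec C U\<^esub> \<tau> U t"
      if r: "r \<in> line_sections N 0 U" and t: "t \<in> carrier (Sec Q U)" for r t
    proof (intro ext)
      fix k x
      show "\<tau> U (r \<odot>\<^bsub>Sec Q U\<^esub> t) k x = (r \<odot>\<^bsub>Sec C U\<^esub> \<tau> U t) k x"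
      proof (cases "x \<in> U")
        case x: True
        obtain V b where V: "zopen N V" "x \<in> V" "b \<in> carrier (Sec B1 V)" "t x = germ x V b"
          using rep[OF U t x] by blast
        let ?b = "\<lambda>j y. fun_restrict (U \<inter> V) r y * fun_restrict (U \<inter> V) (b j) y"
        have W: "zopen N (U \<inter> V)" "x \<in> U \<inter> V" using V U x by (auto intro: zopen_Int)
        have b: "?b \<in> carrier (Sec B1 (U \<inter> V))"
          unfolding B1_def
          by (intro line_sum_closed_smult W line_sections_restrict[OF r U W(1)]
              line_sum_restrict_Int2[OF V(3)[unfolded B1_def]] V(1) U) simp
        have "\<tau> U (r \<odot>\<^bsub>Sec Q U\<^esub> t) k x = \<psi> (U \<inter> V) ?b k x"
          by (rule \<tau>[OF U x W b]) (rule Q_smult_germ[where t = t, OF V(1,2) B1_B[OF V(3,1)] V(4) U x r])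
        also have "\<dots> = r x * \<psi> V b k x"
          using W by (simp add: \<psi>_def matrix_map_def fun_restrict_def sum_distrib_left mult.left_commute)
        finally show ?thesis using \<tau>[where t = t, OF U x V] by (simp add: C_def)
      qed (simp add: \<tau>_def C_def)
    qed
    show "\<tau> V (Res Q U V t) = Res C U V (\<tau> U t)"
      if V: "zopen N V" "V \<subseteq> U" and t: "t \<in> carrier (Sec Q U)" for V t
      using V(2) by (auto simp: fun_eq_iff \<tau>_def C_def fun_restrict_def)
  qed
  moreover have "shf_inj N Q \<tau>"
    unfolding shf_inj_def
  proof (intro allI impI inj_onI)
    fix U s t assume U: "zopen N U" and s: "s \<in> carrier (Sec Q U)" and t: "t \<in> carrier (Sec Q U)"
      and eq: "\<tau> U s = \<tau> U t"
    show "s = t"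
    proof
      fix x show "s x = t x"
      proof (cases "x \<in> U")
        case x: True
        obtain V b where V: "zopen N V" "x \<in> V" "V \<subseteq> U" "b \<in> carrier (Sec B1 V)" "\<forall>y\<in>V. s y = germ y V b"
          using rep[OF U s x] by blast
        obtain V' b' where V': "zopen N V'" "x \<in> V'" "V' \<subseteq> U" "b' \<in> carrier (Sec B1 V')" "\<forall>y\<in>V'. t y = germ y V' b'"
          using rep[OF U t x] by blast
        have W: "zopen N (V \<inter> V')" "x \<in> V \<inter> V'" using V V' by (auto intro: zopen_Int)
        have "\<psi> (V \<inter> V') (diff V V' b b') k y = 0" if y: "y \<in> V \<inter> V'" for y k
        proof -
          have y': "y \<in> V" "y \<in> V'" using y by auto
          show ?thesis
            using diff_psi[OF y] \<tau>[where t = s, OF U subsetD[OF V(3) y'(1)] V(1) y'(1) V(4) bspec[OF V(5) y'(1)], of k]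
              \<tau>[where t = t, OF U subsetD[OF V'(3) y'(2)] V'(1) y'(2) V'(4) bspec[OF V'(5) y'(2)], of k] eq by simp
        qed
        from exact[OF W diff_closed[OF V(1) V'(1) V(4) V'(4)] this]
        have "csim x b b'" using diff_csim[OF V(1) V'(1) W(2)] by blast
        then have "germ x V b = germ x V' b'"
          unfolding germ_eq_iff[OF V(1,2) B1_B[OF V(4,1)] V'(1,2) B1_B[OF V'(4,1)]] .
        then show ?thesis using V V' by simp
      next
        case False
        then show ?thesis using s t by (simp add: Q_carrier_iff)
      qed
    qed
  qed
  moreover have "shf_map_eq N B1 \<psi> (shf_comp \<tau> (coker_proj N SA SB \<phi>))"
    unfolding shf_map_eq_def shf_comp_def
  proof (intro allI impI ballI ext)
    fix U b k x assume U: "zopen N U" and b: "b \<in> carrier (Sec B1 U)"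
    show "\<psi> U b k x = \<tau> U (coker_proj N SA SB \<phi> U b) k x"
    proof (cases "x \<in> U")
      case x: True
      show ?thesis by (rule \<tau>[symmetric, OF U x U x b]) (simp add: coker_proj_def x)
    next
      case False
      with b show ?thesis by (simp add: \<tau>_def \<psi>_def matrix_map_def B1_def line_sum_carrier_iff[OF U])
    qed
  qed
  ultimately show ?thesis by blast
qed

end

subsection \<open>Ranks over the field of rational functions\<close>

lemma sum_apply: "(\<Sum>e\<in>A. u e) i = (\<Sum>e\<in>A. u e i :: 'a::comm_monoid_add)"
  by (induction A rule: infinite_finite_induct) auto

text \<open>A minor that is nonzero at one point is a nonzero polynomial, hence nonzero over the
  field of rational functions.\<close>

lemma indep_cols_transfer:
  fixes X :: "'i \<Rightarrow> 'c \<Rightarrow> cpoly"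
  assumes "finite I" "finite C" "indep_cols I C (\<lambda>i c. peval (X i c) y)"
  shows "\<exists>R\<subseteq>I. card R = card C \<and> indep_cols R C (\<lambda>i c. Fract (X i c) 1)"
proof -
  interpret frac: comm_ring_hom "\<lambda>p :: cpoly. Fract p 1" by (rule frac_hom)
  obtain R where R: "R \<subseteq> I" "card R = card C" "indep_cols R C (\<lambda>i c. peval (X i c) y)"
    using indep_cols_select_rows[OF assms] by blast
  obtain \<rho> where \<rho>: "bij_betw \<rho> {..<card C} R"
    using ex_enumeration[of R] R assms(1) finite_subset by metis
  obtain \<kappa> where \<kappa>: "bij_betw \<kappa> {..<card C} C" using ex_enumeration[OF assms(2)] by blast
  have "peval (minor (card C) \<rho> \<kappa> X) y \<noteq> 0"
    using R(3) by (simp add: peval_hom.hom_minor minor_nonzero_iff[OF \<rho> \<kappa>])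
  then have "minor (card C) \<rho> \<kappa> X \<noteq> 0" by auto
  then have "Fract (minor (card C) \<rho> \<kappa> X) 1 \<noteq> 0"
    unfolding Zero_fract_def by (subst eq_fract) auto
  then have "indep_cols R C (\<lambda>i c. Fract (X i c) 1)"
    by (simp add: frac.hom_minor minor_nonzero_iff[OF \<rho> \<kappa>])
  with R show ?thesis by blast
qed

text \<open>Passes from families of columns to sets of vectors, as \<open>fun_vs.dim\<close>
  requires; two equal columns would be a relation.\<close>

lemma indep_cols_independent:
  fixes X :: "'i \<Rightarrow> 'c \<Rightarrow> 'a::field"
  assumes C: "finite C" and ind: "indep_cols I C X"
  defines "v \<equiv> \<lambda>c i. if i \<in> I then X i c else 0"
  shows "inj_on v C" "fun_vs.independent (v ` C)"
proof -
  show inj: "inj_on v C"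
  proof (rule inj_onI, rule ccontr)
    fix c d assume cd: "c \<in> C" "d \<in> C" "v c = v d" "c \<noteq> d"
    let ?a = "\<lambda>e. (if e = c then 1 else 0) - (if e = d then 1 else 0 :: 'a)"
    have "(\<Sum>e\<in>C. X i e * ?a e) = 0" if "i \<in> I" for i
    proof -
      have "(\<Sum>e\<in>C. X i e * ?a e) = X i c - X i d"
      proof -
        have "X i e * ?a e = (if e = c then X i e else 0) - (if e = d then X i e else 0)" for e
          by simp
        then show ?thesis using cd C by (simp only: sum_subtractf sum.delta if_True)
      qed
      then show ?thesis using fun_cong[OF cd(3), of i] that by (simp add: v_def)
    qed
    from indep_colsD[OF ind this cd(1)] cd(4) show False by simp
  qed
  show "fun_vs.independent (v ` C)"
  proof (rule fun_vs.independent_if_scalars_zero)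
    show "finite (v ` C)" using C by simp
    fix f x assume sum: "(\<Sum>x\<in>v ` C. fscale (f x) x) = 0" and "x \<in> v ` C"
    then obtain c where c: "c \<in> C" "x = v c" by blast
    have "(\<Sum>e\<in>C. fscale (f (v e)) (v e)) = 0"
      using sum by (simp add: sum.reindex[OF inj] o_def)
    then have s: "(\<Sum>e\<in>C. fscale (f (v e)) (v e)) i = 0" for i by simp
    have "(\<Sum>e\<in>C. X i e * f (v e)) = 0" if "i \<in> I" for i
      using s[of i] that by (simp add: sum_apply fscale_def v_def mult.commute)
    from indep_colsD[OF ind this c(1)] c(2) show "f x = 0" by simp
  qed
qed

lemma poly_matrix_rank_ge:
  assumes "finite J" "C \<subseteq> J" "indep_cols I C (\<lambda>i c. Fract (M i c) 1)"
  shows "card C \<le> poly_matrix_rank I J M"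
proof -
  let ?v = "\<lambda>c i. if i \<in> I then Fract (M i c) 1 else 0"
  have C: "finite C" using assms finite_subset by blast
  obtain B where B: "B \<subseteq> ?v ` J" "fun_vs.independent B" "?v ` J \<subseteq> fun_vs.span B" "card B = fun_vs.dim (?v ` J)"
    using fun_vs.basis_exists[of "?v ` J"] by blast
  have "finite B" using B(1) assms(1) finite_subset by blast
  moreover have "?v ` C \<subseteq> fun_vs.span B" using B(3) assms(2) by blast
  ultimately have "card (?v ` C) \<le> card B"
    using fun_vs.independent_span_bound[of B "?v ` C"] indep_cols_independent(2)[OF C assms(3)] by blast
  then show ?thesis
    using B(4) card_image[OF indep_cols_independent(1)[OF C assms(3)]] by (simp add: poly_matrix_rank_def)
qed

lemma poly_matrix_rank_le:
  assumes "finite L" "\<And>j. j \<in> J \<Longrightarrow> \<exists>p. \<forall>i\<in>I. Fract (M i j) 1 = (\<Sum>l\<in>L. v i l * p l)"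
  shows "poly_matrix_rank I J M \<le> card L"
proof -
  let ?u = "\<lambda>l i. if i \<in> I then v i l else 0"
  have "(\<lambda>i. if i \<in> I then Fract (M i j) 1 else 0) \<in> fun_vs.span (?u ` L)" if "j \<in> J" for j
  proof -
    obtain p where p: "\<forall>i\<in>I. Fract (M i j) 1 = (\<Sum>l\<in>L. v i l * p l)" using assms(2)[OF \<open>j \<in> J\<close>] by blast
    have "(\<lambda>i. if i \<in> I then Fract (M i j) 1 else 0) = (\<Sum>l\<in>L. fscale (p l) (?u l))"
      using p by (auto simp: fun_eq_iff sum_apply fscale_def mult.commute)
    also have "\<dots> \<in> fun_vs.span (?u ` L)"
      by (intro fun_vs.span_sum fun_vs.span_scale fun_vs.span_base) auto
    finally show ?thesis .
  qed
  then have "fun_vs.dim ((\<lambda>j i. if i \<in> I then Fract (M i j) 1 else 0) ` J) \<le> card (?u ` L)"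
    by (intro fun_vs.dim_le_card) (use assms(1) in auto)
  also have "\<dots> \<le> card L" by (rule card_image_le[OF assms(1)])
  finally show ?thesis by (simp add: poly_matrix_rank_def)
qed

subsection \<open>The fibres of the bundles\<close>

lemma wedge_skew: "wedge v u = - wedge u v"
  by (auto simp: wedge_def fun_eq_iff)

lemma wedge_same: "wedge u u = 0"
  by (auto simp: wedge_def fun_eq_iff)

lemma cst_mult: "cst (a * b) = cst a * cst b"
  by (simp add: cst_def mult_single)

lemma cst_0 [simp]: "cst 0 = 0"
  by (simp add: cst_def)

lemma cst_1 [simp]: "cst 1 = 1"
  by (simp add: cst_def single_one)

lemma cst_uminus: "cst (- a) = - cst a"
  by (simp add: cst_def single_uminus)

lemma cpoly_eq_uminus_iff: "p = - p \<longleftrightarrow> p = (0 :: cpoly)"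
proof
  assume "p = - p"
  then have "Poly_Mapping.lookup p k = Poly_Mapping.lookup (- p) k" for k by (rule arg_cong)
  then have "Poly_Mapping.lookup p k = - Poly_Mapping.lookup p k" for k by simp
  then have "Poly_Mapping.lookup p k = 0" for k by (simp add: complex_eq_iff)
  then show "p = 0" by (intro poly_mapping_eqI) simp
qed simp

locale instanton_data =
  fixes n :: nat and \<alpha> \<beta> \<gamma> :: int
    and W :: "bivector set" and f :: "bivector \<Rightarrow> complex"
    and h :: "nat \<Rightarrow> bivector \<Rightarrow> complex" and g :: "nat \<Rightarrow> cpoly"
  assumes n_pos: "n \<ge> 1"
    and W_subspace: "fun_vs.subspace W"
    and W_indecomposable: "\<And>w. w \<in> W \<Longrightarrow> decomposable n w \<Longrightarrow> w = 0"
    and f_linear: "linear_form f"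
    and f_nonzero: "\<exists>w \<in> ext_square n. f w \<noteq> 0"
    and f_W: "\<And>w. w \<in> W \<Longrightarrow> f w = 0"
    and f_E: "\<And>k w. k \<in> {1..4*n+1} \<Longrightarrow> k \<noteq> 2*n+1 \<Longrightarrow> w \<in> E_space n k \<Longrightarrow> f w = 0"
    and h_linear: "\<And>k. k \<in> {1..4*n+1} \<Longrightarrow> linear_form (h k)"
    and h_kernel: "\<And>k. k \<in> {1..4*n+1} \<Longrightarrow> {w \<in> E_space n k. h k w = 0} = W \<inter> E_space n k"
    and g_forms: "\<And>i. i \<le> 2*n+1 \<Longrightarrow> is_form (2*n+1) (\<gamma> + S_deg n \<alpha> \<beta> i) (g i)"
    and g_no_common_zero: "\<And>x. x \<in> cone_pts (2*n+1) \<Longrightarrow> \<exists>i\<le>2*n+1. peval (g i) x \<noteq> 0"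
begin

declare sum.atMost_Suc [simp del]

abbreviation "N \<equiv> 2*n+1"
abbreviation "e i j \<equiv> wedge (basis_vec i) (basis_vec j)"
definition "F i = f (e i (N - i))"
definition "Bp k j = (\<Sum>i | i \<le> N \<and> i + j = k. cst (h k (e i j)) * g i)"
definition "rp j = (\<Sum>i\<le>N. cst (f (e i j)) * g i)"
text \<open>The product of \<open>Bp\<close>, the inverse of the antidiagonal matrix of
  \<open>f\<close>, and the transpose of \<open>Bp\<close>; the inverse is constant, so the entries
  stay polynomial.\<close>

definition "Mp k l = (\<Sum>j\<le>N. Bp k j * cst (1 / F (N - j)) * Bp l (N - j))"
text \<open>The complement of a set \<open>J\<close> of 2n-1 of the 4n indices has 2n+1 elements,
  the number of coordinates that \<open>psi\<close> expects. The increasing order fixes the sign of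
  component \<open>J\<close>.\<close>

definition "\<rho> J p = sorted_list_of_set (K1 n - J) ! p"
text \<open>\<open>psi\<close> is linear in its last argument, so the entry in column
  \<open>k\<close> is its value at the unit vector \<open>k\<close>.\<close>

definition "Pp J k = psi N (\<lambda>i. cst (F i)) Bp (\<rho> J) (\<lambda>l. if l = k then 1 else 0)"

section \<open>Values of \<open>f\<close> and \<open>h\<close> on basis bivectors\<close>

lemma linear_form_0: "linear_form u \<Longrightarrow> u 0 = 0"
  and linear_form_uminus: "linear_form u \<Longrightarrow> u (- w) = - u w"
  and linear_form_add: "linear_form u \<Longrightarrow> u (w + w') = u w + u w'"
  and linear_form_diff: "linear_form u \<Longrightarrow> u (w - w') = u w - u w'"
  and linear_form_scale: "linear_form u \<Longrightarrow> u (fscale c w) = c * u w"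
  and linear_form_sum: "linear_form u \<Longrightarrow> u (\<Sum>x\<in>A. v x) = (\<Sum>x\<in>A. u (v x))"
proof -
  assume "linear_form u"
  then interpret Vector_Spaces.linear fscale "(*)" u .
  show "u 0 = 0" "u (- w) = - u w" "u (w + w') = u w + u w'" "u (w - w') = u w - u w'"
    "u (fscale c w) = c * u w" "u (\<Sum>x\<in>A. v x) = (\<Sum>x\<in>A. u (v x))"
    by (fact zero neg add diff scale sum)+
qed

lemma linear_form_skew: "linear_form u \<Longrightarrow> u (e j i) = - u (e i j)"
  using linear_form_uminus wedge_skew by metis

lemma linear_form_same: "linear_form u \<Longrightarrow> u (e i i) = 0"
  using linear_form_0 wedge_same by metis

lemma e_in_E: "i \<le> N \<Longrightarrow> j \<le> N \<Longrightarrow> e i j \<in> E_space n (i + j)"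
proof -
  assume ij: "i \<le> N" "j \<le> N"
  have lt: "e p q \<in> E_space n (p + q)" if "p < q" "q \<le> N" for p q
    unfolding E_space_def by (rule fun_vs.span_base) (use that in blast)
  consider "i < j" | "i = j" | "j < i" by linarith
  then show ?thesis
  proof cases
    case 3
    then show ?thesis using fun_vs.span_neg[of "e j i"] lt[OF 3 ij(1)]
      by (subst wedge_skew) (simp add: E_space_def add.commute)
  qed (use ij lt in \<open>auto simp: wedge_same E_space_def fun_vs.span_zero\<close>)
qed

lemma N_range: "N \<in> {1..4*n+1}"
  by simp

lemma f_e_zero: "i \<le> N \<Longrightarrow> j \<le> N \<Longrightarrow> i + j \<noteq> N \<Longrightarrow> f (e i j) = 0"
proof -
  assume ij: "i \<le> N" "j \<le> N" "i + j \<noteq> N"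
  show ?thesis
  proof (cases "i = j")
    case True
    then show ?thesis using linear_form_same[OF f_linear] by simp
  next
    case False
    with ij have "i + j \<in> {1..4*n+1}" by auto
    then show ?thesis using f_E e_in_E ij by blast
  qed
qed

lemma exists_f_e_nonzero: "\<exists>p q. p < q \<and> q \<le> N \<and> p + q = N \<and> f (e p q) \<noteq> 0"
proof (rule ccontr)
  assume *: "\<not> ?thesis"
  have z0: "f (e p q) = 0" if "p < q" "q \<le> N" for p q
    using * f_e_zero[of p q] that by (cases "p + q = N") auto
  have z: "f w = 0" if "w \<in> ext_square n" for w
    using that unfolding ext_square_def
  proof (induction rule: fun_vs.span_induct_alt)
    case (step c x y)
    then obtain p q where "x = e p q" "p < q" "q \<le> N" by blast
    with z0 step show ?case
      by (simp only: linear_form_add[OF f_linear] linear_form_scale[OF f_linear] mult_zero_right add_0_right)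
  qed (rule linear_form_0[OF f_linear])
  then show False using f_nonzero by blast
qed

text \<open>On \<open>E_space n N\<close> the kernel of \<open>h N\<close> lies in W, where
  \<open>f\<close> vanishes; since \<open>f\<close> is nonzero on that space, the two forms are
  proportional.\<close>

lemma h_prop_f: "\<exists>c. c \<noteq> 0 \<and> (\<forall>w\<in>E_space n N. h N w = c * f w)"
proof -
  obtain p q where pq: "p < q" "q \<le> N" "p + q = N" "f (e p q) \<noteq> 0" using exists_f_e_nonzero by blast
  define v where "v = e p q"
  have v: "v \<in> E_space n N" "f v \<noteq> 0" using e_in_E[of p q] pq by (auto simp: v_def)
  note hl = h_linear[OF N_range]
  have ker: "f w = 0" if "w \<in> E_space n N" "h N w = 0" for w
    using h_kernel[OF N_range] that f_W by blast
  have hv: "h N v \<noteq> 0" using ker v by blast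
  have hw: "h N w = (h N v / f v) * f w" if w: "w \<in> E_space n N" for w
  proof -
    let ?w = "w - fscale (h N w / h N v) v"
    have "?w \<in> E_space n N" using w v unfolding E_space_def
      by (intro fun_vs.span_diff fun_vs.span_scale)
    moreover have "h N ?w = 0" using hv by (simp only: linear_form_diff[OF hl] linear_form_scale[OF hl]) simp
    ultimately have "f ?w = 0" by (rule ker)
    then have "f w = h N w / h N v * f v"
      by (simp only: linear_form_diff[OF f_linear] linear_form_scale[OF f_linear]) simp
    then show ?thesis using hv v by (simp add: field_simps)
  qed
  have "h N v / f v \<noteq> 0" using hv v(2) by simp
  with hw show ?thesis by blast
qed

lemma F_skew: "i \<le> N \<Longrightarrow> F (N - i) = - F i"
  using linear_form_skew[OF f_linear, of "N - i" i] by (simp add: F_def)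

lemma e_nonzero: "i < j \<Longrightarrow> e i j \<noteq> 0"
proof -
  assume "i < j"
  then have "e i j (i, j) \<noteq> 0" by (simp add: wedge_def basis_vec_def)
  then show ?thesis by (auto dest: fun_cong)
qed

text \<open>Were \<open>F i\<close> zero, \<open>h N\<close> would vanish on the bivector of
  \<open>i\<close> and \<open>N - i\<close>, which would then be a nonzero decomposable element of
  W. This is the nondegeneracy of \<open>f\<close>.\<close>

lemma F_nz: "i \<le> N \<Longrightarrow> F i \<noteq> 0"
proof -
  have lt: "F i \<noteq> 0" if "i < N - i" for i
  proof
    assume "F i = 0"
    obtain c where c: "\<forall>w\<in>E_space n N. h N w = c * f w" using h_prop_f by blast
    have E: "e i (N - i) \<in> E_space n N" using e_in_E[of i "N - i"] that by simp
    with c \<open>F i = 0\<close> have "h N (e i (N - i)) = 0" by (simp add: F_def)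
    with E h_kernel[OF N_range] have "e i (N - i) \<in> W" by blast
    moreover have "decomposable n (e i (N - i))"
      unfolding decomposable_def using that
      by (intro bexI[of _ "basis_vec i"] bexI[of _ "basis_vec (N - i)"]) (auto simp: V_space_def basis_vec_def)
    ultimately show False using W_indecomposable e_nonzero[OF that] by blast
  qed
  assume "i \<le> N"
  show "F i \<noteq> 0"
  proof (cases "i < N - i")
    case False
    then have "N - i < N - (N - i)" using \<open>i \<le> N\<close> by presburger
    from lt[OF this] F_skew[OF \<open>i \<le> N\<close>] show ?thesis by simp
  qed (rule lt)
qed

section \<open>The polynomial matrices \<open>rp\<close> and \<open>Bp\<close>\<close>

lemma rp_eq: "j \<le> N \<Longrightarrow> rp j = cst (F (N - j)) * g (N - j)"
proof -
  assume j: "j \<le> N"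
  have "rp j = (\<Sum>i\<in>{N - j}. cst (f (e i j)) * g i)"
    unfolding rp_def
  proof (rule sum.mono_neutral_right)
    show "\<forall>i\<in>{..N} - {N - j}. cst (f (e i j)) * g i = 0"
    proof
      fix i assume "i \<in> {..N} - {N - j}"
      then have "i \<le> N" "i + j \<noteq> N" by auto
      then show "cst (f (e i j)) * g i = 0" using f_e_zero j by simp
    qed
  qed auto
  then show ?thesis using j by (simp add: F_def)
qed

lemma Bp_eq: "Bp k j = (if j \<le> k \<and> k - j \<le> N then cst (h k (e (k - j) j)) * g (k - j) else 0)"
proof -
  have "{i. i \<le> N \<and> i + j = k} = (if j \<le> k \<and> k - j \<le> N then {k - j} else {})" by auto
  then show ?thesis by (simp add: Bp_def)
qed

text \<open>In the omitted summand the class modulo W is read off by \<open>f\<close>, so its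
  vanishing is the condition r = 0 on the fibres.\<close>

lemma Bp_N: "\<exists>c. c \<noteq> 0 \<and> (\<forall>j\<le>N. Bp N j = cst c * rp j)"
proof -
  obtain c where c: "c \<noteq> 0" "\<forall>w\<in>E_space n N. h N w = c * f w" using h_prop_f by blast
  have "Bp N j = cst c * rp j" if "j \<le> N" for j
    using c(2) e_in_E[of "N - j" j] that by (simp add: Bp_eq rp_eq F_def cst_mult mult.assoc)
  with c(1) show ?thesis by blast
qed

text \<open>The wedge of a vector with itself vanishes: exchanging \<open>i\<close> and
  \<open>j\<close> changes the sign of every term, so the double sum equals its negative.\<close>

lemma Bp_g: "k \<in> {1..4*n+1} \<Longrightarrow> (\<Sum>j\<le>N. Bp k j * g j) = 0"
proof -
  assume k: "k \<in> {1..4*n+1}"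
  define X where "X = (\<Sum>j\<le>N. \<Sum>i\<le>N. if i + j = k then cst (h k (e i j)) * g i * g j else 0)"
  have X: "(\<Sum>j\<le>N. Bp k j * g j) = X"
    unfolding X_def
  proof (intro sum.cong refl)
    fix j
    have "(\<Sum>i\<le>N. if i + j = k then cst (h k (e i j)) * g i * g j else 0) =
        (\<Sum>i\<in>{i. i \<le> N \<and> i + j = k}. cst (h k (e i j)) * g i * g j)"
      by (rule sum.mono_neutral_cong_right) auto
    then show "Bp k j * g j = (\<Sum>i\<le>N. if i + j = k then cst (h k (e i j)) * g i * g j else 0)"
      by (simp add: Bp_def sum_distrib_right)
  qed
  have skew: "cst (h k (e j i)) * g j * g i = - (cst (h k (e i j)) * g i * g j)" for i j
    unfolding linear_form_skew[OF h_linear[OF k], of j i] cst_uminus by (simp add: mult_ac)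
  have "X = (\<Sum>i\<le>N. \<Sum>j\<le>N. if i + j = k then cst (h k (e i j)) * g i * g j else 0)"
    unfolding X_def by (rule sum.swap)
  also have "\<dots> = (\<Sum>i\<le>N. \<Sum>j\<le>N. - (if j + i = k then cst (h k (e j i)) * g j * g i else 0))"
  proof (intro sum.cong refl)
    fix i j
    show "(if i + j = k then cst (h k (e i j)) * g i * g j else 0) =
        - (if j + i = k then cst (h k (e j i)) * g j * g i else 0)"
      using skew[of i j] by (simp add: add.commute[of j i])
  qed
  also have "\<dots> = - X" by (simp add: X_def sum_negf)
  finally have "X = 0" unfolding cpoly_eq_uminus_iff .
  with X show ?thesis by simp
qed

lemma rp_g: "(\<Sum>j\<le>N. rp j * g j) = 0"
proof -
  obtain c where c: "c \<noteq> 0" "\<forall>j\<le>N. Bp N j = cst c * rp j" using Bp_N by blast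
  have "cst c * (\<Sum>j\<le>N. rp j * g j) = (\<Sum>j\<le>N. Bp N j * g j)"
    unfolding sum_distrib_left using c(2) by (intro sum.cong) (auto simp: mult.assoc)
  also have "\<dots> = 0" by (rule Bp_g[OF N_range])
  finally have z: "cst c * (\<Sum>j\<le>N. rp j * g j) = 0" .
  have "cst (1 / c) * cst c = 1" unfolding cst_mult[symmetric] using c(1) by simp
  then have "(\<Sum>j\<le>N. rp j * g j) = cst (1 / c) * cst c * (\<Sum>j\<le>N. rp j * g j)" by simp
  also have "\<dots> = 0" by (simp only: mult.assoc z mult_zero_right)
  finally show ?thesis .
qed

lemma finite_K1 [simp]: "finite (K1 n)"
  by (simp add: K1_def)

lemma card_K1: "card (K1 n) = 4 * n"
  by (simp add: K1_def)

text \<open>\<open>H\<close> stands for evaluation at a point and for the embedding into the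
  rational functions, so one proof covers both kinds of fibre.\<close>

lemma fibre_hom:
  fixes H :: "cpoly \<Rightarrow> 'a::field"
  assumes "comm_ring_hom H" "m \<le> N" "H (g m) \<noteq> 0"
  shows "symplectic_fibre N (\<lambda>i. H (cst (F i))) (\<lambda>i. H (g i)) (K1 n) (\<lambda>k j. H (Bp k j)) m"
proof -
  interpret H: comm_ring_hom H by fact
  show ?thesis
  proof
    show "H (cst (F i)) \<noteq> 0" if "i \<le> N" for i
    proof
      assume "H (cst (F i)) = 0"
      then have "H (cst (F i) * cst (1 / F i)) = 0" by (simp only: H.hom_mult mult_zero_left)
      moreover have "cst (F i) * cst (1 / F i) = 1"
        unfolding cst_mult[symmetric] using F_nz[OF that] by simp
      ultimately show False by simp
    qed
    show "H (cst (F (N - i))) = - H (cst (F i))" if "i \<le> N" for i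
      using F_skew[OF that] by (simp add: cst_uminus H.hom_uminus)
    show "(\<Sum>j\<le>N. H (Bp k j) * H (g j)) = 0" if "k \<in> K1 n" for k
      using arg_cong[OF Bp_g[of k], of H] that by (simp add: K1_def hom_distribs)
    have "(\<Sum>j\<le>N. cst (F (N - j)) * g (N - j) * g j) = 0"
      using rp_g by (simp add: rp_eq)
    from arg_cong[OF this, of H]
    show "(\<Sum>j\<le>N. H (cst (F (N - j))) * H (g (N - j)) * H (g j)) = 0" by (simp add: hom_distribs)
  qed (use assms in auto)
qed

lemma fibre_M:
  fixes H :: "cpoly \<Rightarrow> 'a::field"
  assumes "comm_ring_hom H" "m \<le> N" "H (g m) \<noteq> 0"
  shows "H (Mp k l) = symplectic_fibre.M N (\<lambda>i. H (cst (F i))) (\<lambda>k j. H (Bp k j)) k l"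
proof -
  interpret H: comm_ring_hom H by fact
  interpret symplectic_fibre N "\<lambda>i. H (cst (F i))" "\<lambda>i. H (g i)" "K1 n" "\<lambda>k j. H (Bp k j)" m
    by (rule fibre_hom[OF assms])
  have inv: "H (cst (1 / F i)) = 1 / H (cst (F i))" if "i \<le> N" for i
  proof -
    have "H (cst (1 / F i)) * H (cst (F i)) = H (cst (1 / F i * F i))" by (simp only: cst_mult H.hom_mult)
    also have "\<dots> = 1" using \<open>i \<le> N\<close> instanton_data.F_nz[OF instanton_data_axioms that] by simp
    finally show ?thesis using F_nz[OF that] by (simp add: field_simps)
  qed
  show ?thesis
    unfolding Mp_def M_def by (simp add: hom_distribs inv)
qed

text \<open>\<open>P k\<close> is the component in \<open>E_space n k\<close> of the wedge of the
  values of \<open>g\<close> with \<open>s\<close>. All components lie in W, the one at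
  \<open>N\<close> by the condition on \<open>rp\<close>; so the wedge lies in W and is zero, which
  makes \<open>s\<close> proportional to the values of \<open>g\<close>.\<close>

lemma nondegenerate:
  assumes y: "y \<in> cone_pts N" and B: "\<And>k. k \<in> K1 n \<Longrightarrow> (\<Sum>j\<le>N. peval (Bp k j) y * s j) = 0"
    and r: "(\<Sum>j\<le>N. peval (rp j) y * s j) = 0"
  shows "\<exists>c. \<forall>j\<le>N. s j = c * peval (g j) y"
proof -
  \<comment> \<open>Truncation above \<open>N\<close> puts both vectors into
    \<open>V_space n\<close>.\<close>
  define G where "G i = (if i \<le> N then peval (g i) y else 0)" for i
  define s' where "s' i = (if i \<le> N then s i else 0)" for i
  have B': "(\<Sum>j\<le>N. peval (Bp k j) y * s j) = 0" if k: "k \<in> {1..4*n+1}" for k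
  proof (cases "k = N")
    case True
    obtain c where c: "\<forall>j\<le>N. Bp N j = cst c * rp j" using Bp_N by blast
    have "(\<Sum>j\<le>N. peval (Bp N j) y * s j) = c * (\<Sum>j\<le>N. peval (rp j) y * s j)"
      using c by (simp add: peval_mult sum_distrib_left mult.assoc)
    with r True show ?thesis by simp
  next
    case False
    with k B show ?thesis by (simp add: K1_def)
  qed
  define P where "P k = (\<Sum>j\<le>N. if j \<le> k \<and> k - j \<le> N then fscale (G (k - j) * s j) (e (k - j) j) else 0)" for k
  have P_W: "P k \<in> W" if k: "k \<in> {1..4*n+1}" for k
  proof -
    note hl = h_linear[OF k]
    have "P k \<in> E_space n k"
      unfolding P_def E_space_def
    proof (intro fun_vs.span_sum)
      fix j assume j: "j \<in> {..N}"
      show "(if j \<le> k \<and> k - j \<le> N then fscale (G (k - j) * s j) (e (k - j) j) else 0) \<in>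
          fun_vs.span {e p q |p q. p < q \<and> q \<le> 2*n+1 \<and> p + q = k}"
        using e_in_E[of "k - j" j] j by (auto simp: E_space_def intro!: fun_vs.span_scale fun_vs.span_zero)
    qed
    moreover have "h k (P k) = (\<Sum>j\<le>N. peval (Bp k j) y * s j)"
      unfolding P_def linear_form_sum[OF hl]
      by (intro sum.cong refl) (auto simp: Bp_eq linear_form_scale[OF hl] linear_form_0[OF hl] peval_mult G_def)
    ultimately show ?thesis using B'[OF k] h_kernel[OF k] by auto
  qed
  have P_apply: "P k (p, q) = (if p < q \<and> q \<le> N \<and> p + q = k then G p * s' q - G q * s' p else 0)" for k p q
  proof -
    have "P k (p, q) = (\<Sum>j\<le>N. if j \<le> k \<and> k - j \<le> N then G (k - j) * s j * e (k - j) j (p, q) else 0)"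
      unfolding P_def sum_apply by (intro sum.cong refl) (auto simp: fscale_def)
    also have "\<dots> = (\<Sum>j\<le>N. (if j = q \<and> p < q \<and> p + q = k then G p * s' q else 0) -
        (if j = p \<and> p < q \<and> q \<le> N \<and> p + q = k then G q * s' p else 0))"
      by (intro sum.cong refl) (auto simp: wedge_def basis_vec_def s'_def)
    also have "\<dots> = (if p < q \<and> q \<le> N \<and> p + q = k then G p * s' q - G q * s' p else 0)"
    proof -
      have "(\<Sum>j\<le>N. if j = q \<and> p < q \<and> p + q = k then G p * s' q else 0) =
          (if p < q \<and> q \<le> N \<and> p + q = k then G p * s' q else 0)"
        by (auto simp: sum.delta' intro!: sum.neutral)
      moreover have "(\<Sum>j\<le>N. if j = p \<and> p < q \<and> q \<le> N \<and> p + q = k then G q * s' p else 0) =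
          (if p < q \<and> q \<le> N \<and> p + q = k then G q * s' p else 0)"
        by (auto simp: sum.delta' intro!: sum.neutral)
      ultimately show ?thesis by (simp add: sum_subtractf)
    qed
    finally show ?thesis .
  qed
  have "wedge G s' = (\<Sum>k\<in>{1..4*n+1}. P k)"
  proof
    fix pq :: "nat \<times> nat"
    obtain p q where pq: "pq = (p, q)" by force
    have "(\<Sum>k\<in>{1..4*n+1}. P k) (p, q) =
        (\<Sum>k\<in>{1..4*n+1}. if k = p + q then (if p < q \<and> q \<le> N then G p * s' q - G q * s' p else 0) else 0)"
      unfolding sum_apply by (intro sum.cong refl) (auto simp: P_apply)
    also have "\<dots> = (if p < q \<and> q \<le> N then G p * s' q - G q * s' p else 0)"
      by (subst sum.delta) auto
    also have "\<dots> = wedge G s' (p, q)" by (auto simp: wedge_def G_def s'_def)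
    finally show "wedge G s' pq = (\<Sum>k\<in>{1..4*n+1}. P k) pq" unfolding pq by simp
  qed
  also have "\<dots> \<in> W" by (rule fun_vs.subspace_sum[OF W_subspace]) (rule P_W)
  finally have "wedge G s' \<in> W" .
  moreover have "decomposable n (wedge G s')"
    unfolding decomposable_def by (intro bexI[of _ G] bexI[of _ s'] refl) (auto simp: V_space_def G_def s'_def)
  ultimately have "wedge G s' = 0" by (rule W_indecomposable)
  then have w: "G p * s' q = G q * s' p" if "p < q" for p q
    using fun_cong[of _ _ "(p, q)"] that by (fastforce simp: wedge_def)
  have w': "G p * s' q = G q * s' p" for p q
    using w[of p q] w[of q p] by (cases p q rule: linorder_cases) auto
  obtain m where m: "m \<le> N" "peval (g m) y \<noteq> 0" using g_no_common_zero[OF y] by blast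
  have "s j = s m / peval (g m) y * peval (g j) y" if "j \<le> N" for j
    using w'[of m j] m that by (simp add: G_def s'_def field_simps)
  then show ?thesis by blast
qed

end

context instanton_data
begin

subsection \<open>Degrees\<close>

lemma S_deg_antidiagonal: "j \<le> N \<Longrightarrow> S_deg n \<alpha> \<beta> j + S_deg n \<alpha> \<beta> (N - j) = (2 * int n + 1) * (\<alpha> + \<beta>)"
  by (simp add: S_deg_def of_nat_diff algebra_simps)

lemma E_deg_add: "E_deg n \<alpha> \<beta> (i + j) = S_deg n \<alpha> \<beta> i + S_deg n \<alpha> \<beta> j"
  by (simp add: E_deg_def S_deg_def algebra_simps)

lemma Bp_form: "is_form N (\<gamma> + E_deg n \<alpha> \<beta> k - S_deg n \<alpha> \<beta> j) (Bp k j)"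
proof (cases "j \<le> k \<and> k - j \<le> N")
  case True
  then have "is_form N (0 + (\<gamma> + S_deg n \<alpha> \<beta> (k - j))) (Bp k j)"
    unfolding Bp_eq if_P[OF True] by (intro is_form_mult is_form_cst g_forms) auto
  moreover have "E_deg n \<alpha> \<beta> k = S_deg n \<alpha> \<beta> (k - j) + S_deg n \<alpha> \<beta> j"
    using True by (simp flip: E_deg_add)
  ultimately show ?thesis by simp
next
  case False
  show ?thesis unfolding Bp_eq if_not_P[OF False] by (rule is_form_0)
qed

lemma rp_form: "j \<le> N \<Longrightarrow> is_form N (\<gamma> + (2 * int n + 1) * (\<alpha> + \<beta>) - S_deg n \<alpha> \<beta> j) (rp j)"
proof -
  assume j: "j \<le> N"
  then have "is_form N (0 + (\<gamma> + S_deg n \<alpha> \<beta> (N - j))) (rp j)"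
    unfolding rp_eq[OF j] by (intro is_form_mult is_form_cst g_forms) auto
  moreover have "0 + (\<gamma> + S_deg n \<alpha> \<beta> (N - j)) = \<gamma> + (2 * int n + 1) * (\<alpha> + \<beta>) - S_deg n \<alpha> \<beta> j"
    using S_deg_antidiagonal[OF j] by linarith
  ultimately show ?thesis by (simp only:)
qed

text \<open>The factor of \<open>Mp\<close> that is applied first. It maps the source of \<phi> to
  the twisted sum of the \<open>S_deg\<close> line bundles, whose image under \<open>Bp\<close> is
  divided out in F(\<gamma>).\<close>

definition "Sp j l = cst (1 / F (N - j)) * Bp l (N - j)"

lemma Mp_eq: "Mp k l = (\<Sum>j\<le>N. Bp k j * Sp j l)"
  by (simp add: Mp_def Sp_def mult.assoc)

text \<open>The origin of \<open>hbar1\<close>: the two degree formulas agree exactly when the twist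
  is 2\<gamma> minus the degree sum of an antidiagonal pair.\<close>

lemma Sp_form: "j \<le> N \<Longrightarrow> is_form N (S_deg n \<alpha> \<beta> j + - \<gamma> - dual_deg n \<alpha> \<beta> \<gamma> l) (Sp j l)"
proof -
  assume j: "j \<le> N"
  have "is_form N (0 + (\<gamma> + E_deg n \<alpha> \<beta> l - S_deg n \<alpha> \<beta> (N - j))) (Sp j l)"
    unfolding Sp_def by (intro is_form_mult is_form_cst Bp_form)
  moreover have "0 + (\<gamma> + E_deg n \<alpha> \<beta> l - S_deg n \<alpha> \<beta> (N - j)) =
      S_deg n \<alpha> \<beta> j + - \<gamma> - dual_deg n \<alpha> \<beta> \<gamma> l"
    using S_deg_antidiagonal[OF j] unfolding dual_deg_def hbar1_def by linarith
  ultimately show ?thesis by (simp only:)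
qed

lemma Mp_form: "is_form N (E_deg n \<alpha> \<beta> k - dual_deg n \<alpha> \<beta> \<gamma> l) (Mp k l)"
  unfolding Mp_eq
proof (intro is_form_sum)
  fix j assume "j \<in> {..N}"
  then show "is_form N (E_deg n \<alpha> \<beta> k - dual_deg n \<alpha> \<beta> \<gamma> l) (Bp k j * Sp j l)"
    by (intro is_form_mult'[OF Bp_form Sp_form]) auto
qed

lemma sum_S_deg: "(\<Sum>j\<le>N. S_deg n \<alpha> \<beta> j) = (int n + 1) * ((2 * int n + 1) * (\<alpha> + \<beta>))"
proof -
  have "2 * (\<Sum>j\<le>N. S_deg n \<alpha> \<beta> j) = (\<Sum>j\<le>N. S_deg n \<alpha> \<beta> j) + (\<Sum>j\<le>N. S_deg n \<alpha> \<beta> (N - j))"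
    unfolding sum_antidiagonal[of "S_deg n \<alpha> \<beta>" N] by simp
  also have "\<dots> = (\<Sum>j\<le>N. (2 * int n + 1) * (\<alpha> + \<beta>))"
    unfolding sum.distrib[symmetric] by (intro sum.cong refl S_deg_antidiagonal) auto
  also have "\<dots> = 2 * ((int n + 1) * ((2 * int n + 1) * (\<alpha> + \<beta>)))" by (simp add: algebra_simps)
  finally show ?thesis by simp
qed

lemma sum_E_deg: "(\<Sum>k\<in>K1 n. E_deg n \<alpha> \<beta> k) = 4 * int n * ((2 * int n + 1) * (\<alpha> + \<beta>))"
proof -
  \<comment> \<open>The reflection preserves \<open>K1 n\<close>, since the missing index 2n+1 is
    its fixed point, and each \<open>k\<close> has a constant degree sum with its
    reflection.\<close>
  have "(\<Sum>k\<in>K1 n. E_deg n \<alpha> \<beta> (4*n+2 - k)) = (\<Sum>k\<in>K1 n. E_deg n \<alpha> \<beta> k)"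
    by (rule sum.reindex_bij_witness[of _ "\<lambda>k. 4*n+2 - k" "\<lambda>k. 4*n+2 - k"]) (auto simp: K1_def)
  then have "2 * (\<Sum>k\<in>K1 n. E_deg n \<alpha> \<beta> k) = (\<Sum>k\<in>K1 n. E_deg n \<alpha> \<beta> k + E_deg n \<alpha> \<beta> (4*n+2 - k))"
    by (simp add: sum.distrib)
  also have "\<dots> = (\<Sum>k\<in>K1 n. 2 * ((2 * int n + 1) * (\<alpha> + \<beta>)))"
    by (intro sum.cong refl) (auto simp: K1_def E_deg_def of_nat_diff algebra_simps)
  also have "\<dots> = 2 * (4 * int n * ((2 * int n + 1) * (\<alpha> + \<beta>)))" by (simp add: card_K1)
  finally show ?thesis by simp
qed

lemma ext_indexD:
  assumes "J \<in> ext_index n"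
  shows "J \<subseteq> K1 n" "finite J" "card (K1 n - J) = N" "bij_betw (\<rho> J) {..<N} (K1 n - J)"
proof -
  show J: "J \<subseteq> K1 n" using assms by (simp add: ext_index_def)
  then show "finite J" using finite_K1 finite_subset by blast
  have "card J = 2*n - 1" using assms by (simp add: ext_index_def)
  then show card: "card (K1 n - J) = N"
    using card_Diff_subset[OF \<open>finite J\<close> J] n_pos by (simp add: card_K1)
  have "bij_betw ((!) (sorted_list_of_set (K1 n - J))) {..<N} (K1 n - J)"
    by (rule bij_betw_nth) (use card in auto)
  then show "bij_betw (\<rho> J) {..<N} (K1 n - J)" by (simp add: \<rho>_def[abs_def])
qed

lemma finite_ext_index: "finite (ext_index n)"
proof (rule finite_subset)
  show "ext_index n \<subseteq> Pow (K1 n)" by (auto simp: ext_index_def)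
qed simp

text \<open>The origin of \<open>hbar2\<close>. With D = (2n+1)(\<alpha>+\<beta>), the 2n+2 columns
  of \<open>Bp\<close> contribute (2n+2)\<gamma> - (n+1)D, removing a pair takes away 2\<gamma> - D,
  and the degrees over all of \<open>K1 n\<close> add 4nD; together 2n\<gamma> + 3nD.\<close>

lemma Pp_form:
  assumes J: "J \<in> ext_index n" and k: "k \<in> K1 n"
  shows "is_form N (ext_deg n \<alpha> \<beta> \<gamma> J - E_deg n \<alpha> \<beta> k) (Pp J k)"
  unfolding Pp_def psi_def
proof (intro is_form_sum)
  fix i assume "i \<in> {..N}"
  then have i: "i \<le> N" "N - i \<noteq> i" by (auto, presburger)
  \<comment> \<open>Row degrees \<open>es\<close> and column degrees \<open>ds\<close> of the
    determinant. Columns \<open>N\<close> and \<open>N + 1\<close> take the degrees of the rows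
    \<open>i\<close> and \<open>N - i\<close>, so that the entries 1 of the unit rows have degree
    0.\<close>
  define es where "es j = (if j \<le> N then \<gamma> - S_deg n \<alpha> \<beta> j else - E_deg n \<alpha> \<beta> k)" for j
  define ds where "ds p = (if p = N then es i else if p = Suc N then es (N - i) else - E_deg n \<alpha> \<beta> (\<rho> J p))" for p
  have form: "is_form N ((\<Sum>j<N+2. es j) - (\<Sum>p<N+2. ds p)) (psi_term N Bp (\<rho> J) (\<lambda>l. if l = k then 1 else 0) i)"
    unfolding psi_term_def alt_def
  proof (rule is_form_det)
    fix j p assume "j < N + 2" "p < N + 2"
    show "is_form N (es j - ds p)
        (((psi_rows N Bp (\<rho> J) (\<lambda>l. if l = k then 1 else 0))(i := unit_row N, N - i := unit_row (Suc N))) j p)"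
      using i Bp_form[of "\<rho> J p" j]
      by (auto simp: es_def ds_def psi_rows_def unit_row_def algebra_simps)
  qed
  have "{..<N+2} = insert (Suc N) {..N}" by auto
  then have e: "(\<Sum>j<N+2. es j) = (\<Sum>j\<le>N. \<gamma> - S_deg n \<alpha> \<beta> j) - E_deg n \<alpha> \<beta> k"
    by (simp add: es_def)
  have "{..<N+2} = insert (Suc N) (insert N {..<N})" by auto
  then have "(\<Sum>p<N+2. ds p) = es (N - i) + es i + (\<Sum>p<N. - E_deg n \<alpha> \<beta> (\<rho> J p))"
    by (simp add: ds_def)
  also have "(\<Sum>p<N. - E_deg n \<alpha> \<beta> (\<rho> J p)) = (\<Sum>l\<in>K1 n - J. - E_deg n \<alpha> \<beta> l)"
    by (rule sum.reindex_bij_betw[OF ext_indexD(4)[OF J]])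
  also have "\<dots> = - ((\<Sum>l\<in>K1 n. E_deg n \<alpha> \<beta> l) - (\<Sum>l\<in>J. E_deg n \<alpha> \<beta> l))"
    using ext_indexD(1,2)[OF J] by (simp add: sum_negf sum_diff)
  finally have d: "(\<Sum>p<N+2. ds p) = es (N - i) + es i - (\<Sum>l\<in>K1 n. E_deg n \<alpha> \<beta> l) + (\<Sum>l\<in>J. E_deg n \<alpha> \<beta> l)"
    by simp
  have "(\<Sum>j<N+2. es j) - (\<Sum>p<N+2. ds p) = ext_deg n \<alpha> \<beta> \<gamma> J - E_deg n \<alpha> \<beta> k"
  proof -
    have "(\<Sum>j\<le>N. \<gamma> - S_deg n \<alpha> \<beta> j) =
        (2 * int n + 2) * \<gamma> - (int n + 1) * ((2 * int n + 1) * (\<alpha> + \<beta>))"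
      unfolding sum_subtractf sum_S_deg by simp
    moreover have "es (N - i) + es i = 2 * \<gamma> - (2 * int n + 1) * (\<alpha> + \<beta>)"
      using S_deg_antidiagonal[OF i(1)] i(1) by (simp add: es_def)
    ultimately show ?thesis
      unfolding e d sum_E_deg ext_deg_def hbar2_def by (simp add: sum_negf algebra_simps)
  qed
  with form show "is_form N (ext_deg n \<alpha> \<beta> \<gamma> J - E_deg n \<alpha> \<beta> k)
      (cst (F i) * psi_term N Bp (\<rho> J) (\<lambda>l. if l = k then 1 else 0) i)"
    by (intro is_form_mult'[OF is_form_cst]) auto
qed

lemma g_matrix: "form_matrix N {..N} (\<lambda>j. S_deg n \<alpha> \<beta> j + - \<gamma>) {()} (\<lambda>_. - \<gamma> + - \<gamma>) (\<lambda>i _. g i)"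
  using g_forms by (simp add: form_matrix_def add.commute)

lemma r_matrix: "form_matrix N {()} (\<lambda>_. \<gamma> + (2 * int n + 1) * (\<alpha> + \<beta>) + - \<gamma>) {..N} (\<lambda>j. S_deg n \<alpha> \<beta> j + - \<gamma>) (\<lambda>_ j. rp j)"
  using rp_form by (simp add: form_matrix_def algebra_simps)

lemma B_matrix: "form_matrix N K (E_deg n \<alpha> \<beta>) {..N} (\<lambda>j. S_deg n \<alpha> \<beta> j + - \<gamma>) Bp"
  using Bp_form by (simp add: form_matrix_def algebra_simps)

lemma S_matrix: "form_matrix N {..N} (\<lambda>j. S_deg n \<alpha> \<beta> j + - \<gamma>) (K1 n) (dual_deg n \<alpha> \<beta> \<gamma>) Sp"
  using Sp_form by (simp add: form_matrix_def)

lemma M_matrix: "form_matrix N (K1 n) (E_deg n \<alpha> \<beta>) (K1 n) (dual_deg n \<alpha> \<beta> \<gamma>) Mp"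
  using Mp_form by (simp add: form_matrix_def)

lemma P_matrix: "form_matrix N (ext_index n) (ext_deg n \<alpha> \<beta> \<gamma>) (K1 n) (E_deg n \<alpha> \<beta>) Pp"
  using Pp_form by (simp add: form_matrix_def)

subsection \<open>Exactness in the fibres\<close>

lemma Pp_apply:
  fixes H :: "cpoly \<Rightarrow> 'a::field"
  assumes "comm_ring_hom H"
  shows "(\<Sum>k\<in>K1 n. H (Pp J k) * t k) = psi N (\<lambda>i. H (cst (F i))) (\<lambda>k j. H (Bp k j)) (\<rho> J)
    (\<lambda>l. \<Sum>k\<in>K1 n. t k * (if l = k then 1 else 0))"
proof -
  interpret H: comm_ring_hom H by fact
  have "H (Pp J k) = psi N (\<lambda>i. H (cst (F i))) (\<lambda>k j. H (Bp k j)) (\<rho> J) (\<lambda>l. if l = k then 1 else 0)" for k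
    unfolding Pp_def H.hom_psi by (simp add: if_distrib cong: if_cong)
  then show ?thesis unfolding psi_linear[OF finite_K1] by (simp add: mult.commute)
qed

text \<open>At points this gives the complex, over the rational functions the upper bound on the
  rank of \<open>Pp\<close>.\<close>

lemma Pp_Mp:
  fixes H :: "cpoly \<Rightarrow> 'a::field"
  assumes H: "comm_ring_hom H" "m \<le> N" "H (g m) \<noteq> 0" and J: "J \<in> ext_index n"
  shows "(\<Sum>k\<in>K1 n. H (Pp J k) * (\<Sum>l\<in>K1 n. H (Mp k l) * z l)) = 0"
proof -
  interpret fb: symplectic_fibre N "\<lambda>i. H (cst (F i))" "\<lambda>i. H (g i)" "K1 n" "\<lambda>k j. H (Bp k j)" m
    by (rule fibre_hom[OF H])
  obtain p where p: "\<forall>k\<in>K1 n. (\<Sum>l\<in>K1 n. fb.M k l * z l) = (\<Sum>j\<in>fb.L. fb.w k j * p j)"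
    using fb.M_in_span_w by blast
  show ?thesis
    unfolding Pp_apply[OF H(1)] fibre_M[OF H]
  proof (rule fb.psi_zero)
    show "\<rho> J q \<in> K1 n" if "q < N" for q
      using bij_betw_apply[OF ext_indexD(4)[OF J], of q] that by auto
    show "(\<Sum>k'\<in>K1 n. (\<Sum>l\<in>K1 n. fb.M k' l * z l) * (if k = k' then 1 else 0)) = (\<Sum>j\<in>fb.L. fb.w k j * p j)"
      if k: "k \<in> K1 n" for k
    proof -
      have "(\<Sum>k'\<in>K1 n. (\<Sum>l\<in>K1 n. fb.M k' l * z l) * (if k = k' then 1 else 0)) =
          (\<Sum>k'\<in>K1 n. if k' = k then \<Sum>l\<in>K1 n. fb.M k l * z l else 0)"
        by (intro sum.cong) auto
      then show ?thesis using k p by (simp add: sum.delta)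
    qed
  qed
qed

text \<open>The fibre of the kernel of \<iota>, taken as the range of \<open>Mp\<close>;
  \<open>fibre_exactness\<close> identifies it with the image under B of the kernel of r and with
  the kernel of \<psi>.\<close>

definition in_N :: "pt \<Rightarrow> (nat \<Rightarrow> complex) \<Rightarrow> bool" where
  "in_N y t \<longleftrightarrow> (\<exists>z. \<forall>k\<in>K1 n. t k = (\<Sum>l\<in>K1 n. peval (Mp k l) y * z l))"

lemma fibre_exactness:
  assumes y: "y \<in> cone_pts N"
  shows in_N_iff_B: "in_N y t \<longleftrightarrow>
      (\<exists>s. (\<forall>k\<in>K1 n. t k = (\<Sum>j\<le>N. peval (Bp k j) y * s j)) \<and> (\<Sum>j\<le>N. peval (rp j) y * s j) = 0)"
    and in_N_iff_P: "in_N y t \<longleftrightarrow> (\<forall>J\<in>ext_index n. (\<Sum>k\<in>K1 n. peval (Pp J k) y * t k) = 0)"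
    and in_N_basis: "\<exists>L w. finite L \<and> card L = 2*n \<and> indep_cols (K1 n) (L :: nat set) w \<and>
      (\<forall>t. in_N y t \<longleftrightarrow> (\<exists>p. \<forall>k\<in>K1 n. t k = (\<Sum>l\<in>L. w k l * p l)))"
proof -
  obtain m where m: "m \<le> N" "peval (g m) y \<noteq> 0" using g_no_common_zero[OF y] by blast
  note H = peval_hom[of y] m
  interpret fb: symplectic_fibre N "\<lambda>i. peval (cst (F i)) y" "\<lambda>i. peval (g i) y" "K1 n" "\<lambda>k j. peval (Bp k j) y" m
    by (rule fibre_hom[OF H])
  have M: "peval (Mp k l) y = fb.M k l" for k l by (rule fibre_M[OF H])
  have r: "(\<Sum>j\<le>N. peval (rp j) y * s j) = (\<Sum>j\<le>N. fb.r j * s j)" for s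
    by (intro sum.cong refl, unfold fb.r_def) (simp add: rp_eq peval_mult)
  have nondeg: "\<exists>c. \<forall>j\<le>N. s j = c * peval (g j) y"
    if "\<And>k. k \<in> K1 n \<Longrightarrow> (\<Sum>j\<le>N. peval (Bp k j) y * s j) = 0" "(\<Sum>j\<le>N. fb.r j * s j) = 0" for s
    by (rule nondegenerate[OF y, unfolded r]) (use that in auto)
  show B: "in_N y t \<longleftrightarrow>
      (\<exists>s. (\<forall>k\<in>K1 n. t k = (\<Sum>j\<le>N. peval (Bp k j) y * s j)) \<and> (\<Sum>j\<le>N. peval (rp j) y * s j) = 0)" for t
  proof
    assume "in_N y t"
    then obtain z where z: "\<forall>k\<in>K1 n. t k = (\<Sum>l\<in>K1 n. fb.M k l * z l)" unfolding in_N_def M by blast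
    show "\<exists>s. (\<forall>k\<in>K1 n. t k = (\<Sum>j\<le>N. peval (Bp k j) y * s j)) \<and> (\<Sum>j\<le>N. peval (rp j) y * s j) = 0"
      unfolding r
    proof (intro exI conjI ballI)
      show "t k = (\<Sum>j\<le>N. peval (Bp k j) y * ((\<Sum>l\<in>K1 n. peval (Bp l (N - j)) y * z l) / peval (cst (F (N - j))) y))"
        if "k \<in> K1 n" for k
        unfolding bspec[OF z that] by (rule fb.M_factor(1)[OF finite_K1])
    qed (rule fb.M_factor(2)[OF finite_K1 order_refl])
  next
    assume "\<exists>s. (\<forall>k\<in>K1 n. t k = (\<Sum>j\<le>N. peval (Bp k j) y * s j)) \<and> (\<Sum>j\<le>N. peval (rp j) y * s j) = 0"
    then obtain s where s: "\<forall>k\<in>K1 n. t k = (\<Sum>j\<le>N. peval (Bp k j) y * s j)" "(\<Sum>j\<le>N. fb.r j * s j) = 0"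
      unfolding r by blast
    obtain z where "\<forall>k\<in>K1 n. (\<Sum>j\<le>N. peval (Bp k j) y * s j) = (\<Sum>l\<in>K1 n. fb.M k l * z l)"
      using fb.image_in_range_M[OF nondeg s(2)] by blast
    with s(1) show "in_N y t" unfolding in_N_def M by (intro exI[of _ z]) simp
  qed
  have span: "in_N y t \<longleftrightarrow> (\<exists>p. \<forall>k\<in>K1 n. t k = (\<Sum>l\<in>fb.L. fb.w k l * p l))" for t
  proof
    assume "in_N y t"
    then obtain z where z: "\<forall>k\<in>K1 n. t k = (\<Sum>l\<in>K1 n. fb.M k l * z l)" unfolding in_N_def M by blast
    obtain p where "\<forall>k\<in>K1 n. (\<Sum>l\<in>K1 n. fb.M k l * z l) = (\<Sum>j\<in>fb.L. fb.w k j * p j)"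
      using fb.M_in_span_w by blast
    with z show "\<exists>p. \<forall>k\<in>K1 n. t k = (\<Sum>l\<in>fb.L. fb.w k l * p l)" by (intro exI[of _ p]) simp
  next
    assume "\<exists>p. \<forall>k\<in>K1 n. t k = (\<Sum>l\<in>fb.L. fb.w k l * p l)"
    then obtain p where p: "\<forall>k\<in>K1 n. t k = (\<Sum>l\<in>fb.L. fb.w k l * p l)" by blast
    obtain s where s: "(\<Sum>j\<le>N. fb.r j * s j) = 0"
        "\<forall>k. (\<Sum>j\<le>N. peval (Bp k j) y * s j) = (\<Sum>j\<in>fb.L. fb.w k j * p j)"
      using fb.span_w_in_image[of p] by blast
    show "in_N y t" unfolding B r using p s by (intro exI[of _ s]) simp
  qed
  have w: "indep_cols (K1 n) fb.L fb.w" by (rule fb.w_indep[OF nondeg])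
  show "in_N y t \<longleftrightarrow> (\<forall>J\<in>ext_index n. (\<Sum>k\<in>K1 n. peval (Pp J k) y * t k) = 0)"
  proof
    assume "in_N y t"
    then obtain z where "\<forall>k\<in>K1 n. t k = (\<Sum>l\<in>K1 n. peval (Mp k l) y * z l)" unfolding in_N_def by blast
    then show "\<forall>J\<in>ext_index n. (\<Sum>k\<in>K1 n. peval (Pp J k) y * t k) = 0"
      using Pp_Mp[OF H, of _ z] by simp
  next
    assume zero: "\<forall>J\<in>ext_index n. (\<Sum>k\<in>K1 n. peval (Pp J k) y * t k) = 0"
    show "in_N y t"
    proof (rule ccontr)
      assume not: "\<not> in_N y t"
      \<comment> \<open>The form in which \<open>Pp_apply\<close> presents \<open>t\<close>; on
        \<open>K1 n\<close> it is \<open>t\<close>.\<close>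
      let ?t = "\<lambda>l. \<Sum>k\<in>K1 n. t k * (if l = k then 1 else 0)"
      have t: "?t l = t l" if "l \<in> K1 n" for l
      proof -
        have "?t l = (\<Sum>k\<in>K1 n. if k = l then t l else 0)" by (intro sum.cong) auto
        then show ?thesis using that by (simp add: sum.delta)
      qed
      let ?X = "\<lambda>k j. if j = Suc N then ?t k else fb.w k j"
      have notin: "Suc N \<notin> fb.L" using fb.L_le[of "Suc N"] by auto
      have sumX: "(\<Sum>j\<in>insert (Suc N) fb.L. ?X k j * a j) = ?t k * a (Suc N) + (\<Sum>j\<in>fb.L. fb.w k j * a j)" for k a
      proof -
        have "(\<Sum>j\<in>fb.L. ?X k j * a j) = (\<Sum>j\<in>fb.L. fb.w k j * a j)"
          using notin by (intro sum.cong) auto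
        then show ?thesis using notin fb.L_finite by (simp del: sum.insert_if add: sum.insert)
      qed
      \<comment> \<open>A \<open>t\<close> outside the span of the 2n vectors \<open>w\<close>
        extends them to \<open>N\<close> independent vectors. The rows \<open>R\<close> of a nonzero
        minor of order \<open>N\<close> then give the component of \<psi>, indexed by the complement
        of \<open>R\<close>, that does not vanish at \<open>t\<close>.\<close>
      have "indep_cols (K1 n) (insert (Suc N) fb.L) ?X"
        unfolding indep_cols_def
      proof (intro allI impI)
        fix a assume a: "\<forall>k\<in>K1 n. (\<Sum>j\<in>insert (Suc N) fb.L. ?X k j * a j) = 0"
        have a': "t k * a (Suc N) + (\<Sum>j\<in>fb.L. fb.w k j * a j) = 0" if "k \<in> K1 n" for k
          using bspec[OF a that, unfolded sumX] unfolding t[OF that] .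
        have z: "a (Suc N) = 0"
        proof (rule ccontr)
          assume nz: "a (Suc N) \<noteq> 0"
          have "t k = (\<Sum>j\<in>fb.L. fb.w k j * (- a j / a (Suc N)))" if "k \<in> K1 n" for k
          proof -
            have "t k * a (Suc N) = - (\<Sum>j\<in>fb.L. fb.w k j * a j)"
              using a'[OF that] by (simp add: eq_neg_iff_add_eq_0)
            then have "t k = - (\<Sum>j\<in>fb.L. fb.w k j * a j) / a (Suc N)" using nz by (simp add: field_simps)
            then show ?thesis by (simp add: sum_negf sum_divide_distrib)
          qed
          then have "in_N y t" unfolding span by (intro exI[of _ "\<lambda>j. - a j / a (Suc N)"] ballI)
          with not show False by blast
        qed
        then have "\<forall>j\<in>fb.L. a j = 0" using a' indep_colsD[OF w, of a] by simp
        with z show "\<forall>j\<in>insert (Suc N) fb.L. a j = 0" by simp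
      qed
      from indep_cols_select_rows[OF finite_K1 _ this] obtain R where
        R: "R \<subseteq> K1 n" "card R = card (insert (Suc N) fb.L)" "indep_cols R (insert (Suc N) fb.L) ?X"
        using fb.L_finite by auto
      have cardR: "card R = N" using R(2) notin fb.L_finite fb.card_L by simp
      define J where "J = K1 n - R"
      have KJ: "K1 n - J = R" using R(1) by (auto simp: J_def)
      have "card J = 2*n - 1"
        using card_Diff_subset[of R "K1 n"] R(1) cardR finite_subset[OF R(1) finite_K1] n_pos
        by (simp add: J_def card_K1)
      then have J: "J \<in> ext_index n" by (auto simp: ext_index_def J_def)
      have "psi N (\<lambda>i. peval (cst (F i)) y) (\<lambda>k j. peval (Bp k j) y) (\<rho> J) ?t \<noteq> 0"
        by (rule fb.psi_nonzero[OF _ R(1) _ R(3)]) (use ext_indexD(4)[OF J] KJ in auto)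
      with zero J show False unfolding Pp_apply[OF H(1)] by blast
    qed
  qed
  show "\<exists>L w. finite L \<and> card L = 2*n \<and> indep_cols (K1 n) (L :: nat set) w \<and>
      (\<forall>t. in_N y t \<longleftrightarrow> (\<exists>p. \<forall>k\<in>K1 n. t k = (\<Sum>l\<in>L. w k l * p l)))"
    using fb.L_finite fb.card_L w span by (intro exI[of _ fb.L] exI[of _ fb.w]) simp
qed

end

context instanton_data
begin

declare One_nat_def [simp del]

subsection \<open>The sheaves\<close>

interpretation qf: matrix_complex N "{()}" "\<lambda>_. - \<gamma> + - \<gamma>" "{..N}" "\<lambda>j. S_deg n \<alpha> \<beta> j + - \<gamma>" "\<lambda>i _. g i"
  "{()}" "\<lambda>_. \<gamma> + (2 * int n + 1) * (\<alpha> + \<beta>) + - \<gamma>" "\<lambda>_ j. rp j"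
proof
  fix x assume "x \<in> cone_pts N"
  show "(\<Sum>j\<le>N. peval (rp j) x * peval (g j) x) = 0"
    using arg_cong[OF rp_g, of "\<lambda>p. peval p x"] by (simp add: peval_hom.hom_sum peval_mult)
qed (rule g_matrix r_matrix)+

interpretation qe: matrix_complex N "{()}" "\<lambda>_. - \<gamma> + - \<gamma>" "{..N}" "\<lambda>j. S_deg n \<alpha> \<beta> j + - \<gamma>" "\<lambda>i _. g i"
  "{1..4*n+1}" "E_deg n \<alpha> \<beta>" Bp
proof
  fix x k assume "x \<in> cone_pts N" and k: "k \<in> {1..4*n+1}"
  show "(\<Sum>j\<le>N. peval (Bp k j) x * peval (g j) x) = 0"
    using arg_cong[OF Bp_g[OF k], of "\<lambda>p. peval p x"] by (simp add: peval_hom.hom_sum peval_mult)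
qed (rule B_matrix)

text \<open>F(\<gamma>) as the cokernel of \<open>Bp\<close> on the sum of line bundles itself,
  instead of on its quotient Q.\<close>

interpretation fe: matrix_coker N "{..N}" "\<lambda>j. S_deg n \<alpha> \<beta> j + - \<gamma>" "{1..4*n+1}" "E_deg n \<alpha> \<beta>" Bp
  by unfold_locales (rule B_matrix)

lemma Q_sheaf_eq: "Q_sheaf n \<alpha> \<beta> \<gamma> g (- \<gamma>) = qf.Q"
  by (simp only: Q_sheaf_def S_sheaf_def g_map_def)

lemma N_sheaf_eq: "N_sheaf n \<alpha> \<beta> \<gamma> f g (- \<gamma>) = qf.Ker"
  by (simp only: N_sheaf_def Let_def Q_sheaf_eq f_map_def rp_def[symmetric])

lemma Q_to_E_eq: "Q_to_E n \<alpha> \<beta> h g = qe.ind"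
  by (simp only: Q_to_E_def E_sheaf_def h_map_def Bp_def[symmetric])

text \<open>Sections of Q lift locally to the sum of line bundles, and the induced map is computed
  on lifts; so, after shrinking \<open>X\<close>, a witness on either side yields one on the
  other.\<close>

lemma coker_germ_apply:
  "coker_germ N (Q_sheaf n \<alpha> \<beta> \<gamma> g (- \<gamma>)) (E_sheaf n \<alpha> \<beta> {1..4*n+1}) (Q_to_E n \<alpha> \<beta> h g) x V b =
    fe.germ x V b"
proof (rule Set.set_eqI)
  fix p :: "pt set \<times> (nat \<Rightarrow> pt \<Rightarrow> complex)"
  obtain V' b' where p: "p = (V', b')" by force
  have ind: "qe.ind X q k y = fe.\<phi> X' s k y"
    if "zopen N X" "q \<in> carrier (Sec qf.Q X)" "y \<in> X" "zopen N X'" "y \<in> X'" "s \<in> carrier (Sec fe.SA X')"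
      "q y = qf.germ y X' s" for X q k y X' s
    using qe.induced_value[OF that(1,2,3), of X' s] qf.self_mem_germ[OF that(4,5,6)] that(7) by simp
  have "(\<exists>X. zopen N X \<and> x \<in> X \<and> X \<subseteq> V \<inter> V' \<and> (\<exists>a\<in>carrier (Sec qf.Q X).
        Res fe.SB V X b = Res fe.SB V' X b' \<oplus>\<^bsub>Sec fe.SB X\<^esub> qe.ind X a)) \<longleftrightarrow>
      (\<exists>X. zopen N X \<and> x \<in> X \<and> X \<subseteq> V \<inter> V' \<and> (\<exists>a\<in>carrier (Sec fe.SA X).
        Res fe.SB V X b = Res fe.SB V' X b' \<oplus>\<^bsub>Sec fe.SB X\<^esub> fe.\<phi> X a))" (is "?L \<longleftrightarrow> ?R")
  proof
    assume ?L
    then obtain X q where X: "zopen N X" "x \<in> X" "X \<subseteq> V \<inter> V'" and q: "q \<in> carrier (Sec qf.Q X)"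
      and eq: "Res fe.SB V X b = Res fe.SB V' X b' \<oplus>\<^bsub>Sec fe.SB X\<^esub> qe.ind X q" by blast
    obtain X' s where X': "zopen N X'" "x \<in> X'" "X' \<subseteq> X" and s: "s \<in> carrier (Sec fe.SA X')"
      and germ: "\<forall>y\<in>X'. q y = qf.germ y X' s"
      by (rule qf.Q_repE[OF q X(2)])
    have "Res fe.SB V X' b k y = (Res fe.SB V' X' b' \<oplus>\<^bsub>Sec fe.SB X'\<^esub> fe.\<phi> X' s) k y" for k y
    proof (cases "y \<in> X'")
      case True
      then have y: "y \<in> X" using X' by blast
      show ?thesis
        using fun_cong[OF fun_cong[OF eq, of k], of y] True y
          ind[OF X(1) q y X'(1) True s bspec[OF germ True], of k]
        by (simp add: fun_restrict_def)
    next
      case False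
      then have "s j y = 0" for j using line_sum_outside[OF s] by blast
      with False show ?thesis by (simp add: fun_restrict_def matrix_map_def)
    qed
    then have "Res fe.SB V X' b = Res fe.SB V' X' b' \<oplus>\<^bsub>Sec fe.SB X'\<^esub> fe.\<phi> X' s" by (intro ext)
    with X X' s show ?R by blast
  next
    assume ?R
    then obtain X s where X: "zopen N X" "x \<in> X" "X \<subseteq> V \<inter> V'" and s: "s \<in> carrier (Sec fe.SA X)"
      and eq: "Res fe.SB V X b = Res fe.SB V' X b' \<oplus>\<^bsub>Sec fe.SB X\<^esub> fe.\<phi> X s" by blast
    let ?q = "coker_proj N qf.SA qf.SB qf.\<phi> X s"
    have q: "?q \<in> carrier (Sec qf.Q X)" by (rule qf.proj_closed[OF X(1) s])
    have "qe.ind X ?q k y = fe.\<phi> X s k y" for k y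
    proof (cases "y \<in> X")
      case True
      show ?thesis by (rule ind[OF X(1) q True X(1) True s]) (simp add: coker_proj_def True)
    next
      case False
      then have "s j y = 0" for j using line_sum_outside[OF s] by blast
      moreover have "qe.ind X ?q k y = 0"
        using line_sum_outside[OF qe.induced_closed[OF X(1) q]] False by blast
      ultimately show ?thesis by (simp add: matrix_map_def)
    qed
    then have "qe.ind X ?q = fe.\<phi> X s" by (intro ext)
    with X q eq show ?L by metis
  qed
  then show "p \<in> coker_germ N (Q_sheaf n \<alpha> \<beta> \<gamma> g (- \<gamma>)) (E_sheaf n \<alpha> \<beta> {1..4*n+1}) (Q_to_E n \<alpha> \<beta> h g) x V b
      \<longleftrightarrow> p \<in> fe.germ x V b"
    unfolding coker_germ_def Q_sheaf_eq Q_to_E_eq E_sheaf_def p by blast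
qed

lemma coker_germ_eq:
  "coker_germ N (Q_sheaf n \<alpha> \<beta> \<gamma> g (- \<gamma>)) (E_sheaf n \<alpha> \<beta> {1..4*n+1}) (Q_to_E n \<alpha> \<beta> h g) = fe.germ"
  by (intro ext coker_germ_apply)

text \<open>\<open>shf_coker\<close> involves its source only through germs.\<close>

lemma F_gamma_eq: "F_gamma n \<alpha> \<beta> \<gamma> h g = fe.Q"
  unfolding F_gamma_def shf_coker_def coker_proj_def coker_germ_eq
  unfolding E_sheaf_def ..

lemma iota_map_eq: "iota_map n \<alpha> \<beta> \<gamma> h g = coker_proj N fe.SA fe.SB fe.\<phi>"
  unfolding iota_map_def coker_proj_def coker_germ_eq ..

section \<open>The morphisms given by \<open>Mp\<close> and \<open>Pp\<close>\<close>

abbreviation "Y \<equiv> line_sum N (K1 n) (E_deg n \<alpha> \<beta>)"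
abbreviation "Yd \<equiv> line_sum N (K1 n) (dual_deg n \<alpha> \<beta> \<gamma>)"
abbreviation "Ye \<equiv> line_sum N (ext_index n) (ext_deg n \<alpha> \<beta> \<gamma>)"
abbreviation "Phi \<equiv> matrix_map (K1 n) (K1 n) Mp"
abbreviation "Psi \<equiv> matrix_map (ext_index n) (K1 n) Pp"

lemma K1_subset: "K1 n \<subseteq> {1..4*n+1}" and N_notin_K1: "N \<notin> K1 n"
  by (auto simp: K1_def)

text \<open>Pointwise membership becomes a local lift because every fibre has the same dimension 2n,
  as \<open>constant_rank_lift\<close> demands.\<close>

lemma in_N_lift:
  assumes U: "zopen N U" and x: "x \<in> U" and t: "t \<in> carrier (Sec Y U)"
    and inN: "\<And>y. y \<in> U \<Longrightarrow> in_N y (\<lambda>k. t k y)"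
  shows "\<exists>V a. zopen N V \<and> x \<in> V \<and> V \<subseteq> U \<and> a \<in> carrier (Sec Yd V) \<and> (\<forall>y\<in>V. \<forall>k. t k y = Phi V a k y)"
proof -
  define D where "D y L w \<longleftrightarrow> finite L \<and> card L = 2*n \<and> indep_cols (K1 n) (L :: nat set) w \<and>
      (\<forall>t. in_N y t \<longleftrightarrow> (\<exists>p. \<forall>k\<in>K1 n. t k = (\<Sum>l\<in>L. w k l * p l)))" for y L w
  have "\<exists>L w. D y L w" if "y \<in> U" for y
    unfolding D_def by (rule in_N_basis[OF subsetD[OF zopen_subset[OF U] that]])
  then obtain L w where Lw: "\<And>y. y \<in> U \<Longrightarrow> D y (L y) (w y)" by metis
  show ?thesis
  proof (rule constant_rank_lift[OF M_matrix finite_K1 finite_K1 U x _ _ _ _ t, of L "2*n" w])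
    fix y assume y: "y \<in> U"
    note D = Lw[OF y, unfolded D_def]
    note span = D[THEN conjunct2, THEN conjunct2, THEN conjunct2, rule_format]
    show "finite (L y) \<and> card (L y) = 2*n" "indep_cols (K1 n) (L y) (w y)" using D by blast+
    show "\<exists>p. \<forall>i\<in>K1 n. (\<Sum>j\<in>K1 n. peval (Mp i j) y * z j) = (\<Sum>l\<in>L y. w y i l * p l)" for z
    proof -
      have "in_N y (\<lambda>i. \<Sum>j\<in>K1 n. peval (Mp i j) y * z j)" unfolding in_N_def by blast
      then show ?thesis unfolding span .
    qed
    show "\<exists>z. \<forall>i\<in>K1 n. (\<Sum>l\<in>L y. w y i l * p l) = (\<Sum>j\<in>K1 n. peval (Mp i j) y * z j)" for p
    proof -
      have "in_N y (\<lambda>i. \<Sum>l\<in>L y. w y i l * p l)" unfolding span by blast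
      then show ?thesis unfolding in_N_def .
    qed
    show "\<exists>z. \<forall>i\<in>K1 n. t i y = (\<Sum>j\<in>K1 n. peval (Mp i j) y * z j)"
      using inN[OF y] unfolding in_N_def .
  qed
qed

lemma in_N_Phi: "in_N y (\<lambda>k. Phi U a k y)"
  unfolding in_N_def by (intro exI[of _ "\<lambda>l. a l y"]) (simp add: matrix_map_def)

text \<open>By \<open>Mp_eq\<close> the section is \<open>Bp\<close> applied to the values of
  \<open>Sp\<close>, hence zero in the cokernel.\<close>

lemma csim_if_Phi:
  assumes V: "zopen N V" "x \<in> V" and a: "a \<in> carrier (Sec Yd V)" and t: "\<And>y k. y \<in> V \<Longrightarrow> t k y = Phi V a k y"
  shows "fe.csim x t (\<lambda>k y. 0)"
proof (rule fe.csimI[OF V matrix_map_closed[OF S_matrix V(1) a]])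
  fix y k assume y: "y \<in> V"
  have B: "(\<Sum>j\<le>N. peval (C j) y * matrix_map {..N} (K1 n) Sp V a j y) =
      (\<Sum>l\<in>K1 n. peval (\<Sum>j\<le>N. C j * Sp j l) y * a l y)" for C
  proof -
    have "(\<Sum>j\<le>N. peval (C j) y * matrix_map {..N} (K1 n) Sp V a j y) =
        (\<Sum>j\<le>N. \<Sum>l\<in>K1 n. peval (C j) y * peval (Sp j l) y * a l y)"
      by (intro sum.cong refl) (simp add: matrix_map_def sum_distrib_left mult.assoc)
    also have "\<dots> = (\<Sum>l\<in>K1 n. \<Sum>j\<le>N. peval (C j) y * peval (Sp j l) y * a l y)" by (rule sum.swap)
    finally show ?thesis by (simp add: peval_hom.hom_sum peval_mult sum_distrib_right)
  qed
  consider "k \<in> K1 n" | "k = N" | "k \<notin> {1..4*n+1}" by (auto simp: K1_def)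
  then have "Phi V a k y = fe.\<phi> V (matrix_map {..N} (K1 n) Sp V a) k y"
  proof cases
    case 1
    then have k: "k \<in> {1..4*n+1}" using K1_subset by blast
    have "fe.\<phi> V (matrix_map {..N} (K1 n) Sp V a) k y =
        (\<Sum>j\<le>N. peval (Bp k j) y * matrix_map {..N} (K1 n) Sp V a j y)"
      using k by (simp add: matrix_map_def)
    also have "\<dots> = (\<Sum>l\<in>K1 n. peval (Mp k l) y * a l y)" unfolding B Mp_eq ..
    finally show ?thesis using 1 by (simp add: matrix_map_def)
  next
    \<comment> \<open>A section of \<open>Y\<close> has no component at \<open>N\<close>, so
      \<open>Bp\<close> applied to the preimage must have none: up to a constant it is r of the
      values of \<open>Sp\<close>, where the symplectic constants cancel and \<open>Bp_g\<close>
      remains.\<close>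
    case 2
    obtain c where c: "\<forall>j\<le>N. Bp N j = cst c * rp j" using Bp_N by blast
    have "(\<Sum>j\<le>N. Bp N j * Sp j l) = 0" if l: "l \<in> K1 n" for l
    proof -
      have "(\<Sum>j\<le>N. Bp N j * Sp j l) = (\<Sum>j\<le>N. cst c * (Bp l (N - j) * g (N - j)))"
      proof (intro sum.cong refl)
        fix j assume "j \<in> {..N}"
        then have j: "j \<le> N" by simp
        have inv: "cst (F (N - j)) * cst (1 / F (N - j)) = 1"
          unfolding cst_mult[symmetric] using F_nz[of "N - j"] by simp
        have "cst (F (N - j)) * g (N - j) * (cst (1 / F (N - j)) * Bp l (N - j)) = Bp l (N - j) * g (N - j)"
          using arg_cong[OF inv, of "\<lambda>u. u * (Bp l (N - j) * g (N - j))"] by (simp only: mult_ac mult_1)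
        then show "Bp N j * Sp j l = cst c * (Bp l (N - j) * g (N - j))"
          using c j by (simp add: Sp_def rp_eq mult.assoc)
      qed
      also have "\<dots> = cst c * (\<Sum>j\<le>N. Bp l j * g j)"
        unfolding sum_distrib_left by (rule sum_antidiagonal)
      also have "\<dots> = 0" using Bp_g l K1_subset by auto
      finally show ?thesis .
    qed
    then have "fe.\<phi> V (matrix_map {..N} (K1 n) Sp V a) k y = 0"
      using 2 B[of "Bp N"] by (simp add: matrix_map_def)
    then show ?thesis using 2 N_notin_K1 by (simp add: matrix_map_def)
  next
    case 3
    then show ?thesis using K1_subset by (auto simp: matrix_map_def)
  qed
  then show "t k y = 0 + fe.\<phi> V (matrix_map {..N} (K1 n) Sp V a) k y" using t[OF y] by simp
qed

text \<open>The component at \<open>N\<close> of the image of \<open>s\<close> is a nonzero multiple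
  of r; as \<open>t\<close> has none there, r vanishes on \<open>s\<close>.\<close>

lemma csim_imp_in_N:
  assumes x: "x \<in> cone_pts N" and t: "t N x = 0" and s: "fe.csim x t (\<lambda>k y. 0)"
  shows "in_N x (\<lambda>k. t k x)"
proof -
  obtain X s where X: "x \<in> X" "\<And>y k. y \<in> X \<Longrightarrow> t k y = 0 + fe.\<phi> X s k y"
    using fe.csimE[OF s zopen_cone x] by metis
  have tk: "t k x = (\<Sum>j\<le>N. peval (Bp k j) x * s j x)" if "k \<in> {1..4*n+1}" for k
    using X(2)[OF X(1), of k] that by (simp add: matrix_map_def)
  obtain c where c: "c \<noteq> 0" "\<forall>j\<le>N. Bp N j = cst c * rp j" using Bp_N by blast
  have "0 = (\<Sum>j\<le>N. peval (Bp N j) x * s j x)" using tk[OF N_range] t by simp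
  also have "\<dots> = c * (\<Sum>j\<le>N. peval (rp j) x * s j x)"
    unfolding sum_distrib_left using c(2) by (intro sum.cong) (auto simp: peval_mult)
  finally have "(\<Sum>j\<le>N. peval (rp j) x * s j x) = 0" using c(1) by simp
  then show ?thesis
    unfolding in_N_iff_B[OF x] using tk K1_subset by (intro exI[of _ "\<lambda>j. s j x"]) auto
qed

lemma iota_zero_iff:
  assumes U: "zopen N U" and t: "t \<in> carrier (Sec Y U)"
  shows "coker_proj N fe.SA fe.SB fe.\<phi> U t = \<zero>\<^bsub>Sec fe.Q U\<^esub> \<longleftrightarrow> (\<forall>x\<in>U. fe.csim x t (\<lambda>k y. 0))"
proof -
  have tE: "t \<in> carrier (Sec fe.SB U)" by (rule line_sum_mono[OF t U K1_subset])
  have "coker_proj N fe.SA fe.SB fe.\<phi> U t = \<zero>\<^bsub>Sec fe.Q U\<^esub> \<longleftrightarrow>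
      (\<forall>x\<in>U. fe.germ x U t = fe.germ x U (\<lambda>k y. 0))"
    unfolding fe.Q_zero coker_proj_def fun_eq_iff by auto
  then show ?thesis using fe.germ_eq_iff[OF U _ tE U _ line_sum_closed_zero[OF U]] by blast
qed

lemma in_N_of_csim:
  assumes "zopen N U" "t \<in> carrier (Sec Y U)" "\<And>x. x \<in> U \<Longrightarrow> fe.csim x t (\<lambda>k y. 0)" "x \<in> U"
  shows "in_N x (\<lambda>k. t k x)"
proof (rule csim_imp_in_N)
  show "x \<in> cone_pts N" using assms zopen_subset by blast
  show "t N x = 0" using line_sum_outside[OF assms(2)] N_notin_K1 by blast
qed (rule assms(3,4))+

lemma Phi_locally_in_image:
  assumes U: "zopen N U" and t: "t \<in> carrier (Sec Y U)" and inN: "\<And>y. y \<in> U \<Longrightarrow> in_N y (\<lambda>k. t k y)"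
  shows "locally_in_image N Yd Y Phi U t"
  unfolding locally_in_image_def
proof
  fix x assume "x \<in> U"
  from in_N_lift[OF U this t inN] obtain V a where V: "zopen N V" "x \<in> V" "V \<subseteq> U" and a: "a \<in> carrier (Sec Yd V)"
    and eq: "\<forall>y\<in>V. \<forall>k. t k y = Phi V a k y" by blast
  have "Phi V a k y = Res Y U V t k y" for k y
  proof (cases "y \<in> V")
    case False
    then have "a l y = 0" for l using line_sum_outside[OF a] by blast
    with False show ?thesis by (simp add: matrix_map_def fun_restrict_def)
  qed (use eq in \<open>simp add: fun_restrict_def\<close>)
  then have "Phi V a = Res Y U V t" by (intro ext)
  with V a show "\<exists>V. zopen N V \<and> x \<in> V \<and> V \<subseteq> U \<and> (\<exists>s\<in>carrier (Sec Yd V). Phi V s = Res Y U V t)" by blast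
qed

lemma Psi_zero_iff:
  assumes "x \<in> cone_pts N"
  shows "(\<forall>J. Psi U t J x = 0) \<longleftrightarrow> in_N x (\<lambda>k. t k x)"
  unfolding in_N_iff_P[OF assms] by (auto simp: matrix_map_def)

lemma Phi_hom: "shf_hom N Yd Y Phi" and Psi_hom: "shf_hom N Y Ye Psi"
  by (rule shf_hom_matrix_map[OF M_matrix], rule shf_hom_matrix_map[OF P_matrix])

lemma Phi_Psi_exact: "shf_exact N Yd Y Ye Phi Psi"
  unfolding shf_exact_def
proof (intro allI impI conjI ballI)
  fix U a assume U: "zopen N U" and a: "a \<in> carrier (Sec Yd U)"
  show "Psi U (Phi U a) = \<zero>\<^bsub>Sec Ye U\<^esub>"
  proof (simp only: line_sum_zero, intro ext)
    fix J x show "Psi U (Phi U a) J x = 0"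
    proof (cases "x \<in> U")
      case True
      then have "x \<in> cone_pts N" using U zopen_subset by blast
      from Psi_zero_iff[OF this] in_N_Phi show ?thesis by blast
    next
      case False
      then have "a l x = 0" for l using line_sum_outside[OF a] by blast
      then show ?thesis by (simp add: matrix_map_def)
    qed
  qed
next
  fix U t assume U: "zopen N U" and t: "t \<in> carrier (Sec Y U)" and "Psi U t = \<zero>\<^bsub>Sec Ye U\<^esub>"
  then have z: "Psi U t J x = 0" for J x by simp
  show "locally_in_image N Yd Y Phi U t"
  proof (rule Phi_locally_in_image[OF U t])
    fix y assume "y \<in> U"
    then have "y \<in> cone_pts N" using U zopen_subset by blast
    from Psi_zero_iff[OF this] z show "in_N y (\<lambda>k. t k y)" by blast
  qed
qed

text \<open>Exactness makes the kernel of \<iota> the local image of \<pi>. It is also the local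
  image of \<open>Phi\<close>, so the two maps are compared without a formula for \<pi>.\<close>

lemma Phi_factors:
  assumes sequence: "shf_short_exact N qf.Ker Y fe.Q \<pi> (coker_proj N fe.SA fe.SB fe.\<phi>)"
  shows "\<exists>\<sigma>. shf_hom N Yd qf.Ker \<sigma> \<and> shf_surj N Yd qf.Ker \<sigma> \<and> shf_map_eq N Yd Phi (shf_comp \<pi> \<sigma>)"
proof (rule qf.factor_through_injection)
  show \<pi>: "shf_hom N qf.Ker Y \<pi>" and "shf_inj N qf.Ker \<pi>" using sequence by (simp_all add: shf_short_exact_def)
  show "shf_hom N Yd Y Phi" by (rule Phi_hom)
  have ex: "shf_exact N qf.Ker Y fe.Q \<pi> (coker_proj N fe.SA fe.SB fe.\<phi>)"
    using sequence by (simp only: shf_short_exact_def)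
  show "locally_in_image N qf.Ker Y \<pi> U (Phi U a)" if U: "zopen N U" and a: "a \<in> carrier (Sec Yd U)" for U a
  proof -
    have t: "Phi U a \<in> carrier (Sec Y U)" by (rule matrix_map_closed[OF M_matrix U a])
    have "coker_proj N fe.SA fe.SB fe.\<phi> U (Phi U a) = \<zero>\<^bsub>Sec fe.Q U\<^esub>"
      unfolding iota_zero_iff[OF U t] by (intro ballI csim_if_Phi[OF U _ a]) auto
    with ex U t show ?thesis unfolding shf_exact_def by blast
  qed
  show "locally_in_image N Yd Y Phi U (\<pi> U s)" if U: "zopen N U" and s: "s \<in> carrier (Sec qf.Ker U)" for U s
  proof -
    have t: "\<pi> U s \<in> carrier (Sec Y U)" by (rule shf_hom_closed[OF \<pi> U s])
    have "coker_proj N fe.SA fe.SB fe.\<phi> U (\<pi> U s) = \<zero>\<^bsub>Sec fe.Q U\<^esub>"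
      using ex U s unfolding shf_exact_def by blast
    then have "\<And>x. x \<in> U \<Longrightarrow> fe.csim x (\<pi> U s) (\<lambda>k y. 0)" unfolding iota_zero_iff[OF U t] by blast
    from in_N_of_csim[OF U t this] show ?thesis by (rule Phi_locally_in_image[OF U t])
  qed
qed

lemma Psi_factors:
  assumes "shf_surj N Y fe.Q (coker_proj N fe.SA fe.SB fe.\<phi>)"
  shows "\<exists>\<tau>. shf_hom N fe.Q Ye \<tau> \<and> shf_inj N fe.Q \<tau> \<and>
    shf_map_eq N Y Psi (shf_comp \<tau> (coker_proj N fe.SA fe.SB fe.\<phi>))"
proof (rule fe.factor_through_coker[OF K1_subset P_matrix _ _ assms])
  fix V x b assume V: "zopen N V" "x \<in> V" and b: "b \<in> carrier (Sec Y V)"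
  have x: "x \<in> cone_pts N" using V zopen_subset by blast
  show "Psi V b J x = 0" if s: "fe.csim x b (\<lambda>j y. 0)" for J
  proof -
    have "b N x = 0" using line_sum_outside[OF b] N_notin_K1 by blast
    from csim_imp_in_N[OF x this s] Psi_zero_iff[OF x] show ?thesis by blast
  qed
  show "fe.csim x b (\<lambda>j y. 0)" if z: "\<And>y J. y \<in> V \<Longrightarrow> Psi V b J y = 0"
  proof -
    have "in_N y (\<lambda>k. b k y)" if "y \<in> V" for y
    proof -
      have "y \<in> cone_pts N" using V that zopen_subset by blast
      from Psi_zero_iff[OF this] z[OF that] show ?thesis by blast
    qed
    from in_N_lift[OF V b this] obtain X a where X: "zopen N X" "x \<in> X" "a \<in> carrier (Sec Yd X)"
      "\<forall>y\<in>X. \<forall>k. b k y = Phi X a k y" by blast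
    show ?thesis by (rule csim_if_Phi[OF X(1-3)]) (use X(4) in blast)
  qed
qed

subsection \<open>Ranks\<close>

lemma exists_point: "\<exists>y m. y \<in> cone_pts N \<and> m \<le> N \<and> Fract (g m) 1 \<noteq> 0"
proof -
  have y: "(\<lambda>i. if i = 0 then 1 else 0) \<in> cone_pts N" by (auto simp: cone_pts_def)
  obtain m where m: "m \<le> N" "peval (g m) (\<lambda>i. if i = 0 then 1 else 0) \<noteq> 0"
    using g_no_common_zero[OF y] by blast
  then have "g m \<noteq> 0" by auto
  then have "Fract (g m) 1 \<noteq> 0" unfolding Zero_fract_def by (subst eq_fract) auto
  with y m show ?thesis by blast
qed

lemma Mp_columns:
  assumes y: "y \<in> cone_pts N"
  shows "\<exists>C\<subseteq>K1 n. card C = 2*n \<and> indep_cols (K1 n) C (\<lambda>k l. peval (Mp k l) y)"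
proof -
  obtain L w where L: "finite L" "card L = 2*n" "indep_cols (K1 n) (L :: nat set) w"
    and span: "\<And>t. in_N y t \<longleftrightarrow> (\<exists>p. \<forall>k\<in>K1 n. t k = (\<Sum>l\<in>L. w k l * p l))"
    using in_N_basis[OF y] by blast
  have "\<exists>p. \<forall>i\<in>K1 n. (\<Sum>j\<in>K1 n. peval (Mp i j) y * z j) = (\<Sum>l\<in>L. w i l * p l)" for z
    using span[of "\<lambda>i. \<Sum>j\<in>K1 n. peval (Mp i j) y * z j"] unfolding in_N_def by blast
  moreover have "\<exists>z. \<forall>i\<in>K1 n. (\<Sum>l\<in>L. w i l * p l) = (\<Sum>j\<in>K1 n. peval (Mp i j) y * z j)" for p
    using span[of "\<lambda>i. \<Sum>l\<in>L. w i l * p l"] unfolding in_N_def by blast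
  ultimately show ?thesis
    using select_columns[OF finite_K1 finite_K1 L(1,3), of "\<lambda>k l. peval (Mp k l) y"] L(2) by simp
qed

text \<open>Independence of 2n columns at a point persists over the rational functions; conversely
  all columns lie in the span of the 2n vectors \<open>w\<close> of the generic fibre.\<close>

lemma Mp_rank: "poly_matrix_rank (K1 n) (K1 n) Mp = 2*n"
proof (rule antisym)
  obtain y m where y: "y \<in> cone_pts N" and m: "m \<le> N" "Fract (g m) 1 \<noteq> 0" using exists_point by blast
  obtain C where C: "C \<subseteq> K1 n" "card C = 2*n" "indep_cols (K1 n) C (\<lambda>k l. peval (Mp k l) y)"
    using Mp_columns[OF y] by blast
  obtain R where R: "R \<subseteq> K1 n" "indep_cols R C (\<lambda>k l. Fract (Mp k l) 1)"
    using indep_cols_transfer[OF finite_K1 finite_subset[OF C(1) finite_K1] C(3)] by blast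
  have "card C \<le> poly_matrix_rank (K1 n) (K1 n) Mp"
    by (rule poly_matrix_rank_ge[OF finite_K1 C(1) indep_cols_subset_rows[OF R(2,1)]])
  then show "2*n \<le> poly_matrix_rank (K1 n) (K1 n) Mp" using C(2) by simp
  note H = frac_hom m
  interpret fb: symplectic_fibre N "\<lambda>i. Fract (cst (F i)) 1" "\<lambda>i. Fract (g i) 1" "K1 n" "\<lambda>k j. Fract (Bp k j) 1" m
    by (rule fibre_hom[OF H])
  have "poly_matrix_rank (K1 n) (K1 n) Mp \<le> card fb.L"
  proof (rule poly_matrix_rank_le[OF fb.L_finite])
    fix l assume l: "l \<in> K1 n"
    have "(\<Sum>l'\<in>K1 n. fb.M k l' * (if l' = l then 1 else 0)) = fb.M k l" for k
    proof -
      have "(\<Sum>l'\<in>K1 n. fb.M k l' * (if l' = l then 1 else 0)) = (\<Sum>l'\<in>K1 n. if l' = l then fb.M k l else 0)"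
        by (intro sum.cong) auto
      then show ?thesis using l by (simp add: sum.delta)
    qed
    with fb.M_in_span_w[of "\<lambda>l'. if l' = l then 1 else 0"]
    show "\<exists>p. \<forall>k\<in>K1 n. Fract (Mp k l) 1 = (\<Sum>j\<in>fb.L. fb.w k j * p j)"
      unfolding fibre_M[OF H] by simp
  qed
  then show "poly_matrix_rank (K1 n) (K1 n) Mp \<le> 2*n" using fb.card_L by simp
qed

lemma card_K1_minus: "R \<subseteq> K1 n \<Longrightarrow> card R = 2*n \<Longrightarrow> card (K1 n - R) = 2*n"
  using card_Diff_subset[of R "K1 n"] finite_subset[of R "K1 n"] by (simp add: card_K1)

text \<open>At a point the kernel of \<open>Pp\<close> has dimension 2n and is detected by 2n
  coordinates \<open>R\<close>, so the other 2n columns are independent. For the upper bound,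
  generic relations from \<open>Pp_Mp\<close> express the columns in \<open>S\<close> through the 2n
  remaining ones.\<close>

lemma Pp_rank: "poly_matrix_rank (ext_index n) (K1 n) Pp = 2*n"
proof (rule antisym)
  obtain y m where y: "y \<in> cone_pts N" and m: "m \<le> N" "Fract (g m) 1 \<noteq> 0" using exists_point by blast
  obtain L w where L: "finite L" "card L = 2*n" "indep_cols (K1 n) (L :: nat set) w"
    and span: "\<And>t. in_N y t \<longleftrightarrow> (\<exists>p. \<forall>k\<in>K1 n. t k = (\<Sum>l\<in>L. w k l * p l))"
    using in_N_basis[OF y] by blast
  obtain R where R: "R \<subseteq> K1 n" "card R = 2*n" "indep_cols R L w"
    using indep_cols_select_rows[OF finite_K1 L(1,3)] L(2) by auto
  have "indep_cols (ext_index n) (K1 n - R) (\<lambda>J k. peval (Pp J k) y)"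
    unfolding indep_cols_def
  proof (intro allI impI)
    fix a assume a: "\<forall>J\<in>ext_index n. (\<Sum>k\<in>K1 n - R. peval (Pp J k) y * a k) = 0"
    let ?t = "\<lambda>k. if k \<in> R then 0 else a k"
    have "(\<Sum>k\<in>K1 n. peval (Pp J k) y * ?t k) = (\<Sum>k\<in>K1 n - R. peval (Pp J k) y * a k)" for J
      by (rule sum.mono_neutral_cong_right) auto
    with a have "in_N y ?t" unfolding in_N_iff_P[OF y] by simp
    then obtain p where p: "\<forall>k\<in>K1 n. ?t k = (\<Sum>l\<in>L. w k l * p l)" unfolding span by blast
    have "(\<Sum>l\<in>L. w k l * p l) = 0" if "k \<in> R" for k
      using bspec[OF p subsetD[OF R(1) that]] that by simp
    from indep_colsD[OF R(3) this] have "\<forall>l\<in>L. p l = 0" by blast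
    with p have t: "\<forall>k\<in>K1 n. ?t k = 0" by simp
    show "\<forall>k\<in>K1 n - R. a k = 0"
    proof
      fix k assume "k \<in> K1 n - R"
      with bspec[OF t, of k] show "a k = 0" by simp
    qed
  qed
  from indep_cols_transfer[OF finite_ext_index finite_Diff[OF finite_K1] this]
  obtain R' where R': "R' \<subseteq> ext_index n" "indep_cols R' (K1 n - R) (\<lambda>J k. Fract (Pp J k) 1)"
    by blast
  have "card (K1 n - R) \<le> poly_matrix_rank (ext_index n) (K1 n) Pp"
    by (rule poly_matrix_rank_ge[OF finite_K1 _ indep_cols_subset_rows[OF R'(2,1)]]) auto
  then show "2*n \<le> poly_matrix_rank (ext_index n) (K1 n) Pp" using card_K1_minus[OF R(1,2)] by simp

  obtain C where C: "C \<subseteq> K1 n" "card C = 2*n" "indep_cols (K1 n) C (\<lambda>k l. peval (Mp k l) y)"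
    using Mp_columns[OF y] by blast
  have finC: "finite C" by (rule finite_subset[OF C(1) finite_K1])
  obtain S where S: "S \<subseteq> K1 n" "card S = card C" "indep_cols S C (\<lambda>k l. Fract (Mp k l) 1)"
    using indep_cols_transfer[OF finite_K1 finC C(3)] by blast
  have finS: "finite S" by (rule finite_subset[OF S(1) finite_K1])
  have "poly_matrix_rank (ext_index n) (K1 n) Pp \<le> card (K1 n - S)"
  proof (rule poly_matrix_rank_le[where v = "\<lambda>J l. Fract (Pp J l) 1"])
    fix k assume k: "k \<in> K1 n"
    show "\<exists>p. \<forall>J\<in>ext_index n. Fract (Pp J k) 1 = (\<Sum>l\<in>K1 n - S. Fract (Pp J l) 1 * p l)"
    proof (cases "k \<in> S")
      case False
      have "Fract (Pp J k) 1 = (\<Sum>l\<in>K1 n - S. Fract (Pp J l) 1 * (if l = k then 1 else 0))" for J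
      proof -
        have "(\<Sum>l\<in>K1 n - S. Fract (Pp J l) 1 * (if l = k then 1 else 0)) =
            (\<Sum>l\<in>K1 n - S. if l = k then Fract (Pp J k) 1 else 0)"
          by (intro sum.cong) auto
        then show ?thesis using k False by (simp add: sum.delta)
      qed
      then show ?thesis by (intro exI[of _ "\<lambda>l. if l = k then 1 else 0"] ballI)
    next
      case True
      \<comment> \<open>A combination of columns of \<open>Mp\<close> that on \<open>S\<close> is
        the unit vector \<open>k\<close>; \<open>Pp\<close> kills it, which solves for column
        \<open>k\<close>.\<close>
      obtain a where a: "\<And>i. i \<in> S \<Longrightarrow> (\<Sum>c\<in>C. Fract (Mp i c) 1 * a c) = (if i = k then 1 else 0)"
        using square_solve[OF finS finC S(2,3), of "\<lambda>i. if i = k then 1 else 0"] by blast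
      define t where "t i = (\<Sum>c\<in>K1 n. Fract (Mp i c) 1 * (if c \<in> C then a c else 0))" for i
      have t_eq: "t i = (\<Sum>c\<in>C. Fract (Mp i c) 1 * a c)" for i
        unfolding t_def using C(1) by (intro sum.mono_neutral_cong_right) auto
      have "Fract (Pp J k) 1 = (\<Sum>l\<in>K1 n - S. Fract (Pp J l) 1 * - t l)" if J: "J \<in> ext_index n" for J
      proof -
        have "0 = (\<Sum>l\<in>K1 n. Fract (Pp J l) 1 * t l)"
          unfolding t_def by (rule Pp_Mp[OF frac_hom m J, symmetric])
        also have "\<dots> = (\<Sum>l\<in>S. Fract (Pp J l) 1 * t l) + (\<Sum>l\<in>K1 n - S. Fract (Pp J l) 1 * t l)"
          using sum.subset_diff[OF S(1) finite_K1] by (simp add: add.commute)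
        also have "(\<Sum>l\<in>S. Fract (Pp J l) 1 * t l) = (\<Sum>l\<in>S. if l = k then Fract (Pp J k) 1 else 0)"
          using a by (intro sum.cong) (auto simp: t_eq)
        also have "\<dots> = Fract (Pp J k) 1" using True finS by (simp add: sum.delta)
        finally show ?thesis by (simp only: mult_minus_right sum_negf eq_neg_iff_add_eq_0)
      qed
      then show ?thesis by (intro exI[of _ "\<lambda>l. - t l"] ballI)
    qed
  qed simp
  then show "poly_matrix_rank (ext_index n) (K1 n) Pp \<le> 2*n"
    using card_K1_minus[OF S(1)] S(2) C(2) by simp
qed

text \<open>\<open>E_deg\<close> is affine in \<open>k\<close> with slope \<beta> - \<alpha>, so its
  extremes are at the ends 4n+1 and 1; they are the two quantities in the bound on \<gamma>.\<close>

lemma E_deg_bounds: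
  assumes "k \<in> K1 n" "\<beta> \<le> \<alpha>"
  shows "E_deg n \<alpha> \<beta> k \<ge> \<alpha> + \<beta> * (4 * int n + 1)" "E_deg n \<alpha> \<beta> k \<le> \<alpha> * (4 * int n + 1) + \<beta>"
proof -
  have k: "1 \<le> int k" "int k \<le> 4 * int n + 1" using assms(1) by (auto simp: K1_def)
  have "int k * (\<beta> - \<alpha>) \<ge> (4 * int n + 1) * (\<beta> - \<alpha>)"
    using k assms(2) by (intro mult_right_mono_neg) auto
  then show "E_deg n \<alpha> \<beta> k \<ge> \<alpha> + \<beta> * (4 * int n + 1)"
    by (simp add: E_deg_def algebra_simps)
  have "int k * (\<beta> - \<alpha>) \<le> 1 * (\<beta> - \<alpha>)"
    using k assms(2) by (intro mult_right_mono_neg) auto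
  then show "E_deg n \<alpha> \<beta> k \<le> \<alpha> * (4 * int n + 1) + \<beta>"
    by (simp add: E_deg_def algebra_simps)
qed

text \<open>An entry of \<open>Mp\<close> has as degree the sum of two values of
  \<open>E_deg\<close> and \<open>hbar1\<close>, at least \<open>2 * m + 2 * \<gamma> - D\<close>.
  An entry of \<open>Pp\<close> has degree \<open>hbar2\<close> minus 2n values of
  \<open>E_deg\<close>, each at most \<gamma>, which the term 2n\<gamma> absorbs.\<close>

lemma form_matrices:
  assumes le: "\<beta> \<le> \<alpha>" and nonneg: "0 \<le> \<alpha> + \<beta>"
    and large: "\<gamma> > max (\<bar>\<alpha> + \<beta> * (4 * int n + 1)\<bar> + (2 * int n + 1) * (\<alpha> + \<beta>)) (\<alpha> * (4 * int n + 1) + \<beta>)"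
  shows "form_matrix_of_rank N (K1 n) (dual_deg n \<alpha> \<beta> \<gamma>) (K1 n) (E_deg n \<alpha> \<beta>) Phi (2*n)"
    and "form_matrix_of_rank N (K1 n) (E_deg n \<alpha> \<beta>) (ext_index n) (ext_deg n \<alpha> \<beta> \<gamma>) Psi (2*n)"
    and "hbar1 n \<alpha> \<beta> \<gamma> > 0"
proof -
  define D where "D = (2 * int n + 1) * (\<alpha> + \<beta>)"
  define m where "m = \<alpha> + \<beta> * (4 * int n + 1)"
  define e1 where "e1 = \<alpha> * (4 * int n + 1) + \<beta>"
  have D: "D \<ge> 0" using nonneg by (simp add: D_def)
  have g1: "\<gamma> > \<bar>m\<bar> + D" and g2: "\<gamma> > e1" using large by (auto simp: D_def m_def e1_def)
  have h1: "hbar1 n \<alpha> \<beta> \<gamma> = 2 * \<gamma> - D" by (simp add: hbar1_def D_def)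
  show "hbar1 n \<alpha> \<beta> \<gamma> > 0" unfolding h1 using g1 D by linarith
  have "E_deg n \<alpha> \<beta> k - dual_deg n \<alpha> \<beta> \<gamma> l \<ge> 0" if kl: "k \<in> K1 n" "l \<in> K1 n" for k l
    using E_deg_bounds(1)[OF kl(1) le] E_deg_bounds(1)[OF kl(2) le] g1 D
    unfolding dual_deg_def h1 m_def[symmetric] by linarith
  then show "form_matrix_of_rank N (K1 n) (dual_deg n \<alpha> \<beta> \<gamma>) (K1 n) (E_deg n \<alpha> \<beta>) Phi (2*n)"
    unfolding form_matrix_of_rank_def
    by (intro exI[of _ Mp]) (auto simp: Mp_form Mp_rank shf_map_eq_def)
  have "ext_deg n \<alpha> \<beta> \<gamma> J - E_deg n \<alpha> \<beta> k \<ge> 0" if J: "J \<in> ext_index n" and k: "k \<in> K1 n" for J k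
  proof -
    have "(\<Sum>l\<in>J. E_deg n \<alpha> \<beta> l) \<le> (\<Sum>l\<in>J. \<gamma>)"
      using ext_indexD(1)[OF J] E_deg_bounds(2)[OF _ le] g2 unfolding e1_def
      by (intro sum_mono) (meson less_imp_le order_trans subsetD)
    also have "\<dots> = (2 * int n - 1) * \<gamma>"
      using J n_pos by (simp add: ext_index_def of_nat_diff)
    finally have s: "(\<Sum>l\<in>J. E_deg n \<alpha> \<beta> l) \<le> (2 * int n - 1) * \<gamma>" .
    have "E_deg n \<alpha> \<beta> k \<le> \<gamma>" using E_deg_bounds(2)[OF k le] g2 unfolding e1_def by linarith
    moreover have "ext_deg n \<alpha> \<beta> \<gamma> J = - (\<Sum>l\<in>J. E_deg n \<alpha> \<beta> l) + (2 * int n * \<gamma> + 3 * (int n * D))"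
      by (simp add: ext_deg_def hbar2_def D_def sum_negf mult.assoc)
    moreover have "int n * D \<ge> 0" using D by simp
    moreover have "(2 * int n - 1) * \<gamma> = 2 * int n * \<gamma> - \<gamma>" by (simp add: algebra_simps)
    ultimately show ?thesis using s by linarith
  qed
  then show "form_matrix_of_rank N (K1 n) (E_deg n \<alpha> \<beta>) (ext_index n) (ext_deg n \<alpha> \<beta> \<gamma>) Psi (2*n)"
    unfolding form_matrix_of_rank_def
    by (intro exI[of _ Pp]) (auto simp: Pp_form Pp_rank shf_map_eq_def)
qed

lemma complex_with_factorizations:
  assumes sequence: "shf_short_exact N (N_sheaf n \<alpha> \<beta> \<gamma> f g (- \<gamma>)) (Upsilon1 n \<alpha> \<beta>) (F_gamma n \<alpha> \<beta> \<gamma> h g)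
      \<pi> (iota_map n \<alpha> \<beta> \<gamma> h g)"
  shows "\<exists>\<sigma>. shf_hom N (Upsilon1_dual n \<alpha> \<beta> \<gamma>) (N_sheaf n \<alpha> \<beta> \<gamma> f g (- \<gamma>)) \<sigma> \<and>
         shf_surj N (Upsilon1_dual n \<alpha> \<beta> \<gamma>) (N_sheaf n \<alpha> \<beta> \<gamma> f g (- \<gamma>)) \<sigma> \<and>
         shf_map_eq N (Upsilon1_dual n \<alpha> \<beta> \<gamma>) Phi (shf_comp \<pi> \<sigma>)"
    and "\<exists>\<tau>. shf_hom N (F_gamma n \<alpha> \<beta> \<gamma> h g) (Upsilon1_ext n \<alpha> \<beta> \<gamma>) \<tau> \<and>
         shf_inj N (F_gamma n \<alpha> \<beta> \<gamma> h g) \<tau> \<and>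
         shf_map_eq N (Upsilon1 n \<alpha> \<beta>) Psi (shf_comp \<tau> (iota_map n \<alpha> \<beta> \<gamma> h g))"
    and "shf_hom N (Upsilon1_dual n \<alpha> \<beta> \<gamma>) (Upsilon1 n \<alpha> \<beta>) Phi"
    and "shf_hom N (Upsilon1 n \<alpha> \<beta>) (Upsilon1_ext n \<alpha> \<beta> \<gamma>) Psi"
    and "shf_exact N (Upsilon1_dual n \<alpha> \<beta> \<gamma>) (Upsilon1 n \<alpha> \<beta>) (Upsilon1_ext n \<alpha> \<beta> \<gamma>) Phi Psi"
proof -
  note eqs = N_sheaf_eq F_gamma_eq iota_map_eq Upsilon1_def E_sheaf_def Upsilon1_dual_def Upsilon1_ext_def
  have seq: "shf_short_exact N qf.Ker Y fe.Q \<pi> (coker_proj N fe.SA fe.SB fe.\<phi>)"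
    using sequence unfolding eqs .
  then have surj: "shf_surj N Y fe.Q (coker_proj N fe.SA fe.SB fe.\<phi>)" by (simp only: shf_short_exact_def)
  show "\<exists>\<sigma>. shf_hom N (Upsilon1_dual n \<alpha> \<beta> \<gamma>) (N_sheaf n \<alpha> \<beta> \<gamma> f g (- \<gamma>)) \<sigma> \<and>
         shf_surj N (Upsilon1_dual n \<alpha> \<beta> \<gamma>) (N_sheaf n \<alpha> \<beta> \<gamma> f g (- \<gamma>)) \<sigma> \<and>
         shf_map_eq N (Upsilon1_dual n \<alpha> \<beta> \<gamma>) Phi (shf_comp \<pi> \<sigma>)"
    unfolding eqs by (rule Phi_factors[OF seq])
  show "\<exists>\<tau>. shf_hom N (F_gamma n \<alpha> \<beta> \<gamma> h g) (Upsilon1_ext n \<alpha> \<beta> \<gamma>) \<tau> \<and>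
         shf_inj N (F_gamma n \<alpha> \<beta> \<gamma> h g) \<tau> \<and>
         shf_map_eq N (Upsilon1 n \<alpha> \<beta>) Psi (shf_comp \<tau> (iota_map n \<alpha> \<beta> \<gamma> h g))"
    unfolding eqs by (rule Psi_factors[OF surj])
  show "shf_hom N (Upsilon1_dual n \<alpha> \<beta> \<gamma>) (Upsilon1 n \<alpha> \<beta>) Phi"
    unfolding eqs by (rule Phi_hom)
  show "shf_hom N (Upsilon1 n \<alpha> \<beta>) (Upsilon1_ext n \<alpha> \<beta> \<gamma>) Psi"
    unfolding eqs by (rule Psi_hom)
  show "shf_exact N (Upsilon1_dual n \<alpha> \<beta> \<gamma>) (Upsilon1 n \<alpha> \<beta>) (Upsilon1_ext n \<alpha> \<beta> \<gamma>) Phi Psi"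
    unfolding eqs by (rule Phi_Psi_exact)
qed

end

theorem proposition3p1p5:
  fixes n \<alpha> \<gamma> :: nat and \<beta> :: int
    and W :: "bivector set" and f :: "bivector \<Rightarrow> complex"
    and h :: "nat \<Rightarrow> bivector \<Rightarrow> complex" and g :: "nat \<Rightarrow> cpoly"
    and \<pi> :: "((nat \<Rightarrow> pt \<Rightarrow> complex) germ_fun, nat \<Rightarrow> pt \<Rightarrow> complex) shf_map"
  assumes "n \<ge> 1" and "\<gamma> > 0" and "int \<alpha> \<ge> \<beta>" and "int \<alpha> + \<beta> \<ge> 0"
    and "int \<gamma> > (2 * int n + 1) * \<bar>\<beta>\<bar>"
    and W_subspace: "W \<subseteq> ext_square n" "fun_vs.subspace W"
    and W_invariant: "torus_invariant n W"
    and W_dim: "fun_vs.dim W = ((2*n+2) choose 2) - 4*n - 1"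
    and W_indecomposable: "\<And>w. w \<in> W \<Longrightarrow> decomposable n w \<Longrightarrow> w = 0"
    and f_linear: "linear_form f"
    and f_nonzero: "\<exists>w \<in> ext_square n. f w \<noteq> 0"
    and f_W: "\<And>w. w \<in> W \<Longrightarrow> f w = 0"
    and f_E: "\<And>k w. k \<in> {1..4*n+1} \<Longrightarrow> k \<noteq> 2*n+1 \<Longrightarrow> w \<in> E_space n k \<Longrightarrow> f w = 0"
    and h_linear: "\<And>k. k \<in> {1..4*n+1} \<Longrightarrow> linear_form (h k)"
    and h_kernel: "\<And>k. k \<in> {1..4*n+1} \<Longrightarrow> {w \<in> E_space n k. h k w = 0} = W \<inter> E_space n k"
    and g_forms: "\<And>i. i \<le> 2*n+1 \<Longrightarrow>
      is_form (2*n+1) (int \<gamma> + (2 * int n + 1) * int \<alpha> + int i * (\<beta> - int \<alpha>)) (g i)"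
    and g_no_common_zero: "\<And>x. x \<in> cone_pts (2*n+1) \<Longrightarrow> \<exists>i\<le>2*n+1. peval (g i) x \<noteq> 0"
    and sequence: "shf_short_exact (2*n+1)
      (N_sheaf n \<alpha> \<beta> \<gamma> f g (- int \<gamma>)) (Upsilon1 n \<alpha> \<beta>) (F_gamma n \<alpha> \<beta> \<gamma> h g)
      \<pi> (iota_map n \<alpha> \<beta> \<gamma> h g)"
  shows "\<exists>\<phi> \<psi>.
    shf_hom (2*n+1) (Upsilon1_dual n \<alpha> \<beta> \<gamma>) (Upsilon1 n \<alpha> \<beta>) \<phi> \<and>
    shf_hom (2*n+1) (Upsilon1 n \<alpha> \<beta>) (Upsilon1_ext n \<alpha> \<beta> \<gamma>) \<psi> \<and>
    shf_exact (2*n+1) (Upsilon1_dual n \<alpha> \<beta> \<gamma>) (Upsilon1 n \<alpha> \<beta>) (Upsilon1_ext n \<alpha> \<beta> \<gamma>) \<phi> \<psi> \<and>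
    (\<exists>\<sigma>. shf_hom (2*n+1) (Upsilon1_dual n \<alpha> \<beta> \<gamma>) (N_sheaf n \<alpha> \<beta> \<gamma> f g (- int \<gamma>)) \<sigma> \<and>
         shf_surj (2*n+1) (Upsilon1_dual n \<alpha> \<beta> \<gamma>) (N_sheaf n \<alpha> \<beta> \<gamma> f g (- int \<gamma>)) \<sigma> \<and>
         shf_map_eq (2*n+1) (Upsilon1_dual n \<alpha> \<beta> \<gamma>) \<phi> (shf_comp \<pi> \<sigma>)) \<and>
    (\<exists>\<tau>. shf_hom (2*n+1) (F_gamma n \<alpha> \<beta> \<gamma> h g) (Upsilon1_ext n \<alpha> \<beta> \<gamma>) \<tau> \<and>
         shf_inj (2*n+1) (F_gamma n \<alpha> \<beta> \<gamma> h g) \<tau> \<and>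
         shf_map_eq (2*n+1) (Upsilon1 n \<alpha> \<beta>) \<psi> (shf_comp \<tau> (iota_map n \<alpha> \<beta> \<gamma> h g))) \<and>
    (int \<gamma> > max (\<bar>int \<alpha> + \<beta> * (4 * int n + 1)\<bar> + (2 * int n + 1) * (int \<alpha> + \<beta>))
                 (int \<alpha> * (4 * int n + 1) + \<beta>) \<longrightarrow>
       form_matrix_of_rank (2*n+1) (K1 n) (dual_deg n \<alpha> \<beta> \<gamma>) (K1 n) (E_deg n \<alpha> \<beta>) \<phi> (2*n) \<and>
       form_matrix_of_rank (2*n+1) (K1 n) (E_deg n \<alpha> \<beta>) (ext_index n) (ext_deg n \<alpha> \<beta> \<gamma>) \<psi> (2*n) \<and>
       hbar1 n \<alpha> \<beta> \<gamma> > 0)"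
proof -
  interpret instanton_data n "int \<alpha>" \<beta> "int \<gamma>" W f h g
  proof (rule instanton_data.intro)
    show "is_form (2*n+1) (int \<gamma> + S_deg n (int \<alpha>) \<beta> i) (g i)" if "i \<le> 2*n+1" for i
      using g_forms[OF that] by (simp add: S_deg_def add.assoc)
  qed (fact assms(1) W_subspace(2) W_indecomposable f_linear f_nonzero f_W f_E h_linear h_kernel g_no_common_zero)+
  show ?thesis
    by (rule exI[of _ Phi], rule exI[of _ Psi])
      (intro conjI impI complex_with_factorizations[OF sequence] form_matrices[OF assms(3,4)], assumption+)
qed

end
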